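(* Let $\varphi$ be an $N$-function with complementary function $\varphi_*$, let $I=(0,a)$ with $0<a\le\infty$, and let $w$ be a decreasing weight function on $I$, not identically zero. Then the Köthe dual of the class $M_{\varphi,w}$ is the Orlicz-Lorentz space $\Lambda_{\varphi_*,w}$, i.e. $M_{\varphi,w}'=\Lambda_{\varphi_*,w}$ as sets, and the Orlicz norm on $\Lambda_{\varphi_*,w}$ is dual to the homogeneous functional $\|\cdot\|_M$ in the sense that $$\|f\|^0_{\Lambda_{\varphi_*,w}}=\sup\left\{\int_I fg : g\in M_{\varphi,w},\ \|g\|_M\le1\right\}\qquad\text{for all } f\in\Lambda_{\varphi_*,w}.$$
   Context: An Orlicz function is a convex, strictly increasing $\varphi:\mathbb{R}_+\to\mathbb{R}_+$ with $\varphi(0)=0$; it is an $N$-function if $\lim_{t\to\infty}\varphi(t)/t=\infty$ and $\lim_{t\to0}\varphi(t)/t=0$. Its complementary function is $\varphi_*(t)=\sup_{s>0}\{st-\varphi(s)\}$. "Decreasing" means non-increasing. $L^0$ is the set of Lebesgue measurable $f:I\to\mathbb{R}$ (identified a.e.). For $f\in L^0$, $d_f(s)=|\{t\in I:|f(t)|>s\}|$ and $f^*(t)=\inf\{s\ge0:d_f(s)\le t\}$, $t\in I$ ($\inf\emptyset=\infty$). A weight function is a non-negative decreasing function in $L^0$; $\int_0^tw$ is allowed to be infinite (in which case $\Lambda_{\varphi_*,w}=\{0\}$). $M(f)=\int_I\varphi(f^*/w)w\in[0,\infty]$, where if $w(t)=0$ the integrand is $0$ if $f^*(t)=0$ and $\infty$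 otherwise (and it is $\infty$ where $f^*(t)=\infty$). $M_{\varphi,w}$ is the class (not necessarily linear) of $f\in L^0$ with $M(\lambda f)<\infty$ for some $\lambda>0$; $\|f\|_M=\inf\{\epsilon>0:M(f/\epsilon)\le1\}$. The Köthe dual of $A\subset L^0$ is $A'=\{f\in L^0: fg\in L_1(I)\ \forall g\in A\}$. $L_\varphi(w)=\{f\in L^0:\exists\lambda>0,\ \int_I\varphi(\lambda|f|)w<\infty\}$ with Luxemburg norm $\|f\|_{L_\varphi(w)}=\inf\{\epsilon>0:\int_I\varphi(|f|/\epsilon)w\le1\}$. $\Lambda_{\varphi_*,w}$ is the set of $f\in L^0$ with $f^*\in L_{\varphi_*}(w)$, and its Orlicz norm is $\|f\|^0_{\Lambda_{\varphi_*,w}}=\sup\{\int_I f^*gw: g\in L_\varphi(w),\ \|g\|_{L_\varphi(w)}\le1\}$. *)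

theory Defs
  imports "HOL-Analysis.Analysis"
begin

text \<open>
  Functions on the interval \<open>I = (0, a)\<close>, \<open>0 < a \<le> \<infinity>\<close>, are represented by total functions
  \<open>real \<Rightarrow> real\<close> whose values outside \<open>I\<close> are irrelevant; \<open>I\<close> is \<open>einterval 0 a\<close> with
  \<open>a :: ereal\<close>. Functions are not quotiented by equality almost everywhere; all the classes
  below are closed under it, so that equality of classes means the same thing as in the quotient.
  Functions \<open>\<real>\<^sub>+ \<rightarrow> \<real>\<^sub>+\<close> are likewise total functions considered on \<open>{0..}\<close> only.
\<close>

abbreviation leb_I :: "ereal \<Rightarrow> real measure" where
  "leb_I a \<equiv> lebesgue_on (einterval 0 a)"

definition L0 :: "ereal \<Rightarrow> (real \<Rightarrow> real) set" where
  "L0 a = borel_measurable (leb_I a)"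

definition orlicz_function :: "(real \<Rightarrow> real) \<Rightarrow> bool" where
  "orlicz_function \<phi> \<longleftrightarrow>
     (\<forall>t\<ge>0. 0 \<le> \<phi> t) \<and> convex_on {0..} \<phi> \<and> strict_mono_on {0..} \<phi> \<and> \<phi> 0 = 0"

definition N_function :: "(real \<Rightarrow> real) \<Rightarrow> bool" where
  "N_function \<phi> \<longleftrightarrow> orlicz_function \<phi> \<and>
     filterlim (\<lambda>t. \<phi> t / t) at_top at_top \<and> ((\<lambda>t. \<phi> t / t) \<longlongrightarrow> 0) (at_right 0)"

text \<open>
  The supremum is taken in \<open>real\<close>; for an N-function the set is bounded above, because
  \<open>\<phi> s / s \<rightarrow> \<infinity>\<close>.
\<close>
definition complementary :: "(real \<Rightarrow> real) \<Rightarrow> real \<Rightarrow> real" where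
  "complementary \<phi> t = (SUP s\<in>{0<..}. s * t - \<phi> s)"

definition weight_function :: "ereal \<Rightarrow> (real \<Rightarrow> real) \<Rightarrow> bool" where
  "weight_function a w \<longleftrightarrow> w \<in> L0 a \<and> (\<forall>t\<in>einterval 0 a. 0 \<le> w t) \<and>
     antimono_on (einterval 0 a) w"

definition distr_fun :: "ereal \<Rightarrow> (real \<Rightarrow> real) \<Rightarrow> real \<Rightarrow> ennreal" where
  "distr_fun a f s = emeasure (leb_I a) {t \<in> einterval 0 a. s < \<bar>f t\<bar>}"

text \<open>The infimum is taken in \<open>[0, \<infinity>]\<close>, so that it is \<open>\<infinity>\<close> for the empty set.\<close>
definition rearrangement :: "ereal \<Rightarrow> (real \<Rightarrow> real) \<Rightarrow> real \<Rightarrow> ennreal" where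
  "rearrangement a f t = Inf {ennreal s | s. 0 \<le> s \<and> distr_fun a f s \<le> ennreal t}"

definition M_integrand ::
  "(real \<Rightarrow> real) \<Rightarrow> (real \<Rightarrow> real) \<Rightarrow> ereal \<Rightarrow> (real \<Rightarrow> real) \<Rightarrow> real \<Rightarrow> ennreal" where
  "M_integrand \<phi> w a f t =
     (if rearrangement a f t = \<infinity> then \<infinity>
      else if w t = 0 then (if rearrangement a f t = 0 then 0 else \<infinity>)
      else ennreal (\<phi> (enn2real (rearrangement a f t) / w t) * w t))"

definition M_modular ::
  "(real \<Rightarrow> real) \<Rightarrow> (real \<Rightarrow> real) \<Rightarrow> ereal \<Rightarrow> (real \<Rightarrow> real) \<Rightarrow> ennreal" where
  "M_modular \<phi> w a f = (\<integral>\<^sup>+ t. M_integrand \<phi> w a f t \<partial>leb_I a)"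

definition M_class ::
  "(real \<Rightarrow> real) \<Rightarrow> (real \<Rightarrow> real) \<Rightarrow> ereal \<Rightarrow> (real \<Rightarrow> real) set" where
  "M_class \<phi> w a = {f \<in> L0 a. \<exists>c>0. M_modular \<phi> w a (\<lambda>t. c * f t) < \<infinity>}"

definition M_norm ::
  "(real \<Rightarrow> real) \<Rightarrow> (real \<Rightarrow> real) \<Rightarrow> ereal \<Rightarrow> (real \<Rightarrow> real) \<Rightarrow> ennreal" where
  "M_norm \<phi> w a f = Inf {ennreal e | e. 0 < e \<and> M_modular \<phi> w a (\<lambda>t. f t / e) \<le> 1}"

definition kothe_dual :: "ereal \<Rightarrow> (real \<Rightarrow> real) set \<Rightarrow> (real \<Rightarrow> real) set" where
  "kothe_dual a A = {f \<in> L0 a. \<forall>g\<in>A. integrable (leb_I a) (\<lambda>t. f t * g t)}"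

definition Lw_class ::
  "(real \<Rightarrow> real) \<Rightarrow> (real \<Rightarrow> real) \<Rightarrow> ereal \<Rightarrow> (real \<Rightarrow> real) set" where
  "Lw_class \<phi> w a =
     {f \<in> L0 a. \<exists>c>0. (\<integral>\<^sup>+ t. ennreal (\<phi> (c * \<bar>f t\<bar>) * w t) \<partial>leb_I a) < \<infinity>}"

definition Lw_norm ::
  "(real \<Rightarrow> real) \<Rightarrow> (real \<Rightarrow> real) \<Rightarrow> ereal \<Rightarrow> (real \<Rightarrow> real) \<Rightarrow> ennreal" where
  "Lw_norm \<phi> w a f =
     Inf {ennreal e | e. 0 < e \<and> (\<integral>\<^sup>+ t. ennreal (\<phi> (\<bar>f t\<bar> / e) * w t) \<partial>leb_I a) \<le> 1}"

text \<open>
  Membership of the rearrangement in a class of real functions includes its finiteness; as it is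
  decreasing, finiteness almost everywhere and everywhere on \<open>I\<close> coincide.
\<close>
definition Lambda_space ::
  "(real \<Rightarrow> real) \<Rightarrow> (real \<Rightarrow> real) \<Rightarrow> ereal \<Rightarrow> (real \<Rightarrow> real) set" where
  "Lambda_space \<psi> w a =
     {f \<in> L0 a. (\<forall>t\<in>einterval 0 a. rearrangement a f t < \<infinity>) \<and>
        (\<lambda>t. enn2real (rearrangement a f t)) \<in> Lw_class \<psi> w a}"

text \<open>
  The Orlicz norm on \<open>Lambda_space (complementary \<phi>) w a\<close>, for \<open>f\<close> in that space (where the
  rearrangement is finite and, by Young's inequality, the integrals exist). The supremum is taken
  in the extended reals.
\<close>
definition Lambda_orlicz_norm ::
  "(real \<Rightarrow> real) \<Rightarrow> (real \<Rightarrow> real) \<Rightarrow> ereal \<Rightarrow> (real \<Rightarrow> real) \<Rightarrow> ereal" where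
  "Lambda_orlicz_norm \<phi> w a f =
     (SUP g\<in>{g \<in> Lw_class \<phi> w a. Lw_norm \<phi> w a g \<le> 1}.
        ereal (\<integral> t. enn2real (rearrangement a f t) * g t * w t \<partial>leb_I a))"

end

theory Submission
  imports Defs
begin

text \<open>
  Write \<open>K\<close> for the decreasing functions \<open>k \<ge> 0\<close> on \<open>I\<close> with \<open>\<integral> \<phi>(k/w) w \<le> 1\<close>. If \<open>k\<close> is
  decreasing and \<open>f\<^sup>*\<close> is finite, then for every \<open>b > 1\<close> some \<open>g\<close> satisfies \<open>g\<^sup>* \<le> k\<close> and
  \<open>\<integral> f\<^sup>* k \<le> b \<integral> |f| g\<close>: order \<open>I\<close> by the levels \<open>b\<^sup>n \<le> |f| < b\<^sup>n\<^sup>+\<^sup>1\<close> (higher levels first) and by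
  position within each level, let \<open>\<tau> x\<close> be the measure of the predecessors of \<open>x\<close>, and put
  \<open>g = k \<circ> \<tau>\<close>. So \<open>f\<close> can be tested against \<open>K\<close> instead of against \<open>M\<close>; unlike the unit ball of
  \<open>M\<close>, \<open>K\<close> is closed under the convex combinations \<open>\<Sum> 2\<^sup>-\<^sup>n k\<^sub>n\<close>, so \<open>k \<mapsto> \<integral> f\<^sup>* k\<close> is bounded on \<open>K\<close> by
  some \<open>C\<close> whenever \<open>f\<close> is in the dual. The equality case of Young's inequality then yields
  \<open>\<integral> \<phi>\<^sub>*(f\<^sup>*/C) w \<le> 1\<close>. The converse inclusion is the Hardy-Littlewood inequality followed by Young's
  inequality, and \<open>h = g\<^sup>*/w\<close> turns it into one inequality between the norms. For the other one,
  a function \<open>h\<close> in the ball of \<open>L\<^sub>\<phi>(w)\<close> is replaced by its decreasing rearrangement with respect to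
  \<open>w(t) dt\<close>, whose product with \<open>w\<close> belongs to \<open>K\<close>.
\<close>

section \<open>Layer cakes and rearrangements\<close>

text \<open>Sums are the obstacle in \<open>M\<close>: \<open>(f + g)\<^sup>*\<close> is not bounded
  pointwise by \<open>f\<^sup>* + g\<^sup>*\<close>. Members of \<open>K\<close> are decreasing from
  the start and are added pointwise, so the convexity of \<open>\<phi>\<close> applies.

  The factor \<open>b\<close> is the price for functions that cannot be transported exactly. On
  \<open>(0, \<infinity>)\<close> the function \<open>max 0 (1 - 1/x)\<close> has rearrangement
  constantly 1, a value it never takes; ordered by the size of its values, every point of its
  support is preceded by infinite mass. Coarse levels cure this: within a level position decides,
  and the part of \<open>I\<close> in front of a point has finite length. Since suprema are
  compared, \<open>b\<close> can tend to 1 at the end.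

  Two finiteness facts must come beforehand. If \<open>|f|\<close> exceeded every level on a set of
  infinite measure, all ranks would be infinite; an element of the dual is shown to avoid this. And
  the rearrangement with respect to \<open>w(t) dt\<close> requires a finite mass of
  \<open>w\<close> near 0, which a nonzero element of the Orlicz-Lorentz space enforces.\<close>

lemma nn_integral_layer_cake:
  fixes u v :: "'a \<Rightarrow> ennreal"
  assumes "sigma_finite_measure M" and [measurable]: "u \<in> borel_measurable M" "v \<in> borel_measurable M"
  shows "(\<integral>\<^sup>+x. u x * v x \<partial>M) =
    (\<integral>\<^sup>+r. indicator {0<..} r * (\<integral>\<^sup>+x. indicator {x. ennreal r < u x} x * v x \<partial>M) \<partial>lborel)"
proof -
  interpret M: sigma_finite_measure M by fact
  interpret P: pair_sigma_finite M lborel ..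
  \<comment> \<open>Since \<open>ennreal\<close> sends negative reals to 0, the levels are cut to
    \<open>r > 0\<close>; otherwise all negative \<open>r\<close> would count and the length could
    not be \<open>u x\<close>.\<close>
  have u: "u x = (\<integral>\<^sup>+r. indicator {0<..} r * indicator {r. ennreal r < u x} r \<partial>lborel)" for x
  proof -
    have "(\<integral>\<^sup>+r. indicator {0<..} r * indicator {r. ennreal r < u x} r \<partial>lborel) =
        (\<integral>\<^sup>+r. indicator {r. 0 < r \<and> ennreal r < u x} r \<partial>lborel)"
      by (intro nn_integral_cong) (auto split: split_indicator)
    also have "\<dots> = emeasure lborel {r. 0 < r \<and> ennreal r < u x}"
      by (intro nn_integral_indicator) measurable
    also have "\<dots> = u x"
    proof (cases "u x")
      case (real c)
      then have "{r. 0 < r \<and> ennreal r < u x} = {0<..<c}"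
        by (auto simp: ennreal_less_iff)
      then show ?thesis using real by simp
    next
      case top
      then have "{r. 0 < r \<and> ennreal r < u x} = {0<..}" by auto
      moreover have "emeasure lborel {0::real<..} = \<infinity>"
      proof -
        have "{0<..<real n} \<subseteq> {0<..}" for n by auto
        then have "of_nat n \<le> emeasure lborel {0::real<..}" for n
          using emeasure_mono[of "{0<..<real n}" "{0<..}" lborel]
          by (simp add: ennreal_of_nat_eq_real_of_nat)
        then show ?thesis
          by (metis ennreal_Ex_less_of_nat infinity_ennreal_def leD top.not_eq_extremum)
      qed
      ultimately show ?thesis using top by simp
    qed
    finally show ?thesis ..
  qed
  have "(\<integral>\<^sup>+x. u x * v x \<partial>M) =
      (\<integral>\<^sup>+x. \<integral>\<^sup>+r. indicator {0<..} r * indicator {r. ennreal r < u x} r * v x \<partial>lborel \<partial>M)"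
    by (subst u, subst nn_integral_multc) auto
  also have "\<dots> = (\<integral>\<^sup>+r. \<integral>\<^sup>+x. indicator {0<..} r * indicator {r. ennreal r < u x} r * v x \<partial>M \<partial>lborel)"
    by (rule P.Fubini'[symmetric]) measurable
  also have "\<dots> = (\<integral>\<^sup>+r. indicator {0<..} r * (\<integral>\<^sup>+x. indicator {x. ennreal r < u x} x * v x \<partial>M) \<partial>lborel)"
    by (subst nn_integral_cmult[symmetric]) (auto intro!: nn_integral_cong simp: mult.assoc split: split_indicator)
  finally show ?thesis .
qed

text \<open>The layer cake in both factors writes the integral of a product as a double integral of
  the measures of \<open>{u > r, v > s}\<close> over positive \<open>r\<close> and \<open>s\<close>.
  The two sides may live on different spaces.\<close>

lemma nn_integral_mult_le_by_levels:
  fixes u v :: "'a \<Rightarrow> ennreal" and U V :: "'b \<Rightarrow> ennreal"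
  assumes "sigma_finite_measure M" "sigma_finite_measure N"
    and [measurable]: "u \<in> borel_measurable M" "v \<in> borel_measurable M"
      "U \<in> borel_measurable N" "V \<in> borel_measurable N"
    and le: "\<And>r s. 0 < r \<Longrightarrow> 0 < s \<Longrightarrow>
      emeasure M {x \<in> space M. ennreal r < u x \<and> ennreal s < v x} \<le>
      emeasure N {x \<in> space N. ennreal r < U x \<and> ennreal s < V x}"
  shows "(\<integral>\<^sup>+x. u x * v x \<partial>M) \<le> (\<integral>\<^sup>+x. U x * V x \<partial>N)"
proof -
  have *: "(\<integral>\<^sup>+x. u x * v x \<partial>M) =
    (\<integral>\<^sup>+r. indicator {0<..} r * (\<integral>\<^sup>+s. indicator {0<..} s *
       emeasure M {x \<in> space M. ennreal r < u x \<and> ennreal s < v x} \<partial>lborel) \<partial>lborel)"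
    if "sigma_finite_measure M" and [measurable]: "u \<in> borel_measurable M" "v \<in> borel_measurable M"
    for M :: "'c measure" and u v
  proof -
    have in1: "(\<integral>\<^sup>+x. indicator {x. ennreal s < v x} x * indicator {x. ennreal r < u x} x \<partial>M)
      = emeasure M {x \<in> space M. ennreal r < u x \<and> ennreal s < v x}" (is "?l = _") for r s
    proof -
      have "?l = (\<integral>\<^sup>+x. indicator {x \<in> space M. ennreal r < u x \<and> ennreal s < v x} x \<partial>M)"
        by (intro nn_integral_cong) (auto split: split_indicator)
      also have "\<dots> = emeasure M {x \<in> space M. ennreal r < u x \<and> ennreal s < v x}"
        by (intro nn_integral_indicator) measurable
      finally show ?thesis .
    qed
    have "(\<integral>\<^sup>+x. indicator {x. ennreal r < u x} x * v x \<partial>M) =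
      (\<integral>\<^sup>+s. indicator {0<..} s *
       emeasure M {x \<in> space M. ennreal r < u x \<and> ennreal s < v x} \<partial>lborel)" for r
      using nn_integral_layer_cake[OF that(1,3), of "indicator {x. ennreal r < u x}"]
      by (simp add: in1 mult.commute)
    then show ?thesis
      using nn_integral_layer_cake[OF that] by simp
  qed
  show ?thesis
    unfolding *[OF assms(1,3,4)] *[OF assms(2,5,6)]
    by (intro nn_integral_mono) (auto split: split_indicator intro!: nn_integral_mono le)
qed

lemma nn_integral_le_by_levels:
  fixes u :: "'a \<Rightarrow> ennreal" and U :: "'b \<Rightarrow> ennreal"
  assumes "sigma_finite_measure M" "sigma_finite_measure N"
    and [measurable]: "u \<in> borel_measurable M" "U \<in> borel_measurable N"
    and le: "\<And>r. 0 < r \<Longrightarrow>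
      emeasure M {x \<in> space M. ennreal r < u x} \<le> emeasure N {x \<in> space N. ennreal r < U x}"
  shows "(\<integral>\<^sup>+x. u x \<partial>M) \<le> (\<integral>\<^sup>+x. U x \<partial>N)"
proof -
  have "(\<integral>\<^sup>+x. u x * 1 \<partial>M) \<le> (\<integral>\<^sup>+x. U x * 1 \<partial>N)"
  proof (rule nn_integral_mult_le_by_levels[OF assms(1,2)])
    fix r s :: real
    assume rs: "0 < r" "0 < s"
    show "emeasure M {x \<in> space M. ennreal r < u x \<and> ennreal s < 1}
       \<le> emeasure N {x \<in> space N. ennreal r < U x \<and> ennreal s < 1}"
      using le[OF rs(1)] by (cases "ennreal s < 1") auto
  qed auto
  then show ?thesis by simp
qed

text \<open>The measure is arbitrary and the argument is a mass, not a point of the space. Lebesgue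
  measure and mass \<open>t\<close> give \<open>f\<^sup>*\<close>; the rearrangement with respect to
  \<open>w(t) dt\<close> is read off at the mass that \<open>w\<close> puts in front of
  \<open>t\<close>.\<close>

definition rearr :: "'a measure \<Rightarrow> ('a \<Rightarrow> real) \<Rightarrow> ennreal \<Rightarrow> ennreal" where
  "rearr M f m = Inf {ennreal s | s. 0 \<le> s \<and> emeasure M {x \<in> space M. s < \<bar>f x\<bar>} \<le> m}"

lemma rearrangement_eq_rearr: "rearrangement a f t = rearr (leb_I a) f (ennreal t)"
  by (simp add: rearrangement_def rearr_def distr_fun_def)

text \<open>Holds with strict inequalities because the distribution function is right-continuous:
  the sets \<open>{|f| > s + 1/(n+1)}\<close> increase to \<open>{|f| > s}\<close>, and continuity
  from below is valid for infinite measures too. It turns superlevel sets of a rearrangement into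
  initial segments.\<close>

lemma less_rearr_iff:
  assumes [measurable]: "f \<in> borel_measurable M" and s: "0 \<le> s"
  shows "ennreal s < rearr M f m \<longleftrightarrow> m < emeasure M {x \<in> space M. s < \<bar>f x\<bar>}"
proof
  assume l: "ennreal s < rearr M f m"
  show "m < emeasure M {x \<in> space M. s < \<bar>f x\<bar>}"
  proof (rule ccontr)
    assume "\<not> m < emeasure M {x \<in> space M. s < \<bar>f x\<bar>}"
    then have "rearr M f m \<le> ennreal s"
      unfolding rearr_def using s by (intro Inf_lower) auto
    with l show False by simp
  qed
next
  assume m: "m < emeasure M {x \<in> space M. s < \<bar>f x\<bar>}"
  let ?A = "\<lambda>n. {x \<in> space M. s + 1 / real (Suc n) < \<bar>f x\<bar>}"
  have "(SUP n. emeasure M (?A n)) = emeasure M (\<Union>n. ?A n)"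
    by (rule SUP_emeasure_incseq)
      (auto simp: incseq_def frac_le order_le_less_trans[rotated] intro!: add_left_mono)
  also have "(\<Union>n. ?A n) = {x \<in> space M. s < \<bar>f x\<bar>}"
  proof (intro equalityI subsetI)
    fix x assume x: "x \<in> {x \<in> space M. s < \<bar>f x\<bar>}"
    then obtain n where "inverse (real (Suc n)) < \<bar>f x\<bar> - s"
      using reals_Archimedean[of "\<bar>f x\<bar> - s"] by auto
    then have "x \<in> ?A n" using x by (auto simp: field_simps)
    then show "x \<in> (\<Union>n. ?A n)" by blast
  next
    fix x assume "x \<in> (\<Union>n. ?A n)"
    then obtain n where "x \<in> space M" "s + 1 / real (Suc n) < \<bar>f x\<bar>" by auto
    moreover have "0 < 1 / real (Suc n)" by simp
    ultimately show "x \<in> {x \<in> space M. s < \<bar>f x\<bar>}" by (smt (verit) mem_Collect_eq)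
  qed
  finally have eq: "emeasure M {x \<in> space M. s < \<bar>f x\<bar>} = (SUP n. emeasure M (?A n))" ..
  from m obtain n where n: "m < emeasure M (?A n)"
    unfolding eq less_SUP_iff by auto
  have "ennreal (s + 1 / real (Suc n)) \<le> rearr M f m"
    unfolding rearr_def
  proof (rule Inf_greatest, safe)
    fix s' :: real
    assume s': "0 \<le> s'" "emeasure M {x \<in> space M. s' < \<bar>f x\<bar>} \<le> m"
    show "ennreal (s + 1 / real (Suc n)) \<le> ennreal s'"
    proof (rule ccontr)
      assume "\<not> ?thesis"
      then have "s' < s + 1 / real (Suc n)"
        using s' by (simp add: ennreal_le_iff not_le)
      then have "emeasure M (?A n) \<le> emeasure M {x \<in> space M. s' < \<bar>f x\<bar>}"
        by (intro emeasure_mono) auto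
      with s' n show False by auto
    qed
  qed
  moreover have "ennreal s < ennreal (s + 1 / real (Suc n))"
    using s by (subst ennreal_less_iff) (auto simp: add_pos_pos)
  ultimately show "ennreal s < rearr M f m" by order
qed

lemma rearr_antimono: "m \<le> m' \<Longrightarrow> rearr M f m' \<le> rearr M f m"
  unfolding rearr_def by (rule Inf_superset_mono) auto

lemma borel_measurable_rearr[measurable]:
  assumes [measurable]: "f \<in> borel_measurable M"
  shows "rearr M f \<in> borel_measurable borel"
proof (rule borel_measurableI_greater)
  fix y :: ennreal
  show "{x \<in> space borel. y < rearr M f x} \<in> sets borel"
  proof (cases y)
    case (real s)
    then show ?thesis by (simp add: less_rearr_iff)
  qed simp
qed

lemma borel_measurable_rearrangement[measurable]:
  assumes "f \<in> borel_measurable (leb_I a)"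
  shows "rearrangement a f \<in> borel_measurable borel"
  using assms unfolding rearrangement_eq_rearr[abs_def] by measurable

lemma rearrangement_antimono: "t \<le> t' \<Longrightarrow> rearrangement a f t' \<le> rearrangement a f t"
  by (simp add: rearrangement_eq_rearr rearr_antimono ennreal_leI)

lemma less_rearrangement_iff:
  assumes "f \<in> borel_measurable (leb_I a)" "0 \<le> s"
  shows "ennreal s < rearrangement a f t \<longleftrightarrow> ennreal t < distr_fun a f s"
  using less_rearr_iff[OF assms] by (simp add: rearrangement_eq_rearr distr_fun_def)

lemma rearrangement_le_iff:
  assumes "f \<in> borel_measurable (leb_I a)" "0 \<le> s"
  shows "rearrangement a f t \<le> ennreal s \<longleftrightarrow> distr_fun a f s \<le> ennreal t"
  using less_rearrangement_iff[OF assms, of t] by (simp add: not_less[symmetric])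

lemma sigma_finite_lebesgue_on:
  assumes "S \<in> sets lebesgue"
  shows "sigma_finite_measure (lebesgue_on S)"
proof -
  have "sigma_finite_measure lebesgue"
  proof
    show "\<exists>A. countable A \<and> A \<subseteq> sets lebesgue \<and> \<Union> A = space lebesgue \<and> (\<forall>a\<in>A. emeasure lebesgue a \<noteq> \<infinity>)"
      using sigma_finite_measure.sigma_finite_countable[OF sigma_finite_lborel]
      by (metis emeasure_completion main_part_sets sets_completionI_sets space_completion subset_iff main_part)
  qed
  then show ?thesis using sigma_finite_measure_restrict_space assms by blast
qed

section \<open>Initial segments of the interval and their mass\<close>

lemma einterval_0_down: "y \<in> einterval 0 a \<Longrightarrow> 0 < x \<Longrightarrow> x \<le> y \<Longrightarrow> x \<in> einterval 0 a"
  by (auto simp: einterval_iff le_less_trans[of "ereal x" "ereal y" a])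

lemma borel_downward_closed:
  fixes S :: "real set"
  assumes down: "\<And>x y. y \<in> S \<Longrightarrow> x \<le> y \<Longrightarrow> x \<in> S"
  shows "S \<in> sets borel"
proof (cases "S = {} \<or> S = UNIV")
  case False
  then obtain z y where z: "z \<notin> S" "y \<in> S" by auto
  then have bdd: "bdd_above S" using down by (intro bdd_aboveI[of _ z]) (meson linear)
  have "{..<Sup S} \<subseteq> S" using less_cSup_iff[OF _ bdd] down z(2) by fastforce
  moreover have "S \<subseteq> {..Sup S}" using bdd by (auto intro: cSup_upper)
  ultimately have "S = {..<Sup S} \<or> S = {..Sup S}"
    by (cases "Sup S \<in> S") (auto simp: order.order_iff_strict subset_iff)
  then show ?thesis by (metis atMost_borel lessThan_borel)
qed auto

lemma borel_measurable_mono_ennreal: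
  fixes f :: "real \<Rightarrow> ennreal"
  assumes "mono f"
  shows "f \<in> borel_measurable borel"
proof (rule borel_measurableI_less)
  fix y
  show "{x \<in> space borel. f x < y} \<in> sets borel"
    by (rule borel_downward_closed) (auto intro: le_less_trans[OF monoD[OF assms]])
qed

text \<open>The points with mass less than \<open>m\<close> in front of them form an initial segment
  \<open>J\<close>. Continuity from below, with a null end point, bounds its mass by
  \<open>m\<close>; if \<open>J\<close> is not the whole interval, continuity from above at the
  infimum of the complement shows that \<open>m\<close> is reached.\<close>

lemma emeasure_lower_mass_less:
  fixes M :: "real measure"
  assumes sp: "space M = einterval 0 a"
    and sets: "\<And>B. B \<in> sets borel \<Longrightarrow> B \<inter> einterval 0 a \<in> sets M"
    and atomless: "\<And>c. emeasure M {c} = 0"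
    and fin: "\<And>t. t \<in> einterval 0 a \<Longrightarrow> emeasure M {x \<in> einterval 0 a. x < t} < \<infinity>"
  shows "emeasure M {t \<in> einterval 0 a. emeasure M {x \<in> einterval 0 a. x < t} < m} = min m (emeasure M (einterval 0 a))"
proof -
  define I where "I = einterval 0 a"
  define W where "W t = emeasure M {x \<in> I. x < t}" for t
  have lower_sets[simp]: "{x \<in> I. x < t} \<in> sets M" "{x \<in> I. x \<le> t} \<in> sets M" for t
    using sets[of "{..<t}"] sets[of "{..t}"] by (auto simp: I_def Int_def conj_commute)
  have Wmono: "W s \<le> W t" if "s \<le> t" for s t
    unfolding W_def using that by (intro emeasure_mono) auto
  have Wle: "emeasure M {x \<in> I. x \<le> t} = W t" for t
  proof -
    have pt: "{t} \<inter> I \<in> sets M" using sets[of "{t}"] by (simp add: I_def)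
    have "emeasure M ({t} \<inter> I) = 0" using atomless[of t] by (cases "t \<in> I") auto
    moreover have "emeasure M {x \<in> I. x \<le> t} \<le> emeasure M ({x \<in> I. x < t} \<union> ({t} \<inter> I))"
      using pt by (intro emeasure_mono sets.Un) auto
    moreover have "\<dots> \<le> W t + emeasure M ({t} \<inter> I)"
      unfolding W_def using pt by (intro emeasure_subadditive) auto
    ultimately have "emeasure M {x \<in> I. x \<le> t} \<le> W t" by simp
    moreover have "W t \<le> emeasure M {x \<in> I. x \<le> t}"
      unfolding W_def by (intro emeasure_mono) auto
    ultimately show ?thesis by order
  qed
  define J where "J = {t \<in> I. W t < m}"
  have Jdown: "x \<in> J" if "y \<in> J" "x \<in> I" "x \<le> y" for x y
    using that Wmono[of x y] by (auto simp: J_def)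
  have I0: "0 < x" if "x \<in> I" for x using that by (auto simp: I_def einterval_iff)
  have Jsets: "J \<in> sets M"
  proof -
    have "{t. W t < m} \<in> sets borel"
      by (rule borel_downward_closed) (auto intro: Wmono le_less_trans)
    then have "{t. W t < m} \<inter> I \<in> sets M"
      unfolding I_def by (rule sets)
    moreover have "{t. W t < m} \<inter> I = J" by (auto simp: J_def)
    ultimately show ?thesis by simp
  qed
  have up: "emeasure M J \<le> m"
  proof (cases "J = {}")
    case False
    \<comment> \<open>The supremum is extended because \<open>J\<close> may be unbounded. Whether
      \<open>c\<close> belongs to \<open>J\<close> is immaterial: it contributes at most one point,
      hence mass 0.\<close>
    define c where "c = Sup (ereal ` J)"
    obtain j where j: "j \<in> J" using False by auto
    have csets: "{x \<in> I. ereal x = c} \<in> sets M"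
      using sets[of "{x. ereal x = c}"] by (auto simp: I_def Int_def conj_commute)
    have "0 < ereal j" "ereal j \<le> c" using j I0[of j] by (auto simp: c_def J_def intro: SUP_upper)
    then have "0 < c" by order
    then obtain X :: "nat \<Rightarrow> real" where X: "incseq X" "\<And>i. ereal (X i) < c" "(\<lambda>i. ereal (X i)) \<longlonglongrightarrow> c"
      using ereal_incseq_approx[of 0 c] by metis
    have "emeasure M J \<le> emeasure M ((\<Union>i. {x \<in> I. x < X i}) \<union> {x \<in> I. ereal x = c})"
    proof (rule emeasure_mono)
      show "J \<subseteq> (\<Union>i. {x \<in> I. x < X i}) \<union> {x \<in> I. ereal x = c}"
      proof
        fix x assume x: "x \<in> J"
        then have "ereal x \<le> c" by (auto simp: c_def intro: SUP_upper)
        moreover have "\<exists>i. x < X i" if "ereal x < c"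
          using order_tendstoD(1)[OF X(3) that] by (auto simp: eventually_sequentially)
        ultimately show "x \<in> (\<Union>i. {x \<in> I. x < X i}) \<union> {x \<in> I. ereal x = c}"
          using x by (auto simp: J_def less_le)
      qed
      show "(\<Union>i. {x \<in> I. x < X i}) \<union> {x \<in> I. ereal x = c} \<in> sets M"
        using csets by (intro sets.Un sets.countable_UN) auto
    qed
    also have "\<dots> \<le> emeasure M (\<Union>i. {x \<in> I. x < X i}) + emeasure M {x \<in> I. ereal x = c}"
      using csets by (intro emeasure_subadditive sets.countable_UN) auto
    also have "{x \<in> I. ereal x = c} = {} \<or> (\<exists>x. {x \<in> I. ereal x = c} = {x})" by auto
    then have "emeasure M {x \<in> I. ereal x = c} = 0" by (metis atomless emeasure_empty)
    also have "emeasure M (\<Union>i. {x \<in> I. x < X i}) = (SUP i. emeasure M {x \<in> I. x < X i})"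
      using X(1) by (intro SUP_emeasure_incseq[symmetric]) (auto simp: incseq_def intro: less_le_trans)
    also have "\<dots> \<le> m"
    proof (rule SUP_least)
      fix i
      obtain y where "y \<in> J" "X i < y"
        using X(2)[of i] by (auto simp: c_def less_SUP_iff)
      then show "emeasure M {x \<in> I. x < X i} \<le> m"
        using Wmono[of "X i" y] by (auto simp: J_def W_def)
    qed
    finally show ?thesis by simp
  qed simp
  have low: "min m (emeasure M I) \<le> emeasure M J"
  proof (cases "J = I")
    case False
    then obtain t1 where t1: "t1 \<in> I" "m \<le> W t1" by (auto simp: J_def not_less[symmetric])
    \<comment> \<open>This infimum can be 0, outside \<open>I\<close>. The mass in front of it is
      therefore approached from points \<open>T n\<close> of \<open>I\<close> to its right, where
      \<open>fin\<close> permits continuity from above.\<close>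
    define c where "c = Inf (I - J)"
    have bdd: "bdd_below (I - J)" using I0 by (intro bdd_belowI[of _ 0]) (auto intro: less_imp_le)
    have c1: "c \<le> t1" unfolding c_def using t1 by (intro cInf_lower bdd) (auto simp: J_def)
    have c0: "0 \<le> c" unfolding c_def using t1 I0
      by (intro cInf_greatest) (auto simp: J_def intro: less_imp_le)
    have sub: "{x \<in> I. x < c} \<subseteq> J"
      using cInf_lower[OF _ bdd] by (force simp: c_def)
    have "m \<le> W c"
    proof (cases "c = t1")
      case False
      with c1 have c1: "c < t1" by simp
      define T where "T n = c + (t1 - c) / real (Suc n)" for n
      have Tc: "c < T n" for n using c1 by (auto simp: T_def field_simps)
      have Tt: "T n \<le> t1" for n
      proof -
        have "(t1 - c) / real (Suc n) \<le> (t1 - c) / 1"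
          using c1 by (intro divide_left_mono) auto
        then show ?thesis by (simp add: T_def del: of_nat_Suc)
      qed
      have TI: "T n \<in> I" for n
        using einterval_0_down[of t1 a "T n"] t1 Tc[of n] Tt[of n] c0 by (auto simp: I_def)
      have Td: "decseq T" unfolding T_def decseq_def using c1 by (auto intro!: divide_left_mono mult_pos_pos)
      have "(\<lambda>n. (t1 - c) / real (Suc n)) \<longlonglongrightarrow> 0"
        by (rule LIMSEQ_Suc[OF lim_const_over_n])
      from tendsto_add[OF tendsto_const[of c] this] have T_lim: "T \<longlonglongrightarrow> c"
        by (simp add: T_def[abs_def])
      have "m \<le> (INF n. emeasure M {x \<in> I. x < T n})"
      proof (rule INF_greatest)
        fix n
        have "I - J \<noteq> {}" using t1 by (auto simp: J_def)
        then obtain y where "y \<in> I - J" "y < T n"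
          using cInf_lessD[of "I - J" "T n"] Tc[of n] by (auto simp: c_def)
        then have "m \<le> W y" "W y \<le> W (T n)" by (auto simp: J_def not_less intro: Wmono)
        then show "m \<le> emeasure M {x \<in> I. x < T n}" by (auto simp: W_def)
      qed
      also have "\<dots> = emeasure M (\<Inter>n. {x \<in> I. x < T n})"
        using Td fin[OF TI[unfolded I_def], folded I_def]
        by (intro INF_emeasure_decseq) (auto simp: decseq_def less_le_trans less_top[symmetric])
      also have "\<dots> \<le> emeasure M {x \<in> I. x \<le> c}"
      proof (intro emeasure_mono subsetI)
          fix x assume "x \<in> (\<Inter>n. {x \<in> I. x < T n})"
          then have "x \<in> I" "\<And>n. x \<le> T n" by (auto intro: less_imp_le)
          then show "x \<in> {x \<in> I. x \<le> c}" using LIMSEQ_le_const[OF T_lim, of x] by auto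
        qed simp
      finally show ?thesis by (simp add: Wle)
    qed (use t1 in simp)
    also have "\<dots> \<le> emeasure M J"
      unfolding W_def by (intro emeasure_mono sub Jsets)
    finally show ?thesis by (simp add: min_le_iff_disj)
  qed simp
  have "emeasure M J \<le> emeasure M I"
    using sp by (intro emeasure_mono) (auto simp: J_def I_def sets.top[of M, unfolded sp])
  with up low have "emeasure M J = min m (emeasure M I)" by (auto intro: antisym)
  then show ?thesis by (simp add: J_def I_def W_def)
qed

lemma borel_Int_in_leb_I: "B \<in> sets borel \<Longrightarrow> B \<inter> einterval 0 a \<in> sets (leb_I a)"
  by (auto simp: sets_restrict_space)

lemma sets_leb_I_less [measurable]: "{x \<in> einterval 0 a. x < t} \<in> sets (leb_I a)"
  using borel_Int_in_leb_I[of "{..<t}" a] by (simp add: Int_def conj_commute)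

lemma emeasure_density_leb_I_singleton:
  assumes [measurable]: "w \<in> borel_measurable (leb_I a)"
  shows "emeasure (density (leb_I a) w) {c} = 0"
proof (cases "c \<in> einterval 0 a")
  case True
  then have c: "{c} \<in> sets (leb_I a)" using borel_Int_in_leb_I[of "{c}" a] by simp
  have "emeasure (leb_I a) {c} = 0"
    using True by (subst emeasure_restrict_space) auto
  then have "{c} \<in> null_sets (leb_I a)" using c by (auto simp: null_sets_def)
  then have "AE x in leb_I a. x \<notin> {c}" by (rule AE_not_in)
  then have "AE x in leb_I a. x \<in> {c} \<longrightarrow> w x = 0" by (rule eventually_mono) auto
  then have "{c} \<in> null_sets (density (leb_I a) w)"
    using c by (subst null_sets_density_iff[OF assms]) auto
  then show ?thesis by auto
next
  case False
  \<comment> \<open>Outside the interval the singleton is not measurable, and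
    \<open>emeasure\<close> is 0 on such sets by convention.\<close>
  then have "{c} \<notin> sets (density (leb_I a) w)"
    using sets.sets_into_space[of "{c}" "leb_I a"] by auto
  then show ?thesis by (rule emeasure_notin_sets)
qed

lemma emeasure_leb_I_less:
  assumes "t \<in> einterval 0 a"
  shows "emeasure (leb_I a) {x \<in> einterval 0 a. x < t} = ennreal t"
proof -
  have "{x \<in> einterval 0 a. x < t} = {0<..<t}"
    using assms by (auto simp: einterval_iff) (meson less_trans ereal_less_le less_ereal.simps(1))
  moreover have "0 < t" using assms by (simp add: einterval_iff)
  ultimately show ?thesis
    by (subst emeasure_restrict_space) auto
qed

lemma emeasure_leb_I_less_le: "emeasure (leb_I a) {x \<in> einterval 0 a. x < t} \<le> ennreal t"
proof -
  have "emeasure (leb_I a) {x \<in> einterval 0 a. x < t} = emeasure lebesgue {x \<in> einterval 0 a. x < t}"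
    by (subst emeasure_restrict_space) auto
  also have "\<dots> \<le> emeasure lebesgue {0<..<t}"
    by (intro emeasure_mono) (auto simp: einterval_iff)
  also have "\<dots> \<le> ennreal t" by (cases "0 \<le> t") auto
  finally show ?thesis .
qed

text \<open>The preceding result for Lebesgue measure restricted to \<open>E\<close>, encoded as a
  density so that the underlying space stays the interval. It cuts from \<open>E\<close> an initial
  part of prescribed measure.\<close>

lemma emeasure_leb_I_mass_less:
  assumes E: "E \<in> sets (leb_I a)"
  shows "emeasure (leb_I a) {x \<in> E. emeasure (leb_I a) {y \<in> E. y < x} < m} = min m (emeasure (leb_I a) E)"
proof -
  let ?I = "einterval 0 a"
  let ?M = "density (leb_I a) (indicator E)"
  have M: "emeasure ?M X = emeasure (leb_I a) (E \<inter> X)" if "X \<in> sets (leb_I a)" for X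
    using emeasure_restricted[OF E that] .
  have EI: "E \<subseteq> ?I" using sets.sets_into_space[OF E] by simp
  have lower: "emeasure ?M {x \<in> ?I. x < t} = emeasure (leb_I a) {y \<in> E. y < t}" for t
    using EI by (subst M) (auto intro!: arg_cong[where f="emeasure (leb_I a)"])
  have "(\<lambda>t. emeasure ?M {x \<in> ?I. x < t}) \<in> borel_measurable borel"
    by (intro borel_measurable_mono_ennreal monoI emeasure_mono) auto
  then have "{t. emeasure ?M {x \<in> ?I. x < t} < m} \<in> sets borel" by simp
  from borel_Int_in_leb_I[OF this, of a]
  have S: "{t \<in> ?I. emeasure ?M {x \<in> ?I. x < t} < m} \<in> sets (leb_I a)"
    by (simp add: Int_def conj_commute)
  have "emeasure ?M {t \<in> ?I. emeasure ?M {x \<in> ?I. x < t} < m} = min m (emeasure ?M ?I)"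
  proof (rule emeasure_lower_mass_less)
    show "emeasure ?M {c} = 0" for c
      using E by (intro emeasure_density_leb_I_singleton) auto
    fix t assume t: "t \<in> ?I"
    have "emeasure ?M {x \<in> ?I. x < t} \<le> emeasure (leb_I a) {x \<in> ?I. x < t}"
      unfolding lower using EI by (intro emeasure_mono) auto
    then show "emeasure ?M {x \<in> ?I. x < t} < \<infinity>"
      using emeasure_leb_I_less[OF t] by (simp add: le_less_trans)
  qed (auto simp: borel_Int_in_leb_I)
  moreover have "E \<inter> {t \<in> ?I. emeasure ?M {x \<in> ?I. x < t} < m} =
      {x \<in> E. emeasure (leb_I a) {y \<in> E. y < x} < m}"
    using EI by (auto simp: lower)
  moreover have "E \<inter> ?I = E" using EI by auto
  ultimately show ?thesis
    using M[OF S] M[of ?I] sets.top[of "leb_I a"] by simp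
qed

lemma emeasure_leb_I_ennreal_less:
  "emeasure (leb_I a) {x \<in> einterval 0 a. ennreal x < m} = min m (emeasure (leb_I a) (einterval 0 a))"
proof -
  have "{x \<in> einterval 0 a. ennreal x < m} =
    {x \<in> einterval 0 a. emeasure (leb_I a) {y \<in> einterval 0 a. y < x} < m}"
    using emeasure_leb_I_less by auto
  then show ?thesis
    using emeasure_leb_I_mass_less[of "einterval 0 a" a m] sets.top[of "leb_I a"] by simp
qed

text \<open>Order \<open>S\<close> by \<open>N\<close> and then by position; \<open>\<tau> x\<close>
  is the mass in front of \<open>x\<close>. Below a critical level \<open>p\<close> every rank is
  less than \<open>m\<close>, above it (up to \<open>n\<close>) none is, and inside it an initial
  part of mass \<open>m - c\<close> is cut off. The levels are unbounded below, so
  \<open>small\<close> is what gives the search for \<open>p\<close> a starting point.\<close>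

lemma emeasure_rank_less:
  fixes N :: "real \<Rightarrow> int" and S :: "real set" and a :: ereal
  defines "L \<equiv> leb_I a"
  defines "\<tau> \<equiv> \<lambda>x. emeasure L {y \<in> S. N y < N x} + emeasure L {y \<in> S. N y = N x \<and> y < x}"
  assumes S: "S \<in> sets L" and [measurable]: "N \<in> measurable L (count_space UNIV)"
    and small: "\<And>e. 0 < e \<Longrightarrow> \<exists>n. emeasure L {x \<in> S. N x \<le> n} < e"
  shows "emeasure L {x \<in> S. N x \<le> n \<and> \<tau> x < m} = min m (emeasure L {x \<in> S. N x \<le> n})"
proof (cases "m = 0")
  case False
  have SI: "S \<subseteq> space L" using sets.sets_into_space[OF S] .
  have Sset: "{x \<in> S. P x} \<in> sets L" if "{x \<in> space L. P x} \<in> sets L" for P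
  proof -
    have "{x \<in> S. P x} = S \<inter> {x \<in> space L. P x}" using SI by auto
    then show ?thesis using that S by auto
  qed
  have [measurable]: "{x \<in> S. N x \<le> i} \<in> sets L" "{x \<in> S. N x < i} \<in> sets L" "{x \<in> S. N x = i} \<in> sets L" for i
    by (auto intro!: Sset)
  obtain n0 where n0: "emeasure L {x \<in> S. N x \<le> n0} < m"
    using small[of m] False by (auto simp: zero_less_iff_neq_zero)
  \<comment> \<open>\<open>p\<close> is the level in which the mass \<open>m\<close> is used up, or
    \<open>n\<close> if that does not happen before. Levels up to \<open>n0\<close> have total mass
    below \<open>m\<close>, so a finite range is left to search.\<close>
  obtain p where p: "p \<le> n" "emeasure L {x \<in> S. N x < p} < m"
    "p = n \<or> m \<le> emeasure L {x \<in> S. N x \<le> p}"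
  proof (cases "n \<le> n0")
    case True
    then have "emeasure L {x \<in> S. N x < n} \<le> emeasure L {x \<in> S. N x \<le> n0}"
      by (intro emeasure_mono) auto
    with n0 that[of n] show ?thesis by auto
  next
    case False
    define P where "P = {p \<in> {n0 + 1..n}. emeasure L {x \<in> S. N x < p} < m}"
    have fin: "finite P" unfolding P_def by (rule finite_subset[of _ "{n0 + 1..n}"]) auto
    have "n0 + 1 \<in> P" using False n0 by (auto simp: P_def)
    then have mP: "Max P \<in> P" using fin by (intro Max_in) auto
    have "m \<le> emeasure L {x \<in> S. N x \<le> Max P}" if "Max P \<noteq> n"
    proof -
      have "Max P + 1 \<notin> P" using Max_ge[OF fin, of "Max P + 1"] by auto
      moreover have "Max P + 1 \<in> {n0 + 1..n}" using mP that by (auto simp: P_def)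
      ultimately show ?thesis by (auto simp: P_def not_less)
    qed
    then show ?thesis using mP that[of "Max P"] by (auto simp: P_def)
  qed
  define c where "c = emeasure L {x \<in> S. N x < p}"
  define D where "D = {x \<in> S. N x = p}"
  have D: "D \<in> sets L" by (simp add: D_def)
  have le_p: "emeasure L {x \<in> S. N x \<le> p} = c + emeasure L D"
    unfolding c_def D_def by (subst plus_emeasure) (auto intro!: arg_cong[where f="emeasure L"])
  have cm: "c < m" using p(2) by (simp add: c_def)
  have "{x \<in> S. N x \<le> n \<and> \<tau> x < m} = {x \<in> S. N x < p} \<union> {x \<in> D. emeasure L {y \<in> D. y < x} < m - c}"
    (is "?A = ?B")
  proof (intro set_eqI)
    fix x
    consider "x \<notin> S" | "x \<in> S" "N x < p" | "x \<in> S" "N x = p" | "x \<in> S" "N x > p" by linarith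
    then show "x \<in> ?A \<longleftrightarrow> x \<in> ?B"
    proof cases
      case 2
      have "\<tau> x \<le> emeasure L {y \<in> S. N y < N x} + emeasure L {y \<in> S. N y = N x}"
        unfolding \<tau>_def by (intro add_left_mono emeasure_mono) auto
      also have "\<dots> = emeasure L {y \<in> S. N y \<le> N x}"
        by (subst plus_emeasure) (auto intro!: arg_cong[where f="emeasure L"])
      also have "\<dots> \<le> c" unfolding c_def using 2 by (intro emeasure_mono) auto
      finally show ?thesis using 2 cm p(1) by auto
    next
      case 3
      have "\<tau> x = c + emeasure L {y \<in> D. y < x}"
        using 3 by (simp add: \<tau>_def c_def D_def conj_ac)
      \<comment> \<open>From \<open>c < m\<close> it follows that \<open>c\<close> is finite, so the
        subtraction behaves even for infinite \<open>m\<close>.\<close>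
      also have "\<dots> < m \<longleftrightarrow> emeasure L {y \<in> D. y < x} < m - c"
        using cm by (metis add.commute less_diff_eq_ennreal top.not_eq_extremum)
      finally show ?thesis using 3 p(1) by (auto simp: D_def)
    next
      case 4
      have "m \<le> \<tau> x" if "N x \<le> n"
      proof -
        have "m \<le> emeasure L {x \<in> S. N x \<le> p}" using p(3) 4 that by auto
        also have "\<dots> \<le> emeasure L {y \<in> S. N y < N x}" using 4 by (intro emeasure_mono) auto
        also have "\<dots> \<le> \<tau> x" by (simp add: \<tau>_def)
        finally show ?thesis .
      qed
      then show ?thesis using 4 by (auto simp: D_def)
    qed (auto simp: D_def)
  qed
  moreover have "emeasure L ?B = c + emeasure L {x \<in> D. emeasure L {y \<in> D. y < x} < m - c}"
  proof -
    have "(\<lambda>t. emeasure L {y \<in> D. y < t}) \<in> borel_measurable borel"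
    proof (intro borel_measurable_mono_ennreal monoI emeasure_mono)
      have "{y \<in> D. y < t} = D \<inter> {y \<in> einterval 0 a. y < t}" for t
        using sets.sets_into_space[OF D] by (auto simp: L_def)
      then show "{y \<in> D. y < t} \<in> sets L" for t using D by (auto simp: L_def)
    qed auto
    then have "{t. emeasure L {y \<in> D. y < t} < m - c} \<in> sets borel" by simp
    from borel_Int_in_leb_I[OF this, of a]
    have "D \<inter> ({t. emeasure L {y \<in> D. y < t} < m - c} \<inter> einterval 0 a) \<in> sets L"
      using D by (auto simp: L_def)
    also have "D \<inter> ({t. emeasure L {y \<in> D. y < t} < m - c} \<inter> einterval 0 a) =
        {x \<in> D. emeasure L {y \<in> D. y < x} < m - c}"
      using sets.sets_into_space[OF D] by (auto simp: L_def)
    finally show ?thesis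
      unfolding c_def by (subst plus_emeasure) (auto simp: D_def)
  qed
  moreover have "emeasure L {x \<in> D. emeasure L {y \<in> D. y < x} < m - c} = min (m - c) (emeasure L D)"
    using emeasure_leb_I_mass_less D by (simp add: L_def)
  moreover have "c + min (m - c) (emeasure L D) = min m (c + emeasure L D)"
  proof -
    have eq: "c + (m - c) = m" using cm by auto
    show ?thesis
    proof (cases "m - c \<le> emeasure L D")
      case True
      then have "m \<le> c + emeasure L D" using add_left_mono[OF True, of c] by (simp only: eq)
      then show ?thesis unfolding min_absorb1[OF True] eq by (simp add: min_absorb1)
    next
      case False
      then have le: "emeasure L D \<le> m - c" by simp
      have "c + emeasure L D \<le> m" using add_left_mono[OF le, of c] by (simp only: eq)
      then show ?thesis unfolding min_absorb2[OF le] by (simp add: min_absorb2)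
    qed
  qed
  ultimately have *: "emeasure L {x \<in> S. N x \<le> n \<and> \<tau> x < m} = min m (emeasure L {x \<in> S. N x \<le> p})"
    by (simp add: le_p)
  show ?thesis
  proof (cases "p = n")
    case False
    then have "m \<le> emeasure L {x \<in> S. N x \<le> p}" using p(3) by simp
    also have "\<dots> \<le> emeasure L {x \<in> S. N x \<le> n}" using p(1) by (intro emeasure_mono) auto
    finally show ?thesis using * \<open>m \<le> emeasure L {x \<in> S. N x \<le> p}\<close> by (simp add: min_absorb1)
  qed (use * in simp)
qed (simp add: min_absorb1)

section \<open>Realizing a decreasing function as a rearrangement\<close>

lemma borel_measurable_antimono_on_einterval:
  fixes k :: "real \<Rightarrow> real"
  assumes "antimono_on (einterval 0 a) k"
  shows "(\<lambda>x. if x \<in> einterval 0 a then k x else 0) \<in> borel_measurable borel"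
proof -
  have "mono_on (einterval 0 a) (\<lambda>x. - k x)"
    using assms by (auto simp: monotone_on_def)
  then have "(\<lambda>x. - k x) \<in> borel_measurable (restrict_space borel (einterval 0 a))"
    by (rule borel_measurable_mono_on_fnc)
  then have "(\<lambda>x. indicator (einterval 0 a) x *\<^sub>R (- k x)) \<in> borel_measurable borel"
    by (subst (asm) borel_measurable_restrict_space_iff) auto
  then have "(\<lambda>x. - (indicator (einterval 0 a) x *\<^sub>R (- k x))) \<in> borel_measurable borel"
    by simp
  also have "(\<lambda>x. - (indicator (einterval 0 a) x *\<^sub>R (- k x))) =
      (\<lambda>x. if x \<in> einterval 0 a then k x else 0)"
    by (auto simp: fun_eq_iff)
  finally show ?thesis .
qed

text \<open>Both \<open>{f\<^sup>* > r}\<close> and \<open>{k > s}\<close> are initial segments up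
  to null sets, so their intersection has at most the smaller of the two masses. The ranking gives
  the set of points of high level and rank below the mass of \<open>{k > s}\<close> exactly such a
  mass, and there \<open>b |f| > r\<close> and, off rank 0, \<open>g > s\<close>.\<close>

lemma rearrangement_realization:
  assumes f: "f \<in> L0 a" and s0: "0 \<le> s0" "distr_fun a f s0 < \<infinity>"
    and k: "antimono_on (einterval 0 a) k" "\<And>t. t \<in> einterval 0 a \<Longrightarrow> 0 \<le> k t"
    and b: "1 < b"
  obtains g where "g \<in> L0 a" "\<And>x. 0 \<le> g x"
    "\<And>t. t \<in> einterval 0 a \<Longrightarrow> rearrangement a g t \<le> ennreal (k t)"
    "(\<integral>\<^sup>+t. rearrangement a f t * ennreal (k t) \<partial>leb_I a) \<le>
      ennreal b * (\<integral>\<^sup>+x. ennreal (\<bar>f x\<bar> * g x) \<partial>leb_I a)"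
proof -
  define I where "I = einterval 0 a"
  define L where "L = leb_I a"
  define S where "S = {x \<in> I. f x \<noteq> 0}"
  \<comment> \<open>The sign is reversed because ranks start from the smallest \<open>N\<close>,
    while the largest values of \<open>|f|\<close> must come first.\<close>
  define N where "N x = - \<lfloor>log b \<bar>f x\<bar>\<rfloor>" for x
  define \<tau> where "\<tau> x = emeasure L {y \<in> S. N y < N x} + emeasure L {y \<in> S. N y = N x \<and> y < x}" for x
  have spL[simp]: "space L = I" by (simp add: L_def I_def)
  have [measurable]: "f \<in> borel_measurable L" using f by (simp add: L0_def L_def)
  have [measurable]: "N \<in> measurable L (count_space UNIV)"
    unfolding N_def[abs_def] by measurable
  have Sset[measurable]: "S \<in> sets L"
  proof -
    have "{x \<in> space L. f x \<noteq> 0} \<in> sets L" by measurable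
    then show ?thesis by (simp add: S_def)
  qed
  have SI: "S \<subseteq> I" by (auto simp: S_def)
  have pw: "y < b powr r \<longleftrightarrow> log b y < r" "b powr r \<le> y \<longleftrightarrow> r \<le> log b y"
    "b powr r < y \<longleftrightarrow> r < log b y" if "0 < y" for r y
    using b that by (auto simp: log_less_iff less_log_iff le_log_iff)
  have idn[measurable]: "(\<lambda>x. x) \<in> measurable L borel"
    unfolding L_def by (intro measurable_restrict_space1 measurable_completion) simp
  have [measurable]: "\<tau> \<in> borel_measurable L"
  proof -
    have "(\<lambda>x. emeasure L {y \<in> S. N y = i \<and> y < x}) \<in> borel_measurable borel" for i
    proof (intro borel_measurable_mono_ennreal monoI emeasure_mono)
      fix t :: real
      have "{y \<in> space L. y \<in> S \<and> N y = i \<and> y < t} \<in> sets L" by measurable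
      also have "{y \<in> space L. y \<in> S \<and> N y = i \<and> y < t} = {y \<in> S. N y = i \<and> y < t}"
        using SI by auto
      finally show "{y \<in> S. N y = i \<and> y < t} \<in> sets L" .
    qed auto
    then have "(\<lambda>x. emeasure L {y \<in> S. N y < i} + emeasure L {y \<in> S. N y = i \<and> y < x}) \<in> borel_measurable L" for i
      using measurable_compose[OF idn] by (intro borel_measurable_add) auto
    then show ?thesis
      unfolding \<tau>_def[abs_def] by (rule measurable_compose_countable) measurable
  qed
  have small: "\<exists>n. emeasure L {x \<in> S. N x \<le> n} < e" if e: "0 < e" for e
  proof -
    \<comment> \<open>\<open>N x \<le> n0\<close> forces \<open>|f x| \<ge> s0 + 1\<close>. Adding 1
      keeps the logarithm meaningful at \<open>s0 = 0\<close> and makes the comparison with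
      \<open>s0\<close> strict.\<close>
    define n0 where "n0 = - \<lceil>log b (s0 + 1)\<rceil>"
    let ?A = "\<lambda>i::nat. {x \<in> S. N x \<le> n0 - int i}"
    have As: "?A i \<in> sets L" for i
    proof -
      have "{x \<in> space L. x \<in> S \<and> N x \<le> n0 - int i} \<in> sets L" by measurable
      also have "{x \<in> space L. x \<in> S \<and> N x \<le> n0 - int i} = ?A i" using SI by auto
      finally show ?thesis .
    qed
    have "?A 0 \<subseteq> {x \<in> I. s0 < \<bar>f x\<bar>}"
    proof
      fix x assume x: "x \<in> ?A 0"
      then have "log b (s0 + 1) \<le> log b \<bar>f x\<bar>" by (simp add: N_def n0_def) linarith
      then have "s0 + 1 \<le> \<bar>f x\<bar>" using x s0(1) b by (simp add: S_def)
      then show "x \<in> {x \<in> I. s0 < \<bar>f x\<bar>}" using x by (auto simp: S_def)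
    qed
    moreover have "{x \<in> space L. s0 < \<bar>f x\<bar>} \<in> sets L" by measurable
    ultimately have fin: "emeasure L (?A 0) < \<infinity>"
      using s0(2) emeasure_mono[of "?A 0" "{x \<in> I. s0 < \<bar>f x\<bar>}" L]
      by (simp add: distr_fun_def L_def I_def le_less_trans)
    have "emeasure L (?A i) \<noteq> \<infinity>" for i
    proof -
      have "emeasure L (?A i) \<le> emeasure L (?A 0)" using As[of 0] by (intro emeasure_mono) auto
      with fin show ?thesis by auto
    qed
    moreover have "decseq ?A" by (auto simp: decseq_def)
    ultimately have "(\<lambda>i. emeasure L (?A i)) \<longlonglongrightarrow> emeasure L (\<Inter>i. ?A i)"
      using As by (intro Lim_emeasure_decseq) auto
    also have "(\<Inter>i. ?A i) = {}"
    proof -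
      have "x \<notin> ?A (nat (n0 - N x + 1))" for x by auto
      then show ?thesis by blast
    qed
    finally have "eventually (\<lambda>i. emeasure L (?A i) < e) sequentially"
      using e by (intro order_tendstoD(2)) auto
    then show ?thesis by (auto simp: eventually_sequentially)
  qed
  have P: "emeasure L {x \<in> S. N x \<le> n \<and> \<tau> x < m} = min m (emeasure L {x \<in> S. N x \<le> n})" for n m
    unfolding \<tau>_def L_def
    by (rule emeasure_rank_less) (use small in \<open>auto simp: L_def[symmetric]\<close>)
  have Pset[measurable, simp]:
    "{x \<in> S. N x \<le> n} \<in> sets L" "{x \<in> S. \<tau> x \<le> m} \<in> sets L"
    "{x \<in> S. N x \<le> n \<and> \<tau> x < m} \<in> sets L" "{x \<in> S. N x \<le> n \<and> \<tau> x = 0} \<in> sets L"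
    "{x \<in> S. N x \<le> n \<and> 0 < \<tau> x \<and> \<tau> x < m} \<in> sets L" for n m
  proof -
    have *: "{x \<in> S. Q x} \<in> sets L" if "{x \<in> space L. Q x} \<in> sets L" for Q
    proof -
      have "{x \<in> S. Q x} = S \<inter> {x \<in> space L. Q x}" using SI by auto
      then show ?thesis using that by auto
    qed
    show "{x \<in> S. N x \<le> n} \<in> sets L" "{x \<in> S. \<tau> x \<le> m} \<in> sets L"
      "{x \<in> S. N x \<le> n \<and> \<tau> x < m} \<in> sets L" "{x \<in> S. N x \<le> n \<and> \<tau> x = 0} \<in> sets L"
      "{x \<in> S. N x \<le> n \<and> 0 < \<tau> x \<and> \<tau> x < m} \<in> sets L"
      by (rule *, measurable)+
  qed
  \<comment> \<open>\<open>P\<close> counts strict ranks in levels bounded by \<open>n\<close>.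
    Exhausting the levels after relaxing \<open>\<tau> \<le> m\<close> to
    \<open>\<tau> < m + e\<close> removes both restrictions.\<close>
  have Pall: "emeasure L {x \<in> S. \<tau> x \<le> m} \<le> m" for m
  proof (rule ennreal_le_epsilon)
    fix e :: real
    assume m: "m < top" and e: "0 < e"
    have "{x \<in> S. \<tau> x \<le> m} \<subseteq> (\<Union>i. {x \<in> S. N x \<le> int i \<and> \<tau> x < m + e})"
    proof
      fix x assume x: "x \<in> {x \<in> S. \<tau> x \<le> m}"
      have "m < m + e"
        using m e by (cases m) (auto simp: ennreal_plus[symmetric] ennreal_less_iff simp del: ennreal_plus)
      with x have "\<tau> x < m + e" by (auto intro: le_less_trans)
      moreover have "N x \<le> int (nat (N x))" by simp
      ultimately show "x \<in> (\<Union>i. {x \<in> S. N x \<le> int i \<and> \<tau> x < m + e})" using x by blast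
    qed
    then have "emeasure L {x \<in> S. \<tau> x \<le> m} \<le> emeasure L (\<Union>i. {x \<in> S. N x \<le> int i \<and> \<tau> x < m + e})"
      by (intro emeasure_mono sets.countable_UN) auto
    also have "\<dots> = (SUP i. emeasure L {x \<in> S. N x \<le> int i \<and> \<tau> x < m + e})"
      by (intro SUP_emeasure_incseq[symmetric]) (auto simp: incseq_def)
    also have "\<dots> \<le> m + e" by (rule SUP_least) (simp add: P)
    finally show "emeasure L {x \<in> S. \<tau> x \<le> m} \<le> m + e" .
  qed
  define k' where "k' x = (if x \<in> I then k x else 0)" for x
  have [measurable]: "k' \<in> borel_measurable borel"
    unfolding k'_def[abs_def] I_def using k(1) by (rule borel_measurable_antimono_on_einterval)
  have kI: "k y \<le> k x" if "x \<in> I" "y \<in> I" "x \<le> y" for x y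
    using k(1) that by (auto simp: monotone_on_def I_def)
  have Idown: "x \<in> I" if "y \<in> I" "0 < x" "x \<le> y" for x y
    using that einterval_0_down unfolding I_def by blast
  have I0: "0 < x" if "x \<in> I" for x using that by (simp add: I_def einterval_iff)
  have k'0: "0 \<le> k' x" for x using k(2) by (auto simp: k'_def I_def)
  \<comment> \<open>The value of \<open>k\<close> at \<open>0\<close> is irrelevant, and \<open>enn2real\<close> sends \<open>\<infinity>\<close> to \<open>0\<close>.\<close>
  define g where "g x = (if x \<in> S \<and> \<tau> x \<noteq> 0 \<and> \<tau> x \<noteq> \<infinity> then k' (enn2real (\<tau> x)) else 0)" for x
  have g_meas[measurable]: "g \<in> borel_measurable L"
    unfolding g_def[abs_def] by measurable
  have g0: "0 \<le> g x" for x using k'0 by (simp add: g_def)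
  have kset: "{x \<in> I. s < k x} \<in> sets L" for s
  proof -
    have "{x \<in> space L. s < k' x} \<in> sets L" by measurable
    then show ?thesis by (simp add: k'_def cong: conj_cong)
  qed
  define m where "m s = emeasure L {x \<in> I. s < k x}" for s
  have Lless: "emeasure L {x \<in> I. x < t} \<le> ennreal t" for t
    using emeasure_leb_I_less_le by (simp add: L_def I_def)
  \<comment> \<open>If \<open>g x > s\<close> and \<open>t\<close> is the rank of \<open>x\<close>,
    then \<open>k > s\<close> on all of \<open>(0, t]\<close>, so \<open>t\<close> is at most the
    length of \<open>{k > s}\<close>.\<close>
  have g_up: "distr_fun a g s \<le> m s" if s: "0 \<le> s" for s
  proof -
    have "distr_fun a g s = emeasure L {x \<in> I. s < \<bar>g x\<bar>}"
      by (simp add: distr_fun_def L_def I_def)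
    also have "\<dots> \<le> emeasure L {x \<in> S. \<tau> x \<le> m s}"
    proof (rule emeasure_mono)
      show "{x \<in> I. s < \<bar>g x\<bar>} \<subseteq> {x \<in> S. \<tau> x \<le> m s}"
      proof
        fix x assume "x \<in> {x \<in> I. s < \<bar>g x\<bar>}"
        then have x: "x \<in> S" "\<tau> x \<noteq> 0" "\<tau> x \<noteq> \<infinity>" "s < k' (enn2real (\<tau> x))"
          using s k'0 by (auto simp: g_def split: if_splits)
        define t where "t = enn2real (\<tau> x)"
        have t: "t \<in> I" "s < k t" using x(4) s by (auto simp: k'_def t_def split: if_splits)
        have "\<tau> x = ennreal t" using x(3) by (simp add: t_def less_top)
        also have "\<dots> = emeasure L {y \<in> I. y < t}"
          using emeasure_leb_I_less[of t a] t(1) by (simp add: L_def I_def)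
        also have "\<dots> \<le> m s"
          unfolding m_def using kset t kI by (intro emeasure_mono) (auto intro: less_le_trans)
        finally show "x \<in> {x \<in> S. \<tau> x \<le> m s}" using x(1) by simp
      qed
    qed auto
    also have "\<dots> \<le> m s" by (rule Pall)
    finally show ?thesis .
  qed
  \<comment> \<open>Conversely, if \<open>k\<close> were at most \<open>s\<close> at the rank
    \<open>t\<close>, or \<open>t\<close> lay beyond \<open>I\<close>, then \<open>{k > s}\<close>
    would be contained in \<open>(0, t)\<close>.\<close>
  have g_low: "s < g x" if x: "x \<in> S" "0 < \<tau> x" "\<tau> x < m s" and s: "0 \<le> s" for x s
  proof -
    define t where "t = enn2real (\<tau> x)"
    have fin: "\<tau> x \<noteq> \<infinity>" using x(3) by auto
    then have t: "\<tau> x = ennreal t" by (simp add: t_def less_top)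
    have t0: "0 < t" using t x(2) by (simp add: )
    have "t \<in> I \<and> s < k t"
    proof (rule ccontr)
      assume c: "\<not> ?thesis"
      have "m s \<le> emeasure L {y \<in> I. y < t}"
        unfolding m_def
      proof (rule emeasure_mono)
        show "{x \<in> I. s < k x} \<subseteq> {y \<in> I. y < t}"
          using c Idown[OF _ t0] kI by (force simp: not_less)
        show "{y \<in> I. y < t} \<in> sets L" using sets_leb_I_less by (simp add: L_def I_def)
      qed
      also have "\<dots> \<le> \<tau> x" using Lless t by simp
      finally show False using x(3) by simp
    qed
    then show ?thesis using x fin by (auto simp: g_def k'_def t_def)
  qed
  have g_star: "rearrangement a g t \<le> ennreal (k t)" if t: "t \<in> I" for t
  proof -
    have "distr_fun a g (k t) \<le> m (k t)" using k(2) t by (intro g_up) (simp add: I_def)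
    also have "\<dots> \<le> emeasure L {x \<in> I. x < t}"
      unfolding m_def
    proof (rule emeasure_mono)
      show "{x \<in> I. k t < k x} \<subseteq> {x \<in> I. x < t}" using kI[OF t] by (force simp: not_less)
      show "{y \<in> I. y < t} \<in> sets L" using sets_leb_I_less by (simp add: L_def I_def)
    qed
    also have "\<dots> \<le> ennreal t" by (rule Lless)
    finally show ?thesis
      using k(2)[of t] t g_meas by (simp add: rearrangement_le_iff L_def I_def)
  qed
  \<comment> \<open>Rank 0, where \<open>g\<close> was set to 0, therefore costs nothing in the
    comparison of levels.\<close>
  have null: "emeasure L {x \<in> S. N x \<le> n \<and> \<tau> x = 0} = 0" for n
  proof -
    have "emeasure L {x \<in> S. N x \<le> n \<and> \<tau> x = 0} \<le> emeasure L {x \<in> S. \<tau> x \<le> 0}"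
      by (intro emeasure_mono) auto
    also have "\<dots> \<le> 0" by (rule Pall)
    finally show ?thesis by simp
  qed
  have fstar[measurable]: "rearrangement a f \<in> borel_measurable L"
    using measurable_compose[OF idn borel_measurable_rearrangement] f by (simp add: L0_def)
  have "(\<integral>\<^sup>+t. rearrangement a f t * ennreal (k' t) \<partial>L) \<le> (\<integral>\<^sup>+x. ennreal (b * \<bar>f x\<bar>) * ennreal (g x) \<partial>L)"
  proof (rule nn_integral_mult_le_by_levels)
    show "sigma_finite_measure L" "sigma_finite_measure L"
      unfolding L_def by (auto intro!: sigma_finite_lebesgue_on)
    show "rearrangement a f \<in> borel_measurable L" by (rule fstar)
    show "(\<lambda>t. ennreal (k' t)) \<in> borel_measurable L" by measurable
    fix r s :: real
    assume r: "0 < r" and s: "0 < s"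
    \<comment> \<open>\<open>|f| > r\<close> implies \<open>N \<le> n\<close>, but
      \<open>N \<le> n\<close> gives back only \<open>b |f| > r\<close>: rounding the logarithm
      loses less than 1. This is the origin of the factor \<open>b\<close>.\<close>
    define n where "n = - \<lfloor>log b r\<rfloor>"
    have "emeasure L {x \<in> I. ennreal r < rearrangement a f x} \<le> emeasure L {x \<in> S. N x \<le> n}"
    proof -
      have "emeasure L {x \<in> I. ennreal r < rearrangement a f x} = emeasure L {x \<in> I. ennreal x < distr_fun a f r}"
        using f r by (simp add: less_rearrangement_iff L0_def)
      also have "\<dots> \<le> distr_fun a f r"
        unfolding L_def I_def emeasure_leb_I_ennreal_less by simp
      also have "\<dots> = emeasure L {x \<in> I. r < \<bar>f x\<bar>}"
        by (simp add: distr_fun_def L_def I_def)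
      also have "\<dots> \<le> emeasure L {x \<in> S. N x \<le> n}"
      proof (rule emeasure_mono)
        show "{x \<in> I. r < \<bar>f x\<bar>} \<subseteq> {x \<in> S. N x \<le> n}"
          using r b by (auto simp: S_def N_def n_def intro!: floor_mono)
      qed auto
      finally show ?thesis .
    qed
    moreover have "{x \<in> I. ennreal s < ennreal (k' x)} = {x \<in> I. s < k x}"
      using s by (auto simp: k'_def ennreal_less_iff)
    ultimately have "emeasure L {x \<in> I. ennreal r < rearrangement a f x \<and> ennreal s < ennreal (k' x)} \<le>
        min (m s) (emeasure L {x \<in> S. N x \<le> n})"
    proof (intro min.boundedI)
      assume e: "{x \<in> I. ennreal s < ennreal (k' x)} = {x \<in> I. s < k x}"
      show "emeasure L {x \<in> I. ennreal r < rearrangement a f x \<and> ennreal s < ennreal (k' x)} \<le> m s"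
        unfolding m_def e[symmetric] using kset[of s] e by (intro emeasure_mono) auto
      assume e2: "emeasure L {x \<in> I. ennreal r < rearrangement a f x} \<le> emeasure L {x \<in> S. N x \<le> n}"
      have "{x \<in> space L. ennreal r < rearrangement a f x} \<in> sets L"
        by measurable
      then have "emeasure L {x \<in> I. ennreal r < rearrangement a f x \<and> ennreal s < ennreal (k' x)} \<le>
        emeasure L {x \<in> I. ennreal r < rearrangement a f x}"
        by (intro emeasure_mono) auto
      with e2 show "emeasure L {x \<in> I. ennreal r < rearrangement a f x \<and> ennreal s < ennreal (k' x)} \<le>
        emeasure L {x \<in> S. N x \<le> n}" by order
    qed
    also have "\<dots> = emeasure L {x \<in> S. N x \<le> n \<and> \<tau> x < m s}" by (simp add: P)
    also have "\<dots> \<le> emeasure L ({x \<in> S. N x \<le> n \<and> 0 < \<tau> x \<and> \<tau> x < m s} \<union> {x \<in> S. N x \<le> n \<and> \<tau> x = 0})"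
      by (intro emeasure_mono sets.Un) (auto simp: zero_less_iff_neq_zero)
    also have "\<dots> \<le> emeasure L {x \<in> S. N x \<le> n \<and> 0 < \<tau> x \<and> \<tau> x < m s} +
        emeasure L {x \<in> S. N x \<le> n \<and> \<tau> x = 0}"
      by (intro emeasure_subadditive) auto
    also have "\<dots> \<le> emeasure L {x \<in> space L. ennreal r < ennreal (b * \<bar>f x\<bar>) \<and> ennreal s < ennreal (g x)}"
      unfolding null add_0_right
    proof (rule emeasure_mono)
      show "{x \<in> S. N x \<le> n \<and> 0 < \<tau> x \<and> \<tau> x < m s} \<subseteq>
        {x \<in> space L. ennreal r < ennreal (b * \<bar>f x\<bar>) \<and> ennreal s < ennreal (g x)}"
      proof
        fix x assume "x \<in> {x \<in> S. N x \<le> n \<and> 0 < \<tau> x \<and> \<tau> x < m s}"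
        then have x: "x \<in> S" "N x \<le> n" "0 < \<tau> x" "\<tau> x < m s" by auto
        have fx: "0 < \<bar>f x\<bar>" using x(1) by (simp add: S_def)
        have "log b r < log b \<bar>f x\<bar> + 1" using x(2) by (simp add: N_def n_def) linarith
        also have "\<dots> = log b (b * \<bar>f x\<bar>)" using fx b by (simp add: log_mult)
        finally have "r < b * \<bar>f x\<bar>" using fx b r by (subst (asm) log_less_cancel_iff) auto
        moreover have "s < g x" using g_low x s by simp
        ultimately show "x \<in> {x \<in> space L. ennreal r < ennreal (b * \<bar>f x\<bar>) \<and> ennreal s < ennreal (g x)}"
          using x(1) SI r s by (auto simp: ennreal_less_iff)
      qed
    qed measurable
    finally show "emeasure L {x \<in> space L. ennreal r < rearrangement a f x \<and> ennreal s < ennreal (k' x)} \<le>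
      emeasure L {x \<in> space L. ennreal r < ennreal (b * \<bar>f x\<bar>) \<and> ennreal s < ennreal (g x)}" by simp
  qed measurable
  also have "\<dots> = (\<integral>\<^sup>+x. ennreal b * ennreal (\<bar>f x\<bar> * g x) \<partial>L)"
    using b g0 by (intro nn_integral_cong) (simp add: ennreal_mult[symmetric] mult.assoc)
  also have "\<dots> = ennreal b * (\<integral>\<^sup>+x. ennreal (\<bar>f x\<bar> * g x) \<partial>L)"
    by (rule nn_integral_cmult) measurable
  also have "(\<integral>\<^sup>+t. rearrangement a f t * ennreal (k' t) \<partial>L) = (\<integral>\<^sup>+t. rearrangement a f t * ennreal (k t) \<partial>L)"
    by (intro nn_integral_cong) (simp add: k'_def)
  finally show ?thesis
    using that[of g] g_meas g0 g_star by (simp add: L0_def L_def I_def)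
qed

section \<open>N-functions\<close>

context
  fixes \<phi> :: "real \<Rightarrow> real"
  assumes N: "N_function \<phi>"
begin

lemma phi_nonneg: "0 \<le> t \<Longrightarrow> 0 \<le> \<phi> t"
  and phi_0: "\<phi> 0 = 0"
  and phi_convex: "convex_on {0..} \<phi>"
  using N by (auto simp: N_function_def orlicz_function_def)

lemma phi_less: "0 \<le> s \<Longrightarrow> s < t \<Longrightarrow> \<phi> s < \<phi> t"
  using N by (auto simp: N_function_def orlicz_function_def strict_mono_on_def)

lemma phi_mono: "0 \<le> s \<Longrightarrow> s \<le> t \<Longrightarrow> \<phi> s \<le> \<phi> t"
  using phi_less by (cases "s = t") (auto intro: less_imp_le)

lemma phi_less_iff: "0 \<le> s \<Longrightarrow> 0 \<le> t \<Longrightarrow> \<phi> s < \<phi> t \<longleftrightarrow> s < t"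
  using phi_less phi_mono by (meson not_less)

lemma phi_pos: "0 < t \<Longrightarrow> 0 < \<phi> t"
  using phi_less[of 0 t] phi_0 by simp

lemma phi_scale: "0 \<le> c \<Longrightarrow> c \<le> 1 \<Longrightarrow> 0 \<le> x \<Longrightarrow> \<phi> (c * x) \<le> c * \<phi> x"
  using convex_onD[OF phi_convex, of c 0 x] phi_0 by simp

lemma phi_ge_linear:
  assumes "1 \<le> x" shows "x * \<phi> 1 \<le> \<phi> x"
  using phi_scale[of "1 / x" x] assms by (simp add: field_simps)

text \<open>Convexity settles the open half-line; at 0 the function is squeezed between 0 and
  \<open>t * \<phi> 1\<close>.\<close>

lemma phi_continuous: "continuous_on {0..} \<phi>"
proof (unfold continuous_on_eq_continuous_within, intro ballI)
  fix x :: real assume x: "x \<in> {0..}"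
  show "continuous (at x within {0..}) \<phi>"
  proof (cases "x = 0")
    case True
    have "(\<phi> \<longlongrightarrow> 0) (at 0 within {0..})"
    proof (rule tendsto_sandwich[of "\<lambda>_. 0" _ _ "\<lambda>t. t * \<phi> 1"])
      show "\<forall>\<^sub>F t in at 0 within {0..}. 0 \<le> \<phi> t"
        by (auto simp: eventually_at_filter phi_nonneg)
      show "\<forall>\<^sub>F t in at 0 within {0..}. \<phi> t \<le> t * \<phi> 1"
        unfolding eventually_at
        by (rule exI[of _ 1]) (use phi_scale[of _ 1] in \<open>auto simp: dist_real_def\<close>)
      show "((\<lambda>t. t * \<phi> 1) \<longlongrightarrow> 0) (at 0 within {0..})"
        by (auto intro!: tendsto_eq_intros)
    qed simp
    then show ?thesis using True phi_0 by (simp add: continuous_within)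
  next
    case False
    have "convex_on {0<..} \<phi>"
      using phi_convex by (rule convex_on_subset) auto
    then have "continuous_on {0<..} \<phi>" by (intro convex_on_continuous) auto
    then show ?thesis
      using False x by (auto simp: continuous_on_eq_continuous_at intro: continuous_at_imp_continuous_at_within)
  qed
qed

lemma phi_superlinear: "\<exists>S>0. \<forall>s\<ge>S. K * s \<le> \<phi> s"
proof -
  have "filterlim (\<lambda>t. \<phi> t / t) at_top at_top" using N by (simp add: N_function_def)
  then have "\<forall>\<^sub>F t in at_top. K \<le> \<phi> t / t" by (simp add: filterlim_at_top)
  then obtain S where S: "\<And>t. S \<le> t \<Longrightarrow> K \<le> \<phi> t / t" by (auto simp: eventually_at_top_linorder)
  show ?thesis
  proof (intro exI[of _ "max S 1"] conjI allI impI)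
    fix s assume "max S 1 \<le> s"
    then show "K * s \<le> \<phi> s" using S[of s] by (simp add: pos_le_divide_eq)
  qed simp
qed

lemma phi_sublinear: "0 < e \<Longrightarrow> \<exists>s>0. \<phi> s < e * s"
proof -
  assume e: "0 < e"
  have "((\<lambda>t. \<phi> t / t) \<longlongrightarrow> 0) (at_right 0)" using N by (simp add: N_function_def)
  then have "\<forall>\<^sub>F t in at_right 0. \<phi> t / t < e" using e by (rule order_tendstoD(2))
  then have "\<forall>\<^sub>F t in at_right 0. \<phi> t / t < e \<and> 0 < t"
    using eventually_at_right_less[of 0] by eventually_elim auto
  then obtain s where "\<phi> s / s < e" "0 < s"
    using eventually_happens'[OF trivial_limit_at_right_real] by blast
  then show ?thesis by (intro exI[of _ s]) (auto simp: field_simps)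
qed

section \<open>The complementary function and Young's inequality\<close>

lemma complementary_bdd:
  assumes t: "0 \<le> t"
  shows "bdd_above ((\<lambda>s. s * t - \<phi> s) ` {0<..})"
proof -
  obtain S where S: "0 < S" "\<And>s. S \<le> s \<Longrightarrow> t * s \<le> \<phi> s" using phi_superlinear[of t] by auto
  have "s * t - \<phi> s \<le> S * t" if "0 < s" for s
  proof (cases "S \<le> s")
    case True
    then have "s * t - \<phi> s \<le> 0" using S(2)[OF True] by (simp add: mult.commute)
    also have "0 \<le> S * t" using S t by simp
    finally show ?thesis .
  next
    case False
    then have "s * t \<le> S * t" using t by (intro mult_right_mono) auto
    then show ?thesis using phi_nonneg[of s] that by linarith
  qed
  then show ?thesis by (auto intro!: bdd_aboveI)
qed

text \<open>Beyond some \<open>S\<close> the expression \<open>s t - \<phi> s\<close> is at most 0,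
  its value at \<open>s = 0\<close>, so a maximum over the compact interval \<open>[0, S]\<close> is
  global. The second conjunct is the equality case of Young's inequality.\<close>

lemma complementary_attained:
  assumes t: "0 \<le> t"
  shows "\<exists>h\<ge>0. (\<forall>s\<ge>0. s * t - \<phi> s \<le> h * t - \<phi> h) \<and> h * t = \<phi> h + complementary \<phi> t"
proof -
  obtain S where S: "0 < S" "\<And>s. S \<le> s \<Longrightarrow> t * s \<le> \<phi> s" using phi_superlinear[of t] by auto
  have "continuous_on {0..S} (\<lambda>s. s * t - \<phi> s)"
    by (intro continuous_intros continuous_on_subset[OF phi_continuous]) auto
  then obtain h where h: "h \<in> {0..S}" "\<And>s. s \<in> {0..S} \<Longrightarrow> s * t - \<phi> s \<le> h * t - \<phi> h"
    using continuous_attains_sup[of "{0..S}" "\<lambda>s. s * t - \<phi> s"] S(1) by auto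
  have hmax: "s * t - \<phi> s \<le> h * t - \<phi> h" if "0 \<le> s" for s
  proof (cases "S \<le> s")
    case True
    then have "s * t - \<phi> s \<le> 0" using S(2)[OF True] by (simp add: mult.commute)
    also have "0 \<le> h * t - \<phi> h" using h(2)[of 0] S(1) phi_0 by simp
    finally show ?thesis .
  qed (use h that in auto)
  have "complementary \<phi> t = h * t - \<phi> h"
  proof (rule antisym)
    show "complementary \<phi> t \<le> h * t - \<phi> h"
      unfolding complementary_def by (rule cSUP_least) (auto intro: hmax)
    show "h * t - \<phi> h \<le> complementary \<phi> t"
    proof (cases "h = 0")
      case False
      then show ?thesis
        unfolding complementary_def using h(1) by (intro cSUP_upper complementary_bdd t) auto
    next
      case True
      \<comment> \<open>The supremum defining \<open>complementary\<close> omits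
        \<open>s = 0\<close>, so a maximizer at 0 has to be approached by small positive
        \<open>s\<close>; the choice of \<open>s\<close> makes \<open>\<phi> s\<close> at most
        \<open>e / 2\<close>.\<close>
      have "0 \<le> complementary \<phi> t + e" if e: "0 < e" for e :: real
      proof -
        obtain s where s: "0 < s" "\<phi> s < e"
        proof
          let ?s = "min 1 (e / (2 * \<phi> 1))"
          show "0 < ?s" using e phi_pos[of 1] by simp
          have "\<phi> ?s \<le> ?s * \<phi> 1" using phi_scale[of ?s 1] e phi_pos[of 1] by simp
          also have "\<dots> \<le> e / (2 * \<phi> 1) * \<phi> 1" using phi_pos[of 1] by (intro mult_right_mono) auto
          also have "\<dots> < e" using e phi_pos[of 1] by simp
          finally show "\<phi> ?s < e" .
        qed
        have "s * t - \<phi> s \<le> complementary \<phi> t"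
          unfolding complementary_def using s(1) by (intro cSUP_upper complementary_bdd t) auto
        moreover have "0 \<le> s * t" using s(1) t by simp
        ultimately show ?thesis using s(2) by linarith
      qed
      then have "0 \<le> complementary \<phi> t" by (rule field_le_epsilon)
      then show ?thesis using True phi_0 by simp
    qed
  qed
  with h hmax show ?thesis by (intro exI[of _ h]) auto
qed

lemma complementary_nonneg: "0 \<le> t \<Longrightarrow> 0 \<le> complementary \<phi> t"
  using complementary_attained[of t] phi_0 by (metis add_diff_cancel_left' diff_self mult_zero_left order_refl)

lemma Young_inequality: "0 \<le> s \<Longrightarrow> 0 \<le> t \<Longrightarrow> s * t \<le> \<phi> s + complementary \<phi> t"
  using complementary_attained[of t] by force

lemma complementary_mono: "0 \<le> s \<Longrightarrow> s \<le> t \<Longrightarrow> complementary \<phi> s \<le> complementary \<phi> t"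
proof -
  assume st: "0 \<le> s" "s \<le> t"
  obtain h where h: "0 \<le> h" "h * s = \<phi> h + complementary \<phi> s"
    using complementary_attained[of s] st by auto
  have "h * t \<le> \<phi> h + complementary \<phi> t" using Young_inequality[of h t] h st by simp
  moreover have "h * s \<le> h * t" using h st by (intro mult_left_mono) auto
  ultimately show ?thesis using h by linarith
qed

text \<open>Because \<open>\<phi> s / s\<close> tends to 0 at 0, some \<open>s > 0\<close> has
  \<open>\<phi> s < t s\<close>.\<close>

lemma complementary_pos: "0 < t \<Longrightarrow> 0 < complementary \<phi> t"
  using phi_sublinear[of t] Young_inequality[of _ t] by (smt (verit) mult.commute)

text \<open>A maximizer of \<open>s t - \<phi> s\<close> depends monotonically on \<open>t\<close>, whichever one is chosen.\<close>
lemma Young_equality_selection: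
  obtains q where "\<And>t. 0 \<le> t \<Longrightarrow> 0 \<le> q t" "q 0 = 0" "\<And>s t. 0 \<le> s \<Longrightarrow> s \<le> t \<Longrightarrow> q s \<le> q t"
    "\<And>t. 0 \<le> t \<Longrightarrow> q t * t = \<phi> (q t) + complementary \<phi> t"
proof -
  obtain q where q: "\<And>t. 0 \<le> t \<Longrightarrow> 0 \<le> q t"
    "\<And>t s. 0 \<le> t \<Longrightarrow> 0 \<le> s \<Longrightarrow> s * t - \<phi> s \<le> q t * t - \<phi> (q t)"
    "\<And>t. 0 \<le> t \<Longrightarrow> q t * t = \<phi> (q t) + complementary \<phi> t"
    using complementary_attained by metis
  show thesis
  proof (rule that)
    show "q 0 = 0"
    proof (rule ccontr)
      assume "q 0 \<noteq> 0"
      then show False using q(1)[of 0] q(2)[of 0 0] phi_pos[of "q 0"] phi_0 by simp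
    qed
    fix s t :: real assume st: "0 \<le> s" "s \<le> t"
    show "q s \<le> q t"
    proof (cases "s = t")
      case False
      \<comment> \<open>Adding the maximality of \<open>q s\<close> against \<open>q t\<close> and
        of \<open>q t\<close> against \<open>q s\<close> cancels the terms in
        \<open>\<phi>\<close>.\<close>
      have "(t - s) * (q t - q s) \<ge> 0"
        using q(2)[of s "q t"] q(2)[of t "q s"] q(1)[of s] q(1)[of t] st by (auto simp: algebra_simps)
      then show ?thesis using st False by (simp add: zero_le_mult_iff)
    qed simp
  qed (use q in auto)
qed

text \<open>Continuity and growth make \<open>r\<close> a value of \<open>\<phi>\<close>. Superlevel
  sets of \<open>\<phi> \<circ> h\<close> thereby become superlevel sets of
  \<open>h\<close>.\<close>

lemma phi_level:
  assumes "0 \<le> r"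
  obtains s where "0 \<le> s" "\<And>x. 0 \<le> x \<Longrightarrow> r < \<phi> x \<longleftrightarrow> s < x"
proof -
  obtain S where S: "0 < S" "\<And>s. S \<le> s \<Longrightarrow> 1 * s \<le> \<phi> s" using phi_superlinear[of 1] by metis
  have "\<exists>s\<ge>0. s \<le> max S r \<and> \<phi> s = r"
    using S(2)[of "max S r"] S(1) phi_0 assms
    by (intro IVT' continuous_on_subset[OF phi_continuous]) auto
  then obtain s where "0 \<le> s" "\<phi> s = r" by auto
  then show thesis using that[of s] phi_less_iff by auto
qed

text \<open>Nothing is known about \<open>\<phi>\<close> at negative arguments; composed with
  \<open>max 0\<close> it is monotone on the whole line.\<close>

lemma borel_measurable_phi_max: "(\<lambda>t. \<phi> (max 0 t)) \<in> borel_measurable borel"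
  by (rule borel_measurable_mono) (auto simp: mono_def intro!: phi_mono)

lemma borel_measurable_complementary_max: "(\<lambda>t. complementary \<phi> (max 0 t)) \<in> borel_measurable borel"
  by (rule borel_measurable_mono) (auto simp: mono_def intro!: complementary_mono)

text \<open>Jensen's inequality for infinitely many points. The first \<open>k\<close> weights add
  up to \<open>1 - (1/2)^k\<close>; the missing weight is put on the point 0, where
  \<open>\<phi>\<close> vanishes, and continuity lets \<open>k\<close> tend to infinity.\<close>

lemma phi_suminf_le:
  fixes x :: "nat \<Rightarrow> real"
  assumes x: "\<And>n. 0 \<le> x n" and sm: "summable (\<lambda>n. (1/2) ^ Suc n * x n)"
  shows "ennreal (\<phi> (\<Sum>n. (1/2) ^ Suc n * x n)) \<le> (\<Sum>n. ennreal ((1/2) ^ Suc n * \<phi> (x n)))"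
proof -
  have fin: "\<phi> (\<Sum>n<k. (1/2) ^ Suc n * x n) \<le> (\<Sum>n<k. (1/2) ^ Suc n * \<phi> (x n))" for k
  proof -
    have w: "(\<Sum>n<k. (1/2::real) ^ Suc n) = 1 - (1/2)^k" by (induction k) (auto simp: field_simps)
    have "\<phi> (\<Sum>n\<in>{..k}. (if n = k then (1/2)^k else (1/2) ^ Suc n) *\<^sub>R (if n = k then 0 else x n))
      \<le> (\<Sum>n\<in>{..k}. (if n = k then (1/2)^k else (1/2) ^ Suc n) * \<phi> (if n = k then 0 else x n))"
    proof (rule convex_on_sum[OF _ _ phi_convex])
      have "(\<Sum>n\<in>{..k}. if n = k then (1/2)^k else (1/2::real) ^ Suc n) = (\<Sum>n<k. (1/2::real) ^ Suc n) + (1/2)^k"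
        by (simp add: lessThan_Suc_atMost[symmetric])
      then show "(\<Sum>n\<in>{..k}. if n = k then (1/2)^k else (1/2::real) ^ Suc n) = 1" using w by linarith
    qed (use x in auto)
    then show ?thesis by (simp add: lessThan_Suc_atMost[symmetric] phi_0)
  qed
  have "(\<lambda>k. \<Sum>n<k. (1/2) ^ Suc n * x n) \<longlonglongrightarrow> (\<Sum>n. (1/2) ^ Suc n * x n)"
    using summable_LIMSEQ[OF sm] .
  moreover have "0 \<le> (\<Sum>n<k. (1/2) ^ Suc n * x n)" for k using x by (intro sum_nonneg) auto
  moreover have "0 \<le> (\<Sum>n. (1/2) ^ Suc n * x n)" using x by (intro suminf_nonneg sm) auto
  ultimately have "(\<lambda>k. \<phi> (\<Sum>n<k. (1/2) ^ Suc n * x n)) \<longlonglongrightarrow> \<phi> (\<Sum>n. (1/2) ^ Suc n * x n)"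
    by (intro continuous_on_tendsto_compose[OF phi_continuous]) auto
  then have "(\<lambda>k. ennreal (\<phi> (\<Sum>n<k. (1/2) ^ Suc n * x n))) \<longlonglongrightarrow> ennreal (\<phi> (\<Sum>n. (1/2) ^ Suc n * x n))"
    by (rule tendsto_ennrealI)
  moreover have "ennreal (\<phi> (\<Sum>n<k. (1/2) ^ Suc n * x n)) \<le> (\<Sum>n. ennreal ((1/2) ^ Suc n * \<phi> (x n)))" for k
  proof -
    have "ennreal (\<phi> (\<Sum>n<k. (1/2) ^ Suc n * x n)) \<le> ennreal (\<Sum>n<k. (1/2) ^ Suc n * \<phi> (x n))"
      by (rule ennreal_leI[OF fin])
    also have "\<dots> = (\<Sum>n<k. ennreal ((1/2) ^ Suc n * \<phi> (x n)))"
      using x phi_nonneg by (intro sum_ennreal[symmetric]) auto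
    also have "\<dots> \<le> (\<Sum>n. ennreal ((1/2) ^ Suc n * \<phi> (x n)))"
      by (rule sum_le_suminf) auto
    finally show ?thesis .
  qed
  ultimately show ?thesis by (intro LIMSEQ_le_const2) auto
qed

end

section \<open>The Koethe dual\<close>

lemma ennreal_eq_by_less:
  fixes x y :: ennreal
  assumes "\<And>s. 0 \<le> s \<Longrightarrow> ennreal s < x \<longleftrightarrow> ennreal s < y"
  shows "x = y"
proof -
  have le: "v \<le> u" if *: "\<And>s. 0 \<le> s \<Longrightarrow> ennreal s < v \<Longrightarrow> ennreal s < u" for u v :: ennreal
  proof (rule ccontr)
    assume "\<not> v \<le> u"
    then obtain z where z: "u < z" "z < v" using dense[of u v] by (auto simp: not_le)
    then obtain s where "z = ennreal s" "0 \<le> s" by (cases z) auto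
    with *[of s] z show False by simp
  qed
  show ?thesis by (intro antisym le) (use assms in blast)+
qed

lemma rearrangement_cmult:
  assumes f: "f \<in> borel_measurable (leb_I a)" and c: "0 < c"
  shows "rearrangement a (\<lambda>t. c * f t) t = ennreal c * rearrangement a f t"
proof (rule ennreal_eq_by_less)
  fix s :: real assume s: "0 \<le> s"
  have "ennreal s < rearrangement a (\<lambda>t. c * f t) t \<longleftrightarrow> ennreal t < distr_fun a (\<lambda>t. c * f t) s"
    using f s by (intro less_rearrangement_iff) auto
  also have "distr_fun a (\<lambda>t. c * f t) s = distr_fun a f (s / c)"
    using c by (simp add: distr_fun_def abs_mult pos_divide_less_eq mult.commute)
  also have "ennreal t < distr_fun a f (s / c) \<longleftrightarrow> ennreal (s / c) < rearrangement a f t"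
    using f s c by (intro less_rearrangement_iff[symmetric]) auto
  also have "\<dots> \<longleftrightarrow> ennreal s < ennreal c * rearrangement a f t"
  proof (cases "rearrangement a f t")
    case (real r)
    then show ?thesis using s c
      by (simp add: ennreal_mult[symmetric] ennreal_less_iff pos_divide_less_eq mult.commute)
  next
    case top
    then show ?thesis using c by (simp add: ennreal_mult_top)
  qed
  finally show "ennreal s < rearrangement a (\<lambda>t. c * f t) t \<longleftrightarrow> ennreal s < ennreal c * rearrangement a f t" .
qed

lemma id_measurable_leb_I: "(\<lambda>x. x) \<in> measurable (leb_I a) borel"
  by (intro measurable_restrict_space1 measurable_completion) simp

lemma rearrangement_measurable_leb_I:
  assumes "f \<in> borel_measurable (leb_I a)"
  shows "rearrangement a f \<in> borel_measurable (leb_I a)"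
  using measurable_compose[OF id_measurable_leb_I borel_measurable_rearrangement[OF assms]] by simp

text \<open>The set \<open>{|f| > r, |g| > s}\<close> is no larger than either of the two sets,
  whereas the superlevel sets of the rearrangements are nested initial segments, whose intersection
  attains the smaller measure.\<close>

lemma Hardy_Littlewood:
  assumes f: "f \<in> borel_measurable (leb_I a)" and g: "g \<in> borel_measurable (leb_I a)"
  shows "(\<integral>\<^sup>+x. ennreal \<bar>f x * g x\<bar> \<partial>leb_I a) \<le>
    (\<integral>\<^sup>+t. rearrangement a f t * rearrangement a g t \<partial>leb_I a)"
proof -
  let ?L = "leb_I a" and ?I = "einterval 0 a"
  note [measurable] = f g rearrangement_measurable_leb_I[OF f] rearrangement_measurable_leb_I[OF g]
  have "(\<integral>\<^sup>+x. ennreal \<bar>f x\<bar> * ennreal \<bar>g x\<bar> \<partial>?L) \<le>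
    (\<integral>\<^sup>+t. rearrangement a f t * rearrangement a g t \<partial>?L)"
  proof (rule nn_integral_mult_le_by_levels)
    fix r s :: real assume r: "0 < r" and s: "0 < s"
    let ?m = "min (distr_fun a f r) (distr_fun a g s)"
    have "emeasure ?L {x \<in> space ?L. ennreal r < ennreal \<bar>f x\<bar> \<and> ennreal s < ennreal \<bar>g x\<bar>}
      = emeasure ?L {x \<in> ?I. r < \<bar>f x\<bar> \<and> s < \<bar>g x\<bar>}"
      using r s by (simp add: ennreal_less_iff)
    also have "\<dots> \<le> min ?m (emeasure ?L ?I)"
    proof -
      have m: "{x \<in> space ?L. r < \<bar>f x\<bar>} \<in> sets ?L" "{x \<in> space ?L. s < \<bar>g x\<bar>} \<in> sets ?L"
        by measurable
      have "emeasure ?L {x \<in> ?I. r < \<bar>f x\<bar> \<and> s < \<bar>g x\<bar>} \<le> distr_fun a f r"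
        unfolding distr_fun_def using m(1) by (intro emeasure_mono) auto
      moreover have "emeasure ?L {x \<in> ?I. r < \<bar>f x\<bar> \<and> s < \<bar>g x\<bar>} \<le> distr_fun a g s"
        unfolding distr_fun_def using m(2) by (intro emeasure_mono) auto
      moreover have "emeasure ?L {x \<in> ?I. r < \<bar>f x\<bar> \<and> s < \<bar>g x\<bar>} \<le> emeasure ?L ?I"
        using sets.top[of ?L] by (intro emeasure_mono) auto
      ultimately show ?thesis by (intro min.boundedI)
    qed
    also have "\<dots> = emeasure ?L {x \<in> ?I. ennreal x < ?m}"
      by (rule emeasure_leb_I_ennreal_less[symmetric])
    also have "\<dots> = emeasure ?L {x \<in> space ?L. ennreal r < rearrangement a f x \<and> ennreal s < rearrangement a g x}"
      using r s f g by (simp add: less_rearrangement_iff)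
    finally show "emeasure ?L {x \<in> space ?L. ennreal r < ennreal \<bar>f x\<bar> \<and> ennreal s < ennreal \<bar>g x\<bar>} \<le>
      emeasure ?L {x \<in> space ?L. ennreal r < rearrangement a f x \<and> ennreal s < rearrangement a g x}" .
  qed (auto intro!: sigma_finite_lebesgue_on)
  then show ?thesis by (simp add: abs_mult ennreal_mult)
qed

section \<open>Decreasing test functions and their realization in \<open>M\<close>\<close>

locale orlicz_weight =
  fixes \<phi> w :: "real \<Rightarrow> real" and a :: ereal
  assumes N: "N_function \<phi>" and a: "0 < a" and weight: "weight_function a w"
    and nonzero: "\<exists>t\<in>einterval 0 a. w t \<noteq> 0"
begin

abbreviation "I \<equiv> einterval 0 a"
abbreviation "L \<equiv> leb_I a"

lemma w_meas [measurable]: "w \<in> borel_measurable L"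
  and w_nonneg: "t \<in> I \<Longrightarrow> 0 \<le> w t"
  and w_antimono: "s \<in> I \<Longrightarrow> t \<in> I \<Longrightarrow> s \<le> t \<Longrightarrow> w t \<le> w s"
  using weight by (auto simp: weight_function_def L0_def monotone_on_def)

lemma w_pos_point: obtains t where "t \<in> I" "0 < w t"
  using nonzero w_nonneg by (metis less_eq_real_def)

lemma I_pos: "t \<in> I \<Longrightarrow> 0 < t" by (simp add: einterval_iff)

text \<open>The integrand of the modular for a decreasing function given directly, with the same
  convention at zeros of \<open>w\<close>; the case split overrides the value 0 of division by
  0.\<close>

definition k_integrand :: "(real \<Rightarrow> real) \<Rightarrow> real \<Rightarrow> ennreal" where
  "k_integrand k t = (if w t = 0 then (if k t = 0 then 0 else \<infinity>) else ennreal (\<phi> (k t / w t) * w t))"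

lemma M_integrand_eq:
  "M_integrand \<phi> w a f t =
    (if rearrangement a f t = \<infinity> then \<infinity> else k_integrand (\<lambda>t. enn2real (rearrangement a f t)) t)"
  by (simp add: M_integrand_def k_integrand_def enn2real_eq_0_iff)

lemma M_integrand_le:
  assumes "t \<in> I" "rearrangement a g t \<le> ennreal (k t)" "0 \<le> k t"
  shows "M_integrand \<phi> w a g t \<le> k_integrand k t"
proof -
  obtain r where r: "rearrangement a g t = ennreal r" "0 \<le> r" "r \<le> k t"
    using assms(2,3) by (cases "rearrangement a g t") (auto simp: top_unique ennreal_le_iff)
  show ?thesis
  proof (cases "w t = 0")
    case False
    then have w: "0 < w t" using w_nonneg[OF assms(1)] by simp
    have "\<phi> (r / w t) \<le> \<phi> (k t / w t)"
      using r w by (intro phi_mono[OF N] divide_right_mono) auto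
    then show ?thesis using r w by (auto simp: M_integrand_def k_integrand_def intro!: ennreal_leI mult_right_mono)
  qed (use r in \<open>auto simp: M_integrand_def k_integrand_def\<close>)
qed

lemma k_integrand_measurable:
  assumes [measurable]: "k \<in> borel_measurable L" and k: "\<And>t. t \<in> I \<Longrightarrow> 0 \<le> k t"
  shows "k_integrand k \<in> borel_measurable L"
proof -
  note [measurable] = borel_measurable_phi_max[OF N]
  have "(\<lambda>t. if w t = 0 then (if k t = 0 then 0 else \<infinity>) else ennreal (\<phi> (max 0 (k t / w t)) * w t)) \<in> borel_measurable L"
    using measurable_compose[OF _ borel_measurable_phi_max[OF N], of "\<lambda>t. k t / w t" L] by measurable
  then show ?thesis
    by (rule measurable_cong[THEN iffD1, rotated])
      (use k w_nonneg in \<open>auto simp: k_integrand_def max_absorb2\<close>)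
qed

lemma M_integrand_measurable:
  assumes "f \<in> borel_measurable L"
  shows "M_integrand \<phi> w a f \<in> borel_measurable L"
proof -
  note [measurable] = rearrangement_measurable_leb_I[OF assms]
  have [measurable]: "k_integrand (\<lambda>t. enn2real (rearrangement a f t)) \<in> borel_measurable L"
    by (rule k_integrand_measurable) auto
  show ?thesis unfolding M_integrand_eq[abs_def] by measurable
qed

definition K :: "(real \<Rightarrow> real) set" where
  "K = {k. antimono_on I k \<and> (\<forall>t\<in>I. 0 \<le> k t) \<and> (\<integral>\<^sup>+t. k_integrand k t \<partial>L) \<le> 1}"

lemma antimono_on_measurable:
  fixes k :: "real \<Rightarrow> real"
  assumes "antimono_on I k"
  shows "k \<in> borel_measurable L"
proof -
  have "(\<lambda>x. if x \<in> I then k x else 0) \<in> borel_measurable L"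
    using measurable_compose[OF id_measurable_leb_I borel_measurable_antimono_on_einterval[OF assms]] by simp
  then show ?thesis by (rule measurable_cong[THEN iffD1, rotated]) auto
qed

text \<open>The nonnegative function produced by the realization is multiplied by the sign of
  \<open>f\<close>, so that \<open>f g\<close> is nonnegative and equals \<open>|f|\<close> times
  the old function. Since \<open>g\<^sup>* \<le> k\<close>, the modular of \<open>g\<close> is at
  most that of \<open>k\<close>.\<close>

lemma realize_K:
  assumes f: "f \<in> L0 a" "0 \<le> s0" "distr_fun a f s0 < \<infinity>" and k: "k \<in> K" and b: "1 < b"
  obtains g where "g \<in> M_class \<phi> w a" "M_norm \<phi> w a g \<le> 1" "\<And>t. 0 \<le> f t * g t"
    "(\<integral>\<^sup>+t. rearrangement a f t * ennreal (k t) \<partial>L) \<le> ennreal b * (\<integral>\<^sup>+x. ennreal (f x * g x) \<partial>L)"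
proof -
  obtain g where g: "g \<in> L0 a" "\<And>x. 0 \<le> g x"
    "\<And>t. t \<in> I \<Longrightarrow> rearrangement a g t \<le> ennreal (k t)"
    "(\<integral>\<^sup>+t. rearrangement a f t * ennreal (k t) \<partial>L) \<le>
      ennreal b * (\<integral>\<^sup>+x. ennreal (\<bar>f x\<bar> * g x) \<partial>L)"
    using rearrangement_realization[OF f, of k b] k b by (auto simp: K_def)
  define g' where "g' x = sgn (f x) * g x" for x
  have [measurable]: "f \<in> borel_measurable L" "g \<in> borel_measurable L" using f g by (auto simp: L0_def)
  have g'L: "g' \<in> L0 a" unfolding L0_def g'_def[abs_def] by measurable
  have g'g: "\<bar>g' x\<bar> \<le> \<bar>g x\<bar>" for x by (simp add: g'_def abs_mult abs_sgn_eq)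
  have "distr_fun a g' s \<le> distr_fun a g s" for s
  proof -
    have "{x \<in> space L. s < \<bar>g x\<bar>} \<in> sets L" by measurable
    then show ?thesis unfolding distr_fun_def using g'g by (intro emeasure_mono) (auto intro: less_le_trans)
  qed
  then have "rearrangement a g' t \<le> rearrangement a g t" for t
    unfolding rearrangement_def by (intro Inf_superset_mono) (auto intro: order_trans)
  then have "rearrangement a g' t \<le> ennreal (k t)" if "t \<in> I" for t
    using g(3)[OF that] order_trans by blast
  then have "M_modular \<phi> w a g' \<le> (\<integral>\<^sup>+t. k_integrand k t \<partial>L)"
    unfolding M_modular_def using k by (intro nn_integral_mono M_integrand_le) (auto simp: K_def)
  also have "\<dots> \<le> 1" using k by (simp add: K_def)
  finally have M: "M_modular \<phi> w a g' \<le> 1" .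
  show thesis
  proof (rule that)
    show "g' \<in> M_class \<phi> w a"
      unfolding M_class_def using g'L M by (auto intro!: exI[of _ "1::real"] simp: le_less_trans)
    show "M_norm \<phi> w a g' \<le> 1"
      unfolding M_norm_def using M by (intro Inf_lower) (auto intro!: exI[of _ "1::real"])
    have eq: "f x * g' x = \<bar>f x\<bar> * g x" for x
      by (simp add: g'_def abs_sgn mult.assoc[symmetric])
    show "0 \<le> f t * g' t" for t using g(2) by (simp add: eq)
    show "(\<integral>\<^sup>+t. rearrangement a f t * ennreal (k t) \<partial>L) \<le> ennreal b * (\<integral>\<^sup>+x. ennreal (f x * g' x) \<partial>L)"
      using g(4) by (simp add: eq)
  qed
qed

text \<open>Otherwise each set \<open>{|f| > 4^n}\<close> contains a set \<open>E n\<close> of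
  measure \<open>t0 / 2^(n+1)\<close>. The indicator of their union has support of measure at most
  \<open>t0\<close>, hence finite modular, while its product with \<open>|f|\<close> has integral at
  least \<open>2^n t0 / 2\<close> for every \<open>n\<close>.\<close>

lemma kothe_dual_distr_finite:
  assumes f: "f \<in> kothe_dual a (M_class \<phi> w a)"
  obtains s where "0 \<le> s" "distr_fun a f s < \<infinity>"
proof (rule ccontr)
  assume "\<not> thesis"
  then have inf: "distr_fun a f s = \<infinity>" if "0 \<le> s" for s
    using that \<open>\<And>s. 0 \<le> s \<Longrightarrow> distr_fun a f s < \<infinity> \<Longrightarrow> thesis\<close> top.not_eq_extremum by fastforce
  have [measurable]: "f \<in> borel_measurable L" using f by (simp add: kothe_dual_def L0_def)
  obtain t0 where t0: "t0 \<in> I" "0 < w t0" by (rule w_pos_point)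
  have t0p: "0 < t0" using t0 I_pos by simp
  define F where "F n = {x \<in> I. 4 ^ n < \<bar>f x\<bar>}" for n :: nat
  have Fs: "F n \<in> sets L" for n
  proof -
    have "{x \<in> space L. 4 ^ n < \<bar>f x\<bar>} \<in> sets L" by measurable
    then show ?thesis by (simp add: F_def)
  qed
  define E where "E n = {x \<in> F n. emeasure L {y \<in> F n. y < x} < ennreal (t0 * (1/2) ^ Suc n)}" for n
  have EF: "E n \<subseteq> F n" for n by (auto simp: E_def)
  have Em: "emeasure L (E n) = ennreal (t0 * (1/2) ^ Suc n)" for n
  proof -
    have "emeasure L (F n) = \<infinity>" using inf[of "4 ^ n"] by (simp add: F_def distr_fun_def)
    then show ?thesis unfolding E_def emeasure_leb_I_mass_less[OF Fs] by simp
  qed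
  have Es: "E n \<in> sets L" for n
  proof -
    have "0 < ennreal (t0 * (1/2) ^ Suc n)" using t0p by (simp del: power_Suc)
    \<comment> \<open>Measurability comes for free: a set that is not measurable would have
      \<open>emeasure\<close> 0.\<close>
    then have "emeasure L (E n) \<noteq> 0" unfolding Em by (simp only: less_irrefl zero_less_iff_neq_zero simp_thms)
    then show ?thesis by (rule contrapos_np) (rule emeasure_notin_sets)
  qed
  define g where "g = (indicator (\<Union>n. E n) :: real \<Rightarrow> real)"
  have g_meas[measurable]: "g \<in> borel_measurable L"
    unfolding g_def using Es by (intro borel_measurable_indicator sets.countable_UN) auto
  define k where "k t = (if t < t0 then 1 else 0 :: real)" for t
  have g_star: "rearrangement a g t \<le> ennreal (k t)" if "t \<in> I" for t
  proof -
    have "distr_fun a g (k t) \<le> ennreal t"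
    proof (cases "t < t0")
      case True
      have "{x \<in> I. 1 < \<bar>g x\<bar>} = {}" by (auto simp: g_def indicator_def)
      with True show ?thesis unfolding distr_fun_def k_def by (simp only: if_True emeasure_empty zero_le)
    next
      case False
      have "distr_fun a g 0 \<le> emeasure L (\<Union>n. E n)"
        unfolding distr_fun_def using Es
        by (intro emeasure_mono sets.countable_UN) (auto simp: g_def indicator_def split: if_splits)
      also have "\<dots> \<le> (\<Sum>n. emeasure L (E n))"
        using Es by (intro emeasure_subadditive_countably) auto
      also have "\<dots> = (\<Sum>n. ennreal (t0 * (1/2) ^ Suc n))" by (simp only: Em)
      also have "\<dots> = ennreal (t0 * 1)"
        using t0p by (intro suminf_ennreal_eq sums_mult power_half_series) auto
      also have "\<dots> \<le> ennreal t" using False by (simp add: ennreal_leI)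
      finally show ?thesis using False by (simp add: k_def)
    qed
    then show ?thesis by (subst rearrangement_le_iff) (auto simp: k_def)
  qed
  have "M_modular \<phi> w a g \<le> (\<integral>\<^sup>+t. ennreal (\<phi> (1 / w t0) * w t0) * indicator {x \<in> I. x < t0} t \<partial>L)"
    unfolding M_modular_def
  proof (intro nn_integral_mono)
    fix t assume "t \<in> space L"
    then have t: "t \<in> I" by simp
    have "M_integrand \<phi> w a g t \<le> k_integrand k t"
      by (intro M_integrand_le t g_star) (simp add: k_def)
    also have "\<dots> \<le> ennreal (\<phi> (1 / w t0) * w t0) * indicator {x \<in> I. x < t0} t"
    proof (cases "t < t0")
      case True
      then have w: "w t0 \<le> w t" using w_antimono t t0 by simp
      \<comment> \<open>By convexity \<open>\<phi> (1/x) x\<close> does not increase with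
        \<open>x\<close>, so on \<open>(0, t0)\<close> it is largest for the smallest weight,
        bounded below by \<open>w t0\<close>.\<close>
      have "\<phi> (w t0 / w t * (1 / w t0)) \<le> w t0 / w t * \<phi> (1 / w t0)"
        using w t0 by (intro phi_scale[OF N]) auto
      then have "\<phi> (1 / w t) * w t \<le> \<phi> (1 / w t0) * w t0"
        using w t0 by (simp add: field_simps)
      then show ?thesis using True t w t0 by (auto simp: k_integrand_def k_def intro!: ennreal_leI)
    next
      case False
      then show ?thesis by (auto simp: k_integrand_def k_def phi_0[OF N])
    qed
    finally show "M_integrand \<phi> w a g t \<le> ennreal (\<phi> (1 / w t0) * w t0) * indicator {x \<in> I. x < t0} t" .
  qed
  also have "\<dots> = ennreal (\<phi> (1 / w t0) * w t0) * ennreal t0"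
    by (subst nn_integral_cmult_indicator) (auto simp: emeasure_leb_I_less t0)
  also have "\<dots> < \<infinity>" by (simp add: ennreal_mult_less_top)
  finally have "g \<in> M_class \<phi> w a"
    unfolding M_class_def L0_def by (auto intro!: exI[of _ "1::real"])
  then have "integrable L (\<lambda>t. f t * g t)" using f by (auto simp: kothe_dual_def)
  then have "(\<integral>\<^sup>+t. ennreal \<bar>f t * g t\<bar> \<partial>L) < \<infinity>"
    unfolding integrable_iff_bounded by simp
  then obtain c where c: "(\<integral>\<^sup>+t. ennreal \<bar>f t * g t\<bar> \<partial>L) = ennreal c" "0 \<le> c"
    by (cases "\<integral>\<^sup>+t. ennreal \<bar>f t * g t\<bar> \<partial>L") auto
  have "2 ^ n * t0 / 2 \<le> c" for n :: nat
  proof -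
    have "ennreal (4 ^ n) * ennreal (t0 * (1/2) ^ Suc n) = (\<integral>\<^sup>+t. ennreal (4 ^ n) * indicator (E n) t \<partial>L)"
      using Es by (simp add: nn_integral_cmult_indicator Em)
    also have "\<dots> \<le> (\<integral>\<^sup>+t. ennreal \<bar>f t * g t\<bar> \<partial>L)"
    proof (rule nn_integral_mono)
      fix t
      have "t \<in> E n \<Longrightarrow> 4 ^ n < \<bar>f t\<bar> \<and> g t = 1" using EF[of n] by (auto simp: F_def g_def indicator_def)
      then show "ennreal (4 ^ n) * indicator (E n) t \<le> ennreal \<bar>f t * g t\<bar>"
        by (auto split: split_indicator intro!: ennreal_leI)
    qed
    finally have "4 ^ n * (t0 * (1/2) ^ Suc n) \<le> c"
      using c t0p by (simp add: ennreal_mult[symmetric])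
    moreover have "(4::real) ^ n * (1/2) ^ n = 2 ^ n" by (simp add: power_mult_distrib[symmetric])
    ultimately show ?thesis by (simp add: mult_ac)
  qed
  moreover obtain n where "c / (t0 / 2) < 2 ^ n" using real_arch_pow[of 2 "c / (t0 / 2)"] by auto
  ultimately show False using t0p by (auto simp: field_simps not_le[symmetric])
qed

text \<open>\<open>\<phi> (k/w) w\<close> increases with \<open>k\<close> and does not increase with
  \<open>w\<close>. On \<open>(t/2, t)\<close> it is thus at least its value for \<open>k t\<close>
  and \<open>w (t/2)\<close>, and its integral there is at most 1;
  \<open>\<phi> x \<ge> x \<phi> 1\<close> for \<open>x \<ge> 1\<close> then bounds
  \<open>k t\<close>. The bound is the same for all of \<open>K\<close>, which is what makes series
  in \<open>K\<close> converge pointwise.\<close>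

lemma K_pointwise_bound:
  assumes k: "k \<in> K" and t: "t \<in> I"
  shows "k t \<le> w (t / 2) * max 1 (2 / (\<phi> 1 * w (t / 2) * t))"
proof -
  define w' where "w' = w (t / 2)"
  have t0: "0 < t" using t by (rule I_pos)
  have t2: "t / 2 \<in> I" using einterval_0_down[OF t, of "t / 2"] t0 by simp
  have w'0: "0 \<le> w'" using w_nonneg[OF t2] by (simp add: w'_def)
  have k0: "0 \<le> k s" if "s \<in> I" for s using k that by (simp add: K_def)
  \<comment> \<open>The lower bound for the integrand on \<open>(t/2, t)\<close>. If
    \<open>w'\<close> vanishes and \<open>k t\<close> does not, it is infinite and contradicts the
    integral bound.\<close>
  define c where "c = (if w' = 0 then (if k t = 0 then 0 else \<infinity>) else ennreal (\<phi> (k t / w') * w'))"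
  have cs: "c \<le> k_integrand k s" if s: "s \<in> I" "t / 2 \<le> s" "s \<le> t" for s
  proof -
    have ws: "w s \<le> w'" "0 \<le> w s" using w_antimono[OF t2 s(1,2)] w_nonneg[OF s(1)] by (auto simp: w'_def)
    have ks: "k t \<le> k s" using k s t by (auto simp: K_def monotone_on_def)
    show ?thesis
    proof (cases "w s = 0")
      case True
      show ?thesis using True ks k0[OF t] by (auto simp: c_def k_integrand_def phi_0[OF N])
    next
      case False
      then have w: "0 < w s" "0 < w'" using ws by auto
      have "\<phi> (w s / w' * (k t / w s)) \<le> w s / w' * \<phi> (k t / w s)"
        using w ws k0[OF t] by (intro phi_scale[OF N]) auto
      then have "\<phi> (k t / w') * w' \<le> \<phi> (k t / w s) * w s" using w by (simp add: field_simps)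
      also have "\<dots> \<le> \<phi> (k s / w s) * w s"
        using w ks k0[OF t] by (intro mult_right_mono phi_mono[OF N] divide_right_mono) auto
      finally show ?thesis using w by (auto simp: c_def k_integrand_def intro!: ennreal_leI)
    qed
  qed
  have S: "{t/2<..<t} \<in> sets L"
    using borel_Int_in_leb_I[of "{t/2<..<t}" a] einterval_0_down[OF t] t0 by (simp add: Int_absorb2 subset_iff)
  have SI: "{t/2<..<t} \<subseteq> I" using sets.sets_into_space[OF S] by simp
  have "emeasure L {t/2<..<t} = ennreal (t / 2)"
    using SI t0 by (subst emeasure_restrict_space) auto
  then have "c * ennreal (t / 2) = (\<integral>\<^sup>+s. c * indicator {t/2<..<t} s \<partial>L)"
    using S by (simp add: nn_integral_cmult_indicator)
  also have "\<dots> \<le> (\<integral>\<^sup>+s. k_integrand k s \<partial>L)"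
    using SI cs by (intro nn_integral_mono) (auto split: split_indicator)
  also have "\<dots> \<le> 1" using k by (simp add: K_def)
  finally have c1: "c * ennreal (t / 2) \<le> 1" .
  show ?thesis
  proof (cases "w' = 0")
    case True
    have "k t = 0"
    proof (rule ccontr)
      assume "k t \<noteq> 0"
      then have "c = \<infinity>" using True by (simp add: c_def)
      with c1 t0 show False by (simp add: ennreal_top_mult top_unique)
    qed
    then show ?thesis using True by (simp add: w'_def)
  next
    case False
    then have w: "0 < w'" using w'0 by simp
    define x where "x = k t / w'"
    have x0: "0 \<le> x" using k0[OF t] w by (simp add: x_def)
    have "c * ennreal (t / 2) = ennreal (\<phi> x * w' * (t / 2))"
      using False t0 phi_nonneg[OF N x0] w by (subst ennreal_mult) (auto simp: c_def x_def)
    then have le: "\<phi> x * w' * (t / 2) \<le> 1" using c1 by (simp only: ennreal_le_1)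
    have "x \<le> max 1 (2 / (\<phi> 1 * w' * t))"
    proof (cases "1 \<le> x")
      case True
      have "x * \<phi> 1 * (w' * (t / 2)) \<le> \<phi> x * (w' * (t / 2))"
        using phi_ge_linear[OF N True] w t0 by (intro mult_right_mono) auto
      then have "x * (\<phi> 1 * w' * t) \<le> 2" using le by (simp add: field_simps)
      then have "x \<le> 2 / (\<phi> 1 * w' * t)"
        using phi_pos[OF N, of 1] w t0 by (simp add: pos_le_divide_eq)
      then show ?thesis by simp
    qed simp
    then have "w' * x \<le> w' * max 1 (2 / (\<phi> 1 * w' * t))" using w by (intro mult_left_mono) auto
    then show ?thesis using w by (simp add: x_def w'_def)
  qed
qed

lemma kothe_dual_integral_finite:
  assumes "f \<in> kothe_dual a (M_class \<phi> w a)" "g \<in> M_class \<phi> w a" "\<And>t. 0 \<le> f t * g t"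
  shows "(\<integral>\<^sup>+x. ennreal (f x * g x) \<partial>L) = ennreal (\<integral>x. f x * g x \<partial>L)"
  using assms by (intro nn_integral_eq_integral) (auto simp: kothe_dual_def)

text \<open>For fixed \<open>t\<close> the integrand is convex in the value of \<open>k\<close>, and
  monotone convergence moves the series out of the integral. The pointwise bound on \<open>K\<close>
  ensures that \<open>suminf\<close> is an actual sum and not a default value.\<close>

lemma K_suminf:
  assumes k: "\<And>n. k n \<in> K"
  defines "kk \<equiv> \<lambda>t. \<Sum>n. (1/2) ^ Suc n * k n t"
  shows "kk \<in> K" "t \<in> I \<Longrightarrow> (1/2) ^ Suc n * k n t \<le> kk t"
proof -
  have k0: "0 \<le> k n t" if "t \<in> I" for n t using k[of n] that by (simp add: K_def)
  have sm: "summable (\<lambda>n. (1/2) ^ Suc n * k n t)" if t: "t \<in> I" for t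
  proof (rule summable_comparison_test')
    let ?B = "w (t / 2) * max 1 (2 / (\<phi> 1 * w (t / 2) * t))"
    show "summable (\<lambda>n. (1/2::real) ^ Suc n * ?B)"
      by (intro summable_mult2 sums_summable[OF power_half_series])
    show "norm ((1/2) ^ Suc n * k n t) \<le> (1/2) ^ Suc n * ?B" if "0 \<le> n" for n
      using K_pointwise_bound[OF k t, of n] k0[OF t, of n]
      by (simp only: norm_mult norm_power real_norm_def abs_of_nonneg) (auto intro!: mult_left_mono)
  qed
  show le: "(1/2) ^ Suc n * k n t \<le> kk t" if t: "t \<in> I" for t n
  proof -
    have "sum (\<lambda>n. (1/2) ^ Suc n * k n t) {n} \<le> kk t"
      unfolding kk_def using k0[OF t] by (intro sum_le_suminf sm t) auto
    then show ?thesis by simp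
  qed
  have kk0: "0 \<le> kk t" if t: "t \<in> I" for t
    unfolding kk_def using k0[OF t] by (intro suminf_nonneg sm t) auto
  have anti: "antimono_on I kk"
  proof (intro monotone_onI)
    fix s t assume st: "s \<in> I" "t \<in> I" "s \<le> t"
    show "kk t \<le> kk s"
      unfolding kk_def
    proof (intro suminf_le sm st mult_left_mono)
      show "k n t \<le> k n s" for n using k[of n] st by (auto simp: K_def monotone_on_def)
    qed auto
  qed
  have k_int: "k_integrand kk t \<le> (\<Sum>n. ennreal ((1/2) ^ Suc n) * k_integrand (k n) t)" if t: "t \<in> I" for t
  proof (cases "w t = 0")
    case True
    show ?thesis
    proof (cases "\<forall>n. k n t = 0")
      case True
      then have "kk t = 0" by (simp add: kk_def)
      with \<open>w t = 0\<close> show ?thesis by (simp add: k_integrand_def)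
    next
      case False
      then obtain n where "k n t \<noteq> 0" by auto
      \<comment> \<open>Where \<open>w\<close> vanishes, a single nonzero \<open>k n t\<close>
        already makes the right-hand side infinite.\<close>
      then have "\<infinity> = ennreal ((1/2) ^ Suc n) * k_integrand (k n) t"
        using True by (simp add: k_integrand_def ennreal_mult_top del: power_Suc)
      also have "\<dots> = sum (\<lambda>n. ennreal ((1/2) ^ Suc n) * k_integrand (k n) t) {n}" by simp
      also have "\<dots> \<le> (\<Sum>n. ennreal ((1/2) ^ Suc n) * k_integrand (k n) t)"
        by (rule sum_le_suminf) auto
      finally show ?thesis by (simp add: top_unique)
    qed
  next
    case False
    then have w: "0 < w t" using w_nonneg[OF t] by simp
    have "(\<lambda>n. (1/2) ^ Suc n * (k n t / w t)) sums (kk t / w t)"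
      using sums_divide[OF summable_sums[OF sm[OF t]], of "w t"] by (simp add: kk_def)
    then have kw: "kk t / w t = (\<Sum>n. (1/2) ^ Suc n * (k n t / w t))"
      and kws: "summable (\<lambda>n. (1/2) ^ Suc n * (k n t / w t))"
      using sums_unique sums_summable by blast+
    have "ennreal (\<phi> (kk t / w t)) \<le> (\<Sum>n. ennreal ((1/2) ^ Suc n * \<phi> (k n t / w t)))"
      unfolding kw using k0[OF t] w by (intro phi_suminf_le[OF N] kws) auto
    then have "ennreal (\<phi> (kk t / w t)) * ennreal (w t) \<le>
        (\<Sum>n. ennreal ((1/2) ^ Suc n * \<phi> (k n t / w t))) * ennreal (w t)"
      by (intro mult_right_mono) auto
    also have "\<dots> = (\<Sum>n. ennreal ((1/2) ^ Suc n) * k_integrand (k n) t)"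
      unfolding ennreal_suminf_multc[symmetric]
      using w phi_nonneg[OF N] k0[OF t]
      by (intro suminf_cong) (auto simp: k_integrand_def ennreal_mult[symmetric] mult.assoc simp del: power_Suc)
    also have "ennreal (\<phi> (kk t / w t)) * ennreal (w t) = k_integrand kk t"
      using w phi_nonneg[OF N] kk0[OF t] by (simp add: k_integrand_def ennreal_mult[symmetric])
    finally show ?thesis .
  qed
  have "(\<integral>\<^sup>+t. k_integrand kk t \<partial>L) \<le> (\<integral>\<^sup>+t. (\<Sum>n. ennreal ((1/2) ^ Suc n) * k_integrand (k n) t) \<partial>L)"
    using k_int by (intro nn_integral_mono) auto
  also have "\<dots> = (\<Sum>n. ennreal ((1/2) ^ Suc n) * (\<integral>\<^sup>+t. k_integrand (k n) t \<partial>L))"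
  proof -
    have [measurable]: "k_integrand (k n) \<in> borel_measurable L" for n
      using k[of n] by (intro k_integrand_measurable antimono_on_measurable) (auto simp: K_def)
    show ?thesis by (subst nn_integral_suminf) (auto simp: nn_integral_cmult simp del: power_Suc)
  qed
  also have "\<dots> \<le> (\<Sum>n. ennreal ((1/2) ^ Suc n) * 1)"
    using k by (intro suminf_le mult_left_mono) (auto simp: K_def)
  also have "\<dots> = ennreal 1"
    using power_half_series by (simp only: mult_1_right) (intro suminf_ennreal_eq, auto)
  finally show "kk \<in> K" using anti kk0 by (simp add: K_def)
qed

text \<open>A gliding hump: with \<open>k n\<close> chosen to give more than \<open>4^n\<close>, the
  combination \<open>kk\<close> dominates \<open>k n / 2^(n+1)\<close> and would give more than
  \<open>2^n / 2\<close> for every \<open>n\<close>. Yet one realization of \<open>kk\<close> bounds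
  it by twice a finite integral; the factor 2 is an arbitrary choice of
  \<open>b > 1\<close>.\<close>

lemma kothe_dual_K_bounded:
  assumes f: "f \<in> kothe_dual a (M_class \<phi> w a)"
  obtains C :: real where "0 < C"
    "\<And>k. k \<in> K \<Longrightarrow> (\<integral>\<^sup>+t. rearrangement a f t * ennreal (k t) \<partial>L) \<le> ennreal C"
proof (rule ccontr)
  assume no: "\<not> thesis"
  have "\<exists>k\<in>K. ennreal (4 ^ n) < (\<integral>\<^sup>+t. rearrangement a f t * ennreal (k t) \<partial>L)" for n :: nat
    using no that[of "4 ^ n"] by (meson not_le zero_less_numeral zero_less_power)
  then obtain k where k: "\<And>n. k n \<in> K"
    "\<And>n. ennreal (4 ^ n) < (\<integral>\<^sup>+t. rearrangement a f t * ennreal (k n t) \<partial>L)" by metis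
  define kk where "kk t = (\<Sum>n. (1/2) ^ Suc n * k n t)" for t
  have kk: "kk \<in> K" and kk_ge: "\<And>t n. t \<in> I \<Longrightarrow> (1/2) ^ Suc n * k n t \<le> kk t"
    using K_suminf[OF k(1)] by (auto simp: kk_def[abs_def])
  have fm: "f \<in> borel_measurable L" using f by (simp add: kothe_dual_def L0_def)
  note [measurable] = rearrangement_measurable_leb_I[OF fm]
  obtain s0 where s0: "0 \<le> s0" "distr_fun a f s0 < \<infinity>" using kothe_dual_distr_finite[OF f] .
  have fL: "f \<in> L0 a" using fm by (simp add: L0_def)
  obtain g where g: "g \<in> M_class \<phi> w a" "\<And>t. 0 \<le> f t * g t"
    "(\<integral>\<^sup>+t. rearrangement a f t * ennreal (kk t) \<partial>L) \<le> ennreal 2 * (\<integral>\<^sup>+x. ennreal (f x * g x) \<partial>L)"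
    using realize_K[OF fL s0 kk, of 2] by auto
  define c where "c = (\<integral>x. f x * g x \<partial>L)"
  have c0: "0 \<le> c" unfolding c_def using g(2) by (intro Bochner_Integration.integral_nonneg)
  have "2 ^ n / 2 \<le> 2 * c" for n :: nat
  proof -
    have "ennreal ((1/2) ^ Suc n) * ennreal (4 ^ n) \<le>
        ennreal ((1/2) ^ Suc n) * (\<integral>\<^sup>+t. rearrangement a f t * ennreal (k n t) \<partial>L)"
      using k(2)[of n] by (intro mult_left_mono) auto
    also have "\<dots> = (\<integral>\<^sup>+t. ennreal ((1/2) ^ Suc n) * (rearrangement a f t * ennreal (k n t)) \<partial>L)"
    proof -
      have [measurable]: "k n \<in> borel_measurable L"
        using k(1)[of n] by (intro antimono_on_measurable) (auto simp: K_def)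
      show ?thesis by (intro nn_integral_cmult[symmetric]) measurable
    qed
    also have "\<dots> \<le> (\<integral>\<^sup>+t. rearrangement a f t * ennreal (kk t) \<partial>L)"
    proof (rule nn_integral_mono)
      fix t assume "t \<in> space L"
      then have t: "t \<in> I" by simp
      have "ennreal ((1/2) ^ Suc n) * ennreal (k n t) = ennreal ((1/2) ^ Suc n * k n t)"
        using k(1)[of n] t by (intro ennreal_mult[symmetric]) (auto simp: K_def)
      also have "\<dots> \<le> ennreal (kk t)" by (intro ennreal_leI kk_ge t)
      finally have "rearrangement a f t * (ennreal ((1/2) ^ Suc n) * ennreal (k n t)) \<le>
        rearrangement a f t * ennreal (kk t)" by (intro mult_left_mono) auto
      then show "ennreal ((1/2) ^ Suc n) * (rearrangement a f t * ennreal (k n t)) \<le>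
        rearrangement a f t * ennreal (kk t)" by (simp only: mult_ac)
    qed
    also have "\<dots> \<le> ennreal 2 * (\<integral>\<^sup>+x. ennreal (f x * g x) \<partial>L)" by (rule g(3))
    also have "\<dots> = ennreal (2 * c)"
      using kothe_dual_integral_finite[OF f g(1,2)] c0 by (simp add: ennreal_mult c_def)
    finally have "ennreal ((1/2) ^ Suc n * 4 ^ n) \<le> ennreal (2 * c)"
      by (subst ennreal_mult) auto
    then have "(1/2) ^ Suc n * 4 ^ n \<le> 2 * c" using c0 by (simp del: power_Suc)
    moreover have "(1/2) ^ n * (4::real) ^ n = 2 ^ n" by (simp add: power_mult_distrib[symmetric])
    ultimately show ?thesis by simp
  qed
  moreover obtain n where "4 * c < 2 ^ n" using real_arch_pow[of 2 "4 * c"] by auto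
  ultimately show False by (smt (verit) field_sum_of_halves)
qed

section \<open>The dual is contained in the Orlicz-Lorentz space\<close>

lemma rearrangement_finite:
  assumes f: "f \<in> borel_measurable L" and s0: "0 \<le> s0" "distr_fun a f s0 < \<infinity>" and t: "0 < t"
  shows "rearrangement a f t < \<infinity>"
proof -
  note [measurable] = f
  let ?A = "\<lambda>n::nat. {x \<in> space L. s0 + real n < \<bar>f x\<bar>}"
  have "emeasure L (?A n) \<noteq> \<infinity>" for n
  proof -
    have m: "{x \<in> space L. s0 < \<bar>f x\<bar>} \<in> sets L" by measurable
    have "emeasure L (?A n) \<le> distr_fun a f s0"
      unfolding distr_fun_def using m by (intro emeasure_mono) auto
    with s0(2) show ?thesis by auto
  qed
  then have "(\<lambda>n. emeasure L (?A n)) \<longlonglongrightarrow> emeasure L (\<Inter>n. ?A n)"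
  proof (intro Lim_emeasure_decseq)
    have "?A n \<in> sets L" for n by measurable
    then show "range ?A \<subseteq> sets L" by blast
  qed (auto simp: decseq_def)
  also have "(\<Inter>n. ?A n) = {}"
  proof -
    have "x \<notin> ?A (nat \<lceil>\<bar>f x\<bar>\<rceil>)" for x using s0(1) by (simp add: not_less) linarith
    then show ?thesis by blast
  qed
  finally have "eventually (\<lambda>n. emeasure L (?A n) < ennreal t) sequentially"
    using t by (intro order_tendstoD(2)) auto
  then obtain n where "emeasure L (?A n) < ennreal t" by (auto simp: eventually_sequentially)
  then have "rearrangement a f t \<le> ennreal (s0 + real n)"
    using s0(1) by (subst rearrangement_le_iff[OF f]) (auto simp: distr_fun_def)
  then show ?thesis by (simp add: le_less_trans)
qed

lemma phi_comp_measurable: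
  assumes [measurable]: "u \<in> borel_measurable L" and u: "\<And>t. t \<in> I \<Longrightarrow> 0 \<le> u t"
  shows "(\<lambda>t. \<phi> (u t)) \<in> borel_measurable L" "(\<lambda>t. complementary \<phi> (u t)) \<in> borel_measurable L"
proof -
  have "(\<lambda>t. \<phi> (max 0 (u t))) \<in> borel_measurable L"
    using measurable_compose[OF assms(1) borel_measurable_phi_max[OF N]] .
  then show "(\<lambda>t. \<phi> (u t)) \<in> borel_measurable L"
    by (rule measurable_cong[THEN iffD1, rotated]) (auto simp: max_absorb2 u)
  have "(\<lambda>t. complementary \<phi> (max 0 (u t))) \<in> borel_measurable L"
    using measurable_compose[OF assms(1) borel_measurable_complementary_max[OF N]] .
  then show "(\<lambda>t. complementary \<phi> (u t)) \<in> borel_measurable L"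
    by (rule measurable_cong[THEN iffD1, rotated]) (auto simp: max_absorb2 u)
qed

text \<open>
  Testing against \<open>h = q(u)\<close>, the equality case of Young's inequality, bounds the modular of a bounded
  truncation \<open>u\<close> of \<open>f\<^sup>* / C\<close>. The weight is truncated as well, so that this also covers weights
  that are not integrable at \<open>0\<close>.
\<close>
lemma complementary_modular_truncated_le:
  fixes F :: "real \<Rightarrow> real" and n :: nat
  assumes C: "0 < C" "\<And>k. k \<in> K \<Longrightarrow> (\<integral>\<^sup>+t. ennreal (F t * k t) \<partial>L) \<le> ennreal C"
    and F: "antimono_on I F" "\<And>t. t \<in> I \<Longrightarrow> 0 \<le> F t"
  shows "(\<integral>\<^sup>+t. ennreal (complementary \<phi> (if t < real n then min (F t / C) (real n) else 0) * min (w t) (real n)) \<partial>L) \<le> 1"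
proof -
  obtain q where q: "\<And>t. 0 \<le> t \<Longrightarrow> 0 \<le> q t" "q 0 = 0" "\<And>s t. 0 \<le> s \<Longrightarrow> s \<le> t \<Longrightarrow> q s \<le> q t"
    "\<And>t. 0 \<le> t \<Longrightarrow> q t * t = \<phi> (q t) + complementary \<phi> t"
    by (rule Young_equality_selection[OF N]) (rule that)
  define u where "u t = (if t < real n then min (F t / C) (real n) else 0)" for t
  define v where "v t = min (w t) (real n)" for t
  define h where "h t = q (u t)" for t
  have u0: "0 \<le> u t" if "t \<in> I" for t using F(2)[OF that] C(1) by (simp add: u_def)
  have v0: "0 \<le> v t" if "t \<in> I" for t using w_nonneg[OF that] by (simp add: v_def)
  have h0: "0 \<le> h t" if "t \<in> I" for t using q(1) u0[OF that] by (simp add: h_def)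
  have u_anti: "u t \<le> u s" if st: "s \<in> I" "t \<in> I" "s \<le> t" for s t
  proof -
    have "F t \<le> F s" using F(1) st by (auto simp: monotone_on_def)
    then have "F t / C \<le> F s / C" using C(1) by (intro divide_right_mono) auto
    then show ?thesis using st u0[OF st(1)] by (auto simp: u_def)
  qed
  have h_anti: "h t \<le> h s" if "s \<in> I" "t \<in> I" "s \<le> t" for s t
    using q(3) u_anti u0 that by (simp add: h_def)
  have v_anti: "v t \<le> v s" if "s \<in> I" "t \<in> I" "s \<le> t" for s t
    using w_antimono[OF that] by (auto simp: v_def)
  have [measurable]: "u \<in> borel_measurable L" "h \<in> borel_measurable L" "v \<in> borel_measurable L"
    using u_anti h_anti v_anti by (auto intro!: antimono_on_measurable monotone_onI)
  have [measurable]: "(\<lambda>t. \<phi> (h t)) \<in> borel_measurable L" "(\<lambda>t. complementary \<phi> (u t)) \<in> borel_measurable L"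
    using phi_comp_measurable[of h] phi_comp_measurable[of u] h0 u0 by auto
  define A where "A = (\<integral>\<^sup>+t. ennreal (\<phi> (h t) * v t) \<partial>L)"
  define D where "D = (\<integral>\<^sup>+t. ennreal (complementary \<phi> (u t) * v t) \<partial>L)"
  \<comment> \<open>The truncations of value, domain and weight make \<open>A\<close> finite, so
    that it can be cancelled against part of the bound for \<open>A + D\<close>.\<close>
  have "A \<le> (\<integral>\<^sup>+t. ennreal (\<phi> (q (real n)) * real n) * indicator {x \<in> I. x < real n} t \<partial>L)"
    unfolding A_def
  proof (rule nn_integral_mono)
    fix t assume "t \<in> space L"
    then have t: "t \<in> I" by simp
    show "ennreal (\<phi> (h t) * v t) \<le> ennreal (\<phi> (q (real n)) * real n) * indicator {x \<in> I. x < real n} t"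
    proof (cases "t < real n")
      case True
      have "\<phi> (h t) \<le> \<phi> (q (real n))"
        unfolding h_def using u0[OF t] q(1,3) by (intro phi_mono[OF N] q) (auto simp: u_def)
      moreover have "v t \<le> real n" by (simp add: v_def)
      ultimately have "\<phi> (h t) * v t \<le> \<phi> (q (real n)) * real n"
        using v0[OF t] phi_nonneg[OF N q(1), of "real n"] by (intro mult_mono) auto
      then show ?thesis using True t by (simp add: ennreal_leI)
    next
      case False
      then show ?thesis by (simp add: h_def u_def q(2) phi_0[OF N])
    qed
  qed
  also have "\<dots> = ennreal (\<phi> (q (real n)) * real n) * emeasure L {x \<in> I. x < real n}"
    by (rule nn_integral_cmult_indicator) measurable
  also have "\<dots> < \<infinity>"
    using emeasure_leb_I_less_le[of a "real n"] by (auto simp: ennreal_mult_less_top intro: le_less_trans)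
  finally obtain \<alpha> where \<alpha>: "A = ennreal \<alpha>" "0 \<le> \<alpha>" by (cases A) auto
  \<comment> \<open>Dividing by \<open>m\<close> brings the modular of \<open>h v\<close> down to at
    most 1, so that \<open>k\<close> is an admissible test function.\<close>
  define m where "m = max 1 \<alpha>"
  have m: "1 \<le> m" "\<alpha> \<le> m" by (auto simp: m_def)
  define k where "k t = h t * v t / m" for t
  have kK: "k \<in> K"
    unfolding K_def
  proof (intro CollectI conjI ballI)
    show "antimono_on I k"
    proof (rule monotone_onI)
      fix s t assume st: "s \<in> I" "t \<in> I" "s \<le> t"
      have "h t * v t \<le> h s * v s" using h_anti[OF st] v_anti[OF st] h0 v0 st by (intro mult_mono) auto
      then show "k t \<le> k s" unfolding k_def using m by (intro divide_right_mono) auto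
    qed
    show "0 \<le> k t" if "t \<in> I" for t using h0 v0 m that by (simp add: k_def)
    have "(\<integral>\<^sup>+t. k_integrand k t \<partial>L) \<le> (\<integral>\<^sup>+t. ennreal (1 / m) * ennreal (\<phi> (h t) * v t) \<partial>L)"
    proof (rule nn_integral_mono)
      fix t assume "t \<in> space L"
      then have t: "t \<in> I" by simp
      show "k_integrand k t \<le> ennreal (1 / m) * ennreal (\<phi> (h t) * v t)"
      proof (cases "w t = 0")
        case True
        then show ?thesis by (simp add: k_integrand_def k_def v_def)
      next
        case False
        then have w: "0 < w t" using w_nonneg[OF t] by simp
        \<comment> \<open>\<open>k / w\<close> is \<open>h\<close> times this factor, which
          convexity lets one pull out of \<open>\<phi>\<close>.\<close>
        have "v t / (w t * m) \<le> 1"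
          using w m v0[OF t] by (simp add: pos_divide_le_eq) (smt (verit) mult_le_cancel_left1 v_def)
        then have "\<phi> (v t / (w t * m) * h t) \<le> v t / (w t * m) * \<phi> (h t)"
          using w m v0[OF t] h0[OF t] by (intro phi_scale[OF N]) auto
        then have "\<phi> (k t / w t) * w t \<le> 1 / m * (\<phi> (h t) * v t)"
          using w m by (simp add: k_def field_simps)
        then show ?thesis
          using w m phi_nonneg[OF N h0[OF t]] v0[OF t]
          by (subst ennreal_mult[symmetric]) (auto simp: k_integrand_def intro!: ennreal_leI)
      qed
    qed
    also have "\<dots> = ennreal (1 / m) * A" unfolding A_def by (rule nn_integral_cmult) measurable
    also have "\<dots> \<le> 1" using m \<alpha> by (simp add: ennreal_mult[symmetric])
    finally show "(\<integral>\<^sup>+t. k_integrand k t \<partial>L) \<le> 1" .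
  qed
  have Fm[measurable]: "F \<in> borel_measurable L" using F(1) by (rule antimono_on_measurable)
  \<comment> \<open>Equality in Young's inequality turns the sum into the integral of
    \<open>u h v\<close>, and \<open>u \<le> F / C\<close> bounds this by \<open>m / C\<close> times
    the integral of \<open>F k\<close>.\<close>
  have "A + D = (\<integral>\<^sup>+t. ennreal (\<phi> (h t) * v t) + ennreal (complementary \<phi> (u t) * v t) \<partial>L)"
    unfolding A_def D_def by (rule nn_integral_add[symmetric]) measurable
  also have "\<dots> \<le> (\<integral>\<^sup>+t. ennreal (m / C) * ennreal (F t * k t) \<partial>L)"
  proof (rule nn_integral_mono)
    fix t assume "t \<in> space L"
    then have t: "t \<in> I" by simp
    have "\<phi> (h t) * v t + complementary \<phi> (u t) * v t = u t * (h t * v t)"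
    proof -
      have "\<phi> (h t) * v t + complementary \<phi> (u t) * v t = (\<phi> (h t) + complementary \<phi> (u t)) * v t"
        by (simp only: distrib_right)
      also have "\<phi> (h t) + complementary \<phi> (u t) = h t * u t"
        using q(4)[OF u0[OF t]] by (simp add: h_def)
      finally show ?thesis by (simp only: mult_ac)
    qed
    also have "\<dots> \<le> F t / C * (h t * v t)"
      using h0[OF t] v0[OF t] F(2)[OF t] C(1) by (intro mult_right_mono) (auto simp: u_def)
    also have "\<dots> = m / C * (F t * k t)" using m by (simp add: k_def)
    finally have "\<phi> (h t) * v t + complementary \<phi> (u t) * v t \<le> m / C * (F t * k t)" .
    then show "ennreal (\<phi> (h t) * v t) + ennreal (complementary \<phi> (u t) * v t) \<le>
      ennreal (m / C) * ennreal (F t * k t)"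
      using m C(1) F(2)[OF t] h0[OF t] v0[OF t] phi_nonneg[OF N h0[OF t]] complementary_nonneg[OF N u0[OF t]]
      by (subst ennreal_mult[symmetric]) (auto simp: k_def ennreal_plus[symmetric] simp del: ennreal_plus intro!: ennreal_leI)
  qed
  also have "\<dots> = ennreal (m / C) * (\<integral>\<^sup>+t. ennreal (F t * k t) \<partial>L)"
  proof -
    have [measurable]: "k \<in> borel_measurable L" unfolding k_def[abs_def] by measurable
    show ?thesis by (rule nn_integral_cmult) measurable
  qed
  also have "\<dots> \<le> ennreal (m / C) * ennreal C"
    by (intro mult_left_mono C(2) kK) auto
  also have "\<dots> = ennreal m" using m C(1) by (simp add: ennreal_mult[symmetric])
  finally have AD: "A + D \<le> ennreal m" .
  have "D \<le> ennreal m" using AD by (meson le_add2 order_trans zero_le add_increasing order_refl le_add_same_cancel2)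
  then obtain \<delta> where \<delta>: "D = ennreal \<delta>" "0 \<le> \<delta>" by (cases D) (auto simp: top_unique)
  have "\<alpha> + \<delta> \<le> m"
    using AD \<alpha> \<delta> m by (simp add: ennreal_plus[symmetric] del: ennreal_plus)
  \<comment> \<open>For \<open>\<alpha> \<ge> 1\<close> the maximum is \<open>\<alpha>\<close> and
    \<open>\<delta>\<close> vanishes; otherwise it is 1 and
    \<open>\<alpha> + \<delta> \<le> 1\<close>.\<close>
  then have "\<delta> \<le> 1" using \<alpha> \<delta> by (auto simp: m_def max_def split: if_splits)
  then show ?thesis using \<delta> by (simp add: D_def u_def v_def)
qed

lemma rearrangement_real:
  "rearrangement a f t < \<infinity> \<Longrightarrow> rearrangement a f t = ennreal (enn2real (rearrangement a f t))"
  by (simp add: less_top)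

lemma enn2real_rearrangement_antimono:
  assumes "\<And>t. t \<in> I \<Longrightarrow> rearrangement a f t < \<infinity>"
  shows "antimono_on I (\<lambda>t. enn2real (rearrangement a f t))"
  using assms by (intro monotone_onI enn2real_mono rearrangement_antimono) auto

lemma kothe_dual_subset_Lambda:
  "kothe_dual a (M_class \<phi> w a) \<subseteq> Lambda_space (complementary \<phi>) w a"
proof
  fix f assume f: "f \<in> kothe_dual a (M_class \<phi> w a)"
  have fm: "f \<in> borel_measurable L" using f by (simp add: kothe_dual_def L0_def)
  obtain s0 where s0: "0 \<le> s0" "distr_fun a f s0 < \<infinity>" using kothe_dual_distr_finite[OF f] .
  have fin: "rearrangement a f t < \<infinity>" if "t \<in> I" for t
    using rearrangement_finite[OF fm s0 I_pos[OF that]] .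
  define F where "F t = enn2real (rearrangement a f t)" for t
  have F_anti: "antimono_on I F"
    unfolding F_def[abs_def] using fin by (rule enn2real_rearrangement_antimono)
  have F0: "0 \<le> F t" for t by (simp add: F_def)
  have fF: "rearrangement a f t = ennreal (F t)" if "t \<in> I" for t
    using rearrangement_real[OF fin[OF that]] by (simp add: F_def)
  have Fm[measurable]: "F \<in> borel_measurable L" using F_anti by (rule antimono_on_measurable)
  obtain C :: real where C: "0 < C"
    "\<And>k. k \<in> K \<Longrightarrow> (\<integral>\<^sup>+t. rearrangement a f t * ennreal (k t) \<partial>L) \<le> ennreal C"
    using kothe_dual_K_bounded[OF f] by blast
  have C': "(\<integral>\<^sup>+t. ennreal (F t * k t) \<partial>L) \<le> ennreal C" if "k \<in> K" for k
  proof -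
    have "(\<integral>\<^sup>+t. ennreal (F t * k t) \<partial>L) = (\<integral>\<^sup>+t. rearrangement a f t * ennreal (k t) \<partial>L)"
      using that F0 by (intro nn_integral_cong) (simp add: fF ennreal_mult K_def)
    then show ?thesis using C(2)[OF that] by simp
  qed
  let ?u = "\<lambda>n t. if t < real n then min (F t / C) (real n) else 0"
  let ?G = "\<lambda>n t. ennreal (complementary \<phi> (?u n t) * min (w t) (real n))"
  have Gm: "?G n \<in> borel_measurable L" for n :: nat
  proof -
    have "{t \<in> space L. t < real n} \<in> sets L" by simp
    then have [measurable]: "Measurable.pred L (\<lambda>t. t < real n)" by (simp only: pred_def)
    have "?u n \<in> borel_measurable L" by measurable
    then have "(\<lambda>t. complementary \<phi> (?u n t)) \<in> borel_measurable L"
      using F0 C(1) by (intro phi_comp_measurable) auto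
    then show ?thesis by measurable
  qed
  have "(\<integral>\<^sup>+t. ennreal (complementary \<phi> (F t / C) * w t) \<partial>L) = (\<integral>\<^sup>+t. liminf (\<lambda>n. ?G n t) \<partial>L)"
  proof (rule nn_integral_cong)
    fix t
    \<comment> \<open>Past this index none of the truncations acts at \<open>t\<close>, so the
      sequence is eventually constant there and Fatou's lemma yields the full modular.\<close>
    obtain n0 :: nat where n0: "\<bar>t\<bar> + \<bar>F t / C\<bar> + \<bar>w t\<bar> < real n0" using reals_Archimedean2 by blast
    have "eventually (\<lambda>n. ?G n t = ennreal (complementary \<phi> (F t / C) * w t)) sequentially"
    proof (rule eventually_sequentiallyI[of n0])
      fix n assume "n0 \<le> n"
      then have "t < real n" "F t / C \<le> real n" "w t \<le> real n" using n0 by linarith+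
      then show "?G n t = ennreal (complementary \<phi> (F t / C) * w t)" by (simp add: min_absorb1)
    qed
    then have "(\<lambda>n. ?G n t) \<longlonglongrightarrow> ennreal (complementary \<phi> (F t / C) * w t)"
      by (rule tendsto_eventually)
    then show "ennreal (complementary \<phi> (F t / C) * w t) = liminf (\<lambda>n. ?G n t)"
      by (intro lim_imp_Liminf[symmetric]) auto
  qed
  also have "\<dots> \<le> liminf (\<lambda>n. \<integral>\<^sup>+t. ?G n t \<partial>L)"
    by (rule nn_integral_liminf) (rule Gm)
  also have "\<dots> \<le> liminf (\<lambda>n::nat. 1)"
    using complementary_modular_truncated_le[OF C(1) C' F_anti F0] by (intro Liminf_mono always_eventually allI)
  also have "\<dots> = 1" by (simp add: Liminf_const)
  finally have "(\<integral>\<^sup>+t. ennreal (complementary \<phi> (1 / C * \<bar>F t\<bar>) * w t) \<partial>L) < \<infinity>"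
    using F0 by (simp add: le_less_trans)
  then have "F \<in> Lw_class (complementary \<phi>) w a"
    unfolding Lw_class_def L0_def using C(1) Fm by (auto intro!: exI[of _ "1 / C"])
  then show "f \<in> Lambda_space (complementary \<phi>) w a"
    using fin fm by (simp add: Lambda_space_def L0_def F_def[abs_def])
qed

section \<open>The Orlicz-Lorentz space is contained in the dual\<close>

lemma Lambda_spaceD:
  assumes "f \<in> Lambda_space (complementary \<phi>) w a"
  shows "f \<in> borel_measurable L" "\<And>t. t \<in> I \<Longrightarrow> rearrangement a f t < \<infinity>"
    "\<exists>c>0. (\<integral>\<^sup>+t. ennreal (complementary \<phi> (c * enn2real (rearrangement a f t)) * w t) \<partial>L) < \<infinity>"
  using assms by (auto simp: Lambda_space_def Lw_class_def L0_def)

text \<open>Young's inequality for \<open>c f\<^sup>*\<close> and \<open>(d g)\<^sup>* / w\<close>,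
  multiplied by \<open>w\<close>, where the scales \<open>c\<close> and \<open>d\<close> make the
  two modulars finite.\<close>

lemma Lambda_M_rearrangement_finite:
  assumes f: "f \<in> Lambda_space (complementary \<phi>) w a" and g: "g \<in> M_class \<phi> w a"
  shows "(\<integral>\<^sup>+t. rearrangement a f t * rearrangement a g t \<partial>L) < \<infinity>"
proof -
  note fm = Lambda_spaceD(1)[OF f]
  define F where "F t = enn2real (rearrangement a f t)" for t
  have F: "rearrangement a f t = ennreal (F t)" "0 \<le> F t" if "t \<in> I" for t
    using rearrangement_real[OF Lambda_spaceD(2)[OF f that]] by (auto simp: F_def)
  obtain c where c: "0 < c" "(\<integral>\<^sup>+t. ennreal (complementary \<phi> (c * F t) * w t) \<partial>L) < \<infinity>"
    using Lambda_spaceD(3)[OF f] by (auto simp: F_def)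
  have gm: "g \<in> borel_measurable L" using g by (simp add: M_class_def L0_def)
  obtain d where d: "0 < d" "M_modular \<phi> w a (\<lambda>t. d * g t) < \<infinity>"
    using g by (auto simp: M_class_def)
  have dgm: "(\<lambda>t. d * g t) \<in> borel_measurable L" using gm by measurable
  note [measurable] = rearrangement_measurable_leb_I[OF fm] rearrangement_measurable_leb_I[OF gm]
    M_integrand_measurable[OF dgm]
  have Fm: "F \<in> borel_measurable L" unfolding F_def[abs_def] by measurable
  have Ym: "(\<lambda>t. ennreal (complementary \<phi> (c * F t) * w t)) \<in> borel_measurable L"
  proof -
    have "(\<lambda>t. c * F t) \<in> borel_measurable L" using Fm by measurable
    then have "(\<lambda>t. complementary \<phi> (c * F t)) \<in> borel_measurable L"
      by (rule phi_comp_measurable(2)) (use c(1) in \<open>simp add: F_def\<close>)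
    then show ?thesis by measurable
  qed
  have "ennreal (c * d) * (\<integral>\<^sup>+t. rearrangement a f t * rearrangement a g t \<partial>L) =
      (\<integral>\<^sup>+t. ennreal (c * d) * (rearrangement a f t * rearrangement a g t) \<partial>L)"
    by (rule nn_integral_cmult[symmetric]) measurable
  also have "\<dots> \<le> (\<integral>\<^sup>+t. ennreal (complementary \<phi> (c * F t) * w t) + M_integrand \<phi> w a (\<lambda>t. d * g t) t \<partial>L)"
  proof (rule nn_integral_mono)
    fix t assume "t \<in> space L"
    then have t: "t \<in> I" by simp
    have eq: "ennreal (c * d) * (rearrangement a f t * rearrangement a g t) =
        ennreal (c * F t) * rearrangement a (\<lambda>t. d * g t) t"
      using c(1) d(1) F[OF t] rearrangement_cmult[OF gm d(1), of t] by (simp add: ennreal_mult mult_ac)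
    show "ennreal (c * d) * (rearrangement a f t * rearrangement a g t) \<le>
        ennreal (complementary \<phi> (c * F t) * w t) + M_integrand \<phi> w a (\<lambda>t. d * g t) t"
    proof (cases "rearrangement a (\<lambda>t. d * g t) t")
      case top
      then show ?thesis by (simp add: M_integrand_def)
    next
      case (real r)
      show ?thesis
      proof (cases "w t = 0")
        case True
        \<comment> \<open>At a zero of \<open>w\<close> the convention decides: for
          \<open>r > 0\<close> the right-hand side is infinite, for \<open>r = 0\<close> the
          left-hand side is 0.\<close>
        then show ?thesis using real unfolding eq by (cases "r = 0") (auto simp: M_integrand_def)
      next
        case False
        then have w: "0 < w t" using w_nonneg[OF t] by simp
        have x0: "0 \<le> r / w t" "0 \<le> c * F t" using real w c(1) F(2)[OF t] by auto
        have "r / w t * (c * F t) * w t \<le> (\<phi> (r / w t) + complementary \<phi> (c * F t)) * w t"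
          using w by (intro mult_right_mono Young_inequality[OF N x0]) auto
        then have le: "c * F t * r \<le> complementary \<phi> (c * F t) * w t + \<phi> (r / w t) * w t"
          using w by (simp add: algebra_simps)
        have "ennreal (c * F t) * ennreal r = ennreal (c * F t * r)"
          using real x0 by (simp only: ennreal_mult)
        also have "\<dots> \<le> ennreal (complementary \<phi> (c * F t) * w t + \<phi> (r / w t) * w t)"
          using le by (rule ennreal_leI)
        also have "\<dots> = ennreal (complementary \<phi> (c * F t) * w t) + ennreal (\<phi> (r / w t) * w t)"
          using w phi_nonneg[OF N x0(1)] complementary_nonneg[OF N x0(2)] by (intro ennreal_plus) auto
        finally show ?thesis using real w unfolding eq by (simp add: M_integrand_def)
      qed
    qed
  qed
  also have "\<dots> = (\<integral>\<^sup>+t. ennreal (complementary \<phi> (c * F t) * w t) \<partial>L) + M_modular \<phi> w a (\<lambda>t. d * g t)"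
    unfolding M_modular_def by (rule nn_integral_add) (use Ym in measurable)
  also have "\<dots> < \<infinity>" using c(2) d(2) by simp
  finally show ?thesis using c(1) d(1) by (auto simp: ennreal_mult_less_top ennreal_mult_eq_top_iff less_top[symmetric])
qed

lemma Lambda_M_integrable:
  assumes f: "f \<in> Lambda_space (complementary \<phi>) w a" and g: "g \<in> M_class \<phi> w a"
  shows "integrable L (\<lambda>t. f t * g t)"
proof -
  note [measurable] = Lambda_spaceD(1)[OF f]
  have [measurable]: "g \<in> borel_measurable L" using g by (simp add: M_class_def L0_def)
  have "(\<integral>\<^sup>+t. ennreal \<bar>f t * g t\<bar> \<partial>L) < \<infinity>"
    using Hardy_Littlewood[of f a g] Lambda_M_rearrangement_finite[OF f g] by (simp add: le_less_trans)
  then show ?thesis unfolding integrable_iff_bounded by simp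
qed

lemma kothe_dual_M_class: "kothe_dual a (M_class \<phi> w a) = Lambda_space (complementary \<phi>) w a"
proof
  show "Lambda_space (complementary \<phi>) w a \<subseteq> kothe_dual a (M_class \<phi> w a)"
    using Lambda_M_integrable Lambda_spaceD(1) by (auto simp: kothe_dual_def L0_def)
qed (rule kothe_dual_subset_Lambda)

section \<open>The duality of the norms\<close>

lemma integral_le_orlicz_norm:
  assumes f: "f \<in> Lambda_space (complementary \<phi>) w a"
    and g: "g \<in> M_class \<phi> w a" "M_norm \<phi> w a g \<le> 1"
  shows "ereal (\<integral>t. f t * g t \<partial>L) \<le> Lambda_orlicz_norm \<phi> w a f"
proof -
  note [measurable] = Lambda_spaceD(1)[OF f]
  have gm[measurable]: "g \<in> borel_measurable L" using g by (simp add: M_class_def L0_def)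
  note rm[measurable] = rearrangement_measurable_leb_I[OF Lambda_spaceD(1)[OF f]] rearrangement_measurable_leb_I[OF gm]
  define F where "F t = enn2real (rearrangement a f t)" for t
  define h where "h t = (if w t = 0 then 0 else enn2real (rearrangement a g t) / w t)" for t
  have hm[measurable]: "h \<in> borel_measurable L" unfolding h_def[abs_def] by measurable
  have le: "(\<integral>\<^sup>+t. ennreal (\<phi> (c * \<bar>h t\<bar>) * w t) \<partial>L) \<le> M_modular \<phi> w a (\<lambda>t. c * g t)" if c: "0 < c" for c
    unfolding M_modular_def
  proof (rule nn_integral_mono)
    fix t assume "t \<in> space L"
    then have t: "t \<in> I" by simp
    have "rearrangement a (\<lambda>t. c * g t) t = ennreal c * rearrangement a g t"
      by (rule rearrangement_cmult[OF gm c])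
    then show "ennreal (\<phi> (c * \<bar>h t\<bar>) * w t) \<le> M_integrand \<phi> w a (\<lambda>t. c * g t) t"
      using c w_nonneg[OF t] by (auto simp: M_integrand_def h_def enn2real_mult)
  qed
  have hL: "h \<in> Lw_class \<phi> w a"
    using g(1) le hm by (auto simp: M_class_def Lw_class_def L0_def intro: le_less_trans)
  have "Lw_norm \<phi> w a h \<le> M_norm \<phi> w a g"
    unfolding Lw_norm_def M_norm_def
  proof (rule Inf_superset_mono, safe)
    fix e :: real assume e: "0 < e" "M_modular \<phi> w a (\<lambda>t. g t / e) \<le> 1"
    show "\<exists>e'. ennreal e = ennreal e' \<and> 0 < e' \<and> (\<integral>\<^sup>+t. ennreal (\<phi> (\<bar>h t\<bar> / e') * w t) \<partial>L) \<le> 1"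
      using le[of "1 / e"] e by (intro exI[of _ e]) (simp add: order_trans)
  qed
  then have h1: "Lw_norm \<phi> w a h \<le> 1" using g(2) by order
  \<comment> \<open>A finite modular at some scale makes \<open>g\<^sup>*\<close> almost everywhere
    finite, and 0 where \<open>w\<close> vanishes. Hence \<open>h w\<close> recovers
    \<open>g\<^sup>*\<close> almost everywhere.\<close>
  obtain d where d: "0 < d" "M_modular \<phi> w a (\<lambda>t. d * g t) < \<infinity>"
    using g(1) by (auto simp: M_class_def)
  have dgm: "(\<lambda>t. d * g t) \<in> borel_measurable L" by measurable
  have "AE t in L. M_integrand \<phi> w a (\<lambda>t. d * g t) t \<noteq> \<infinity>"
    using d(2) by (intro nn_integral_PInf_AE M_integrand_measurable[OF dgm]) (auto simp: M_modular_def)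
  then have ae: "AE t in L. rearrangement a f t * rearrangement a g t = ennreal (F t * h t * w t)"
    using AE_space
  proof eventually_elim
    case (elim t)
    then have t: "t \<in> I" by simp
    have dg: "rearrangement a (\<lambda>t. d * g t) t = ennreal d * rearrangement a g t"
      by (rule rearrangement_cmult[OF gm d(1)])
    have fin: "rearrangement a g t < \<infinity>" "w t = 0 \<Longrightarrow> rearrangement a g t = 0"
      using elim(1) d(1) by (auto simp: M_integrand_def dg ennreal_mult_eq_top_iff less_top[symmetric] split: if_splits)
    then obtain r where r: "rearrangement a g t = ennreal r" "0 \<le> r" by (cases "rearrangement a g t") auto
    have "h t * w t = r" using r fin(2) by (auto simp: h_def)
    moreover have "rearrangement a f t = ennreal (F t)" "0 \<le> F t"
      using rearrangement_real[OF Lambda_spaceD(2)[OF f t]] by (auto simp: F_def)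
    ultimately show ?case using r by (simp add: ennreal_mult mult.assoc)
  qed
  have "(\<integral>t. f t * g t \<partial>L) \<le> (\<integral>t. \<bar>f t * g t\<bar> \<partial>L)"
    using Lambda_M_integrable[OF f g(1)] by (intro integral_mono) auto
  also have "\<dots> = enn2real (\<integral>\<^sup>+t. ennreal \<bar>f t * g t\<bar> \<partial>L)"
    by (intro integral_eq_nn_integral) auto
  also have "\<dots> \<le> enn2real (\<integral>\<^sup>+t. rearrangement a f t * rearrangement a g t \<partial>L)"
    using Lambda_M_rearrangement_finite[OF f g(1)] by (intro enn2real_mono Hardy_Littlewood) auto
  also have "(\<integral>\<^sup>+t. rearrangement a f t * rearrangement a g t \<partial>L) = (\<integral>\<^sup>+t. ennreal (F t * h t * w t) \<partial>L)"
    by (rule nn_integral_cong_AE[OF ae])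
  also have "enn2real \<dots> = (\<integral>t. F t * h t * w t \<partial>L)"
    by (intro integral_eq_nn_integral[symmetric])
      (use w_nonneg in \<open>auto simp: F_def h_def intro!: AE_I2\<close>)
  finally have "ereal (\<integral>t. f t * g t \<partial>L) \<le> ereal (\<integral>t. enn2real (rearrangement a f t) * h t * w t \<partial>L)"
    by (simp add: F_def)
  also have "\<dots> \<le> Lambda_orlicz_norm \<phi> w a f"
    unfolding Lambda_orlicz_norm_def using hL h1 by (intro SUP_upper) auto
  finally show ?thesis .
qed

text \<open>With \<open>\<mu> = w(t) dt\<close>, the superlevel sets of \<open>h'\<close> are
  initial segments with the same \<open>\<mu>\<close>-measure as those of \<open>|h|\<close>. So
  \<open>\<phi> \<circ> h'\<close> has the same distribution as \<open>\<phi> \<circ> |h|\<close>,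
  and since the superlevel sets of \<open>F\<close> are initial segments as well, the integral
  against \<open>F\<close> can only grow.\<close>

lemma weighted_rearrangement:
  fixes h :: "real \<Rightarrow> real" and F :: "real \<Rightarrow> ennreal"
  assumes hm[measurable]: "h \<in> borel_measurable L"
    and h1: "(\<integral>\<^sup>+t. ennreal (\<phi> \<bar>h t\<bar> * w t) \<partial>L) \<le> 1"
    and W: "\<And>t. t \<in> I \<Longrightarrow> (\<integral>\<^sup>+x. ennreal (w x) * indicator {x \<in> I. x < t} x \<partial>L) < \<infinity>"
    and Fm[measurable]: "F \<in> borel_measurable L" and F: "antimono_on I F"
  obtains h' where "antimono_on I h'" "\<And>t. t \<in> I \<Longrightarrow> 0 \<le> h' t"
    "(\<integral>\<^sup>+t. ennreal (\<phi> (h' t) * w t) \<partial>L) \<le> 1"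
    "(\<integral>\<^sup>+t. F t * ennreal (\<bar>h t\<bar> * w t) \<partial>L) \<le> (\<integral>\<^sup>+t. F t * ennreal (h' t * w t) \<partial>L)"
proof -
  define \<mu> where "\<mu> = density L (\<lambda>x. ennreal (w x))"
  have sets[simp]: "sets \<mu> = sets L" and sp[simp]: "space \<mu> = I" by (auto simp: \<mu>_def)
  have meas: "u \<in> borel_measurable \<mu> \<longleftrightarrow> u \<in> borel_measurable L" for u :: "real \<Rightarrow> ennreal"
    by (subst measurable_cong_sets[OF sets refl]) (rule refl)
  have sf: "sigma_finite_measure \<mu>"
  proof -
    interpret sigma_finite_measure L by (auto intro!: sigma_finite_lebesgue_on)
    show ?thesis unfolding \<mu>_def by (subst sigma_finite_iff_density_finite) auto
  qed
  have int: "(\<integral>\<^sup>+t. u t \<partial>\<mu>) = (\<integral>\<^sup>+t. ennreal (w t) * u t \<partial>L)" if "u \<in> borel_measurable L" for u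
    unfolding \<mu>_def using that by (intro nn_integral_density) auto
  have hm\<mu>: "h \<in> borel_measurable \<mu>"
    using hm by (subst measurable_cong_sets[of \<mu> L borel borel]) auto
  define Wt where "Wt t = emeasure \<mu> {x \<in> I. x < t}" for t
  have Wt: "Wt t = (\<integral>\<^sup>+x. ennreal (w x) * indicator {x \<in> I. x < t} x \<partial>L)" for t
    unfolding Wt_def \<mu>_def by (rule emeasure_density) auto
  have Wt_fin: "Wt t < \<infinity>" if "t \<in> I" for t using W[OF that] by (simp add: Wt)
  have Wt_mono: "Wt s \<le> Wt t" if "s \<le> t" for s t
    unfolding Wt_def using that by (intro emeasure_mono) auto
  \<comment> \<open>A decreasing weight is at least \<open>w t0 > 0\<close> on
    \<open>(0, t0)\<close>. Positive mass matters for finiteness: at mass 0 the rearrangement would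
    be the essential supremum of \<open>|h|\<close>.\<close>
  have Wt_pos: "0 < Wt t" if t: "t \<in> I" for t
  proof -
    obtain t0 where t0: "t0 \<in> I" "0 < w t0" by (rule w_pos_point)
    define s where "s = min t t0"
    have s: "s \<in> I" "s \<le> t" "s \<le> t0" using t t0 by (auto simp: s_def min_def)
    have "0 < ennreal (w t0) * ennreal s"
      using t0 I_pos[OF s(1)] by (simp add: ennreal_zero_less_mult_iff)
    also have "\<dots> = (\<integral>\<^sup>+x. ennreal (w t0) * indicator {x \<in> I. x < s} x \<partial>L)"
      by (subst nn_integral_cmult_indicator) (auto simp: emeasure_leb_I_less[OF s(1)])
    also have "\<dots> \<le> Wt s"
      unfolding Wt using w_antimono[OF _ t0(1)] s
      by (intro nn_integral_mono) (auto split: split_indicator intro!: ennreal_leI)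
    also have "\<dots> \<le> Wt t" by (rule Wt_mono[OF s(2)])
    finally show ?thesis .
  qed
  define H where "H t = rearr \<mu> h (Wt t)" for t
  define m where "m s = emeasure \<mu> {x \<in> I. s < \<bar>h x\<bar>}" for s
  have H_less: "ennreal s < H t \<longleftrightarrow> Wt t < m s" if "0 \<le> s" for s t
    using less_rearr_iff[OF hm\<mu> that, of "Wt t"] by (simp add: H_def m_def)
  have h_set: "{x \<in> I. s < \<bar>h x\<bar>} \<in> sets L" for s
  proof -
    have "{x \<in> space L. s < \<bar>h x\<bar>} \<in> sets L" by measurable
    then show ?thesis by simp
  qed
  have Markov: "ennreal (\<phi> s) * m s \<le> 1" if s: "0 \<le> s" for s
  proof -
    have "ennreal (\<phi> s) * m s = (\<integral>\<^sup>+t. ennreal (\<phi> s) * indicator {x \<in> I. s < \<bar>h x\<bar>} t \<partial>\<mu>)"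
      unfolding m_def using h_set by (subst nn_integral_cmult_indicator) auto
    also have "\<dots> = (\<integral>\<^sup>+t. ennreal (w t) * (ennreal (\<phi> s) * indicator {x \<in> I. s < \<bar>h x\<bar>} t) \<partial>L)"
      using h_set by (intro int) auto
    also have "\<dots> \<le> (\<integral>\<^sup>+t. ennreal (\<phi> \<bar>h t\<bar> * w t) \<partial>L)"
    proof (rule nn_integral_mono)
      fix t assume "t \<in> space L"
      then have t: "t \<in> I" by simp
      have "w t * \<phi> s \<le> \<phi> \<bar>h t\<bar> * w t" if "s < \<bar>h t\<bar>"
        using phi_mono[OF N s, of "\<bar>h t\<bar>"] that w_nonneg[OF t]
        by (subst mult.commute) (simp add: mult_right_mono)
      then show "ennreal (w t) * (ennreal (\<phi> s) * indicator {x \<in> I. s < \<bar>h x\<bar>} t) \<le> ennreal (\<phi> \<bar>h t\<bar> * w t)"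
        using w_nonneg[OF t] phi_nonneg[OF N s]
        by (auto split: split_indicator simp: ennreal_mult[symmetric] intro!: ennreal_leI)
    qed
    also have "\<dots> \<le> 1" by (rule h1)
    finally show ?thesis .
  qed
  have H_fin: "H t < \<infinity>" if t: "t \<in> I" for t
  proof -
    obtain \<delta> where \<delta>: "0 < \<delta>" "ennreal \<delta> \<le> Wt t"
      using Wt_pos[OF t] Wt_fin[OF t] that by (cases "Wt t") auto
    obtain S where S: "0 < S" "\<And>s. S \<le> s \<Longrightarrow> 1 * s \<le> \<phi> s" using phi_superlinear[OF N, of 1] by metis
    \<comment> \<open>The bound \<open>\<phi> s \<ge> s \<ge> 1 / \<delta>\<close> makes the Markov
      estimate yield \<open>m s \<le> \<delta> \<le> Wt t\<close>, so \<open>H t\<close> does not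
      exceed \<open>s\<close>.\<close>
    define s where "s = max S (1 / \<delta>)"
    have s: "0 \<le> s" "1 / \<delta> \<le> \<phi> s" using S(1) S(2)[of s] by (auto simp: s_def)
    have "\<not> ennreal s < H t"
    proof
      assume "ennreal s < H t"
      then have "ennreal \<delta> < m s" using H_less[OF s(1)] \<delta>(2) by simp
      moreover have p: "0 < \<phi> s" using s(2) \<delta>(1) by (smt (verit) zero_less_divide_1_iff)
      ultimately have "ennreal (\<phi> s) * ennreal \<delta> < ennreal (\<phi> s) * m s"
        by (intro ennreal_mult_strict_left_mono) auto
      then have "ennreal (\<phi> s * \<delta>) < 1" using Markov[OF s(1)] p \<delta>(1) by (simp add: ennreal_mult)
      moreover have "1 \<le> \<phi> s * \<delta>" using s(2) \<delta>(1) by (simp add: pos_divide_le_eq)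
      ultimately show False by (simp add: not_less[symmetric])
    qed
    then have "H t \<le> ennreal s" by simp
    then show ?thesis by (simp add: le_less_trans)
  qed
  define h' where "h' t = enn2real (H t)" for t
  have h'H: "ennreal (h' t) = H t" if "t \<in> I" for t using H_fin[OF that] by (simp add: h'_def)
  have h'0: "0 \<le> h' t" for t by (simp add: h'_def)
  have anti: "antimono_on I h'"
    unfolding h'_def using H_fin
    by (intro monotone_onI enn2real_mono) (auto simp: H_def intro!: rearr_antimono Wt_mono)
  then have h'm[measurable]: "h' \<in> borel_measurable L" by (rule antimono_on_measurable)
  have h'_level: "{t \<in> I. s < h' t} = {t \<in> I. Wt t < m s}" if "0 \<le> s" for s
    using H_less[OF that] h'H h'0 that by (metis (mono_tags, lifting) Collect_cong ennreal_less_iff)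
  have level: "emeasure \<mu> {t \<in> I. Wt t < m s} = m s" for s
  proof -
    have "emeasure \<mu> {t \<in> I. Wt t < m s} = min (m s) (emeasure \<mu> I)"
      unfolding Wt_def
    proof (rule emeasure_lower_mass_less)
      show "B \<inter> I \<in> sets \<mu>" if "B \<in> sets borel" for B using that borel_Int_in_leb_I by simp
      show "emeasure \<mu> {c} = 0" for c unfolding \<mu>_def by (rule emeasure_density_leb_I_singleton) measurable
      show "emeasure \<mu> {x \<in> I. x < t} < \<infinity>" if "t \<in> I" for t using Wt_fin[OF that] by (simp add: Wt_def)
    qed simp
    \<comment> \<open>The cap at the total mass is harmless, because \<open>m s\<close> is the mass
      of a subset.\<close>
    also have "m s \<le> emeasure \<mu> I"
      unfolding m_def using sets.top[of \<mu>] by (intro emeasure_mono) auto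
    then have "min (m s) (emeasure \<mu> I) = m s" by (rule min_absorb1)
    finally show ?thesis .
  qed
  have phim: "(\<lambda>t. \<phi> (h' t)) \<in> borel_measurable L" "(\<lambda>t. \<phi> \<bar>h t\<bar>) \<in> borel_measurable L"
    using h'0 by (auto intro!: phi_comp_measurable(1))
  have "(\<integral>\<^sup>+t. ennreal (\<phi> (h' t)) \<partial>\<mu>) \<le> (\<integral>\<^sup>+t. ennreal (\<phi> \<bar>h t\<bar>) \<partial>\<mu>)"
  proof (rule nn_integral_le_by_levels[OF sf sf])
    show "(\<lambda>t. ennreal (\<phi> (h' t))) \<in> borel_measurable \<mu>" "(\<lambda>t. ennreal (\<phi> \<bar>h t\<bar>)) \<in> borel_measurable \<mu>"
      unfolding meas using phim by measurable
    fix r :: real assume r: "0 < r"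
    obtain s where s: "0 \<le> s" "\<And>x. 0 \<le> x \<Longrightarrow> r < \<phi> x \<longleftrightarrow> s < x" using phi_level[OF N, of r] r by auto
    have "{x \<in> space \<mu>. ennreal r < ennreal (\<phi> (h' x))} = {t \<in> I. Wt t < m s}"
      using r s(2)[OF h'0] h'_level[OF s(1)] by (simp add: ennreal_less_iff)
    moreover have "{x \<in> space \<mu>. ennreal r < ennreal (\<phi> \<bar>h x\<bar>)} = {x \<in> I. s < \<bar>h x\<bar>}"
      using r s(2) by (simp add: ennreal_less_iff)
    ultimately show "emeasure \<mu> {x \<in> space \<mu>. ennreal r < ennreal (\<phi> (h' x))} \<le>
      emeasure \<mu> {x \<in> space \<mu>. ennreal r < ennreal (\<phi> \<bar>h x\<bar>)}"
      using level[of s] by (simp add: m_def)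
  qed
  then have c1: "(\<integral>\<^sup>+t. ennreal (\<phi> (h' t) * w t) \<partial>L) \<le> 1"
  proof -
    have eq: "(\<integral>\<^sup>+t. ennreal (\<phi> (u t)) \<partial>\<mu>) = (\<integral>\<^sup>+t. ennreal (\<phi> (u t) * w t) \<partial>L)"
      if "(\<lambda>t. \<phi> (u t)) \<in> borel_measurable L" "\<And>t. 0 \<le> u t" for u
      using that w_nonneg phi_nonneg[OF N]
      by (subst int) (auto intro!: nn_integral_cong simp: ennreal_mult mult.commute)
    assume "(\<integral>\<^sup>+t. ennreal (\<phi> (h' t)) \<partial>\<mu>) \<le> (\<integral>\<^sup>+t. ennreal (\<phi> \<bar>h t\<bar>) \<partial>\<mu>)"
    then show ?thesis using h1 by (simp add: eq phim h'0)
  qed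
  have "(\<integral>\<^sup>+t. F t * ennreal \<bar>h t\<bar> \<partial>\<mu>) \<le> (\<integral>\<^sup>+t. F t * ennreal (h' t) \<partial>\<mu>)"
  proof (rule nn_integral_mult_le_by_levels[OF sf sf])
    show "F \<in> borel_measurable \<mu>" "(\<lambda>t. ennreal \<bar>h t\<bar>) \<in> borel_measurable \<mu>"
      "F \<in> borel_measurable \<mu>" "(\<lambda>t. ennreal (h' t)) \<in> borel_measurable \<mu>"
      unfolding meas by measurable
    fix r s :: real assume r: "0 < r" and s: "0 < s"
    define J where "J = {x \<in> I. ennreal r < F x}"
    define T where "T = {t \<in> I. Wt t < m s}"
    have Js: "J \<in> sets L"
    proof -
      have "{x \<in> space L. ennreal r < F x} \<in> sets L" by measurable
      then show ?thesis by (simp add: J_def)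
    qed
    have l: "{x \<in> space \<mu>. ennreal r < F x \<and> ennreal s < ennreal \<bar>h x\<bar>} = J \<inter> {x \<in> I. s < \<bar>h x\<bar>}"
      using s by (auto simp: J_def ennreal_less_iff)
    have rr: "{x \<in> space \<mu>. ennreal r < F x \<and> ennreal s < ennreal (h' x)} = J \<inter> T"
      using h'_level[of s] s unfolding T_def J_def by (auto simp: ennreal_less_iff)
    \<comment> \<open>Both are initial segments of \<open>I\<close>. Either
      \<open>J \<inter> T\<close> is all of \<open>J\<close>, or it is \<open>T\<close>, whose mass
      \<open>m s\<close> is that of the whole set \<open>{|h| > s}\<close>.\<close>
    have "J \<subseteq> T \<or> T \<subseteq> J"
    proof (rule ccontr)
      assume "\<not> ?thesis"
      then obtain x y where xy: "x \<in> J" "x \<notin> T" "y \<in> T" "y \<notin> J" by auto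
      have I: "x \<in> I" "y \<in> I" using xy by (auto simp: J_def T_def)
      show False
      proof (cases "x \<le> y")
        case True
        then show False using xy I Wt_mono[of x y] by (auto simp: T_def)
      next
        case False
        then have "F x \<le> F y" using F I by (auto simp: monotone_on_def)
        then show False using xy I by (auto simp: J_def)
      qed
    qed
    then have "emeasure \<mu> (J \<inter> {x \<in> I. s < \<bar>h x\<bar>}) \<le> emeasure \<mu> (J \<inter> T)"
    proof
      assume "J \<subseteq> T"
      then show ?thesis using Js by (intro emeasure_mono) (auto simp: Int_absorb2)
    next
      assume "T \<subseteq> J"
      then have "emeasure \<mu> (J \<inter> T) = m s" using level[of s] by (simp add: T_def Int_absorb1)
      moreover have "emeasure \<mu> (J \<inter> {x \<in> I. s < \<bar>h x\<bar>}) \<le> m s"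
        unfolding m_def using h_set by (intro emeasure_mono) auto
      ultimately show ?thesis by simp
    qed
    then show "emeasure \<mu> {x \<in> space \<mu>. ennreal r < F x \<and> ennreal s < ennreal \<bar>h x\<bar>} \<le>
      emeasure \<mu> {x \<in> space \<mu>. ennreal r < F x \<and> ennreal s < ennreal (h' x)}"
      unfolding l rr .
  qed
  then have c2: "(\<integral>\<^sup>+t. F t * ennreal (\<bar>h t\<bar> * w t) \<partial>L) \<le> (\<integral>\<^sup>+t. F t * ennreal (h' t * w t) \<partial>L)"
  proof -
    have eq: "(\<integral>\<^sup>+t. F t * ennreal (u t) \<partial>\<mu>) = (\<integral>\<^sup>+t. F t * ennreal (u t * w t) \<partial>L)"
      if [measurable]: "u \<in> borel_measurable L" and "\<And>t. 0 \<le> u t" for u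
      using that w_nonneg by (subst int) (auto intro!: nn_integral_cong simp: ennreal_mult mult_ac)
    assume "(\<integral>\<^sup>+t. F t * ennreal \<bar>h t\<bar> \<partial>\<mu>) \<le> (\<integral>\<^sup>+t. F t * ennreal (h' t) \<partial>\<mu>)"
    then show ?thesis by (simp add: eq h'0)
  qed
  show thesis by (rule that[OF anti h'0 c1 c2])
qed

text \<open>On \<open>(0, t1)\<close> the integrand of the modular is at least \<open>w\<close>
  times the positive constant \<open>\<phi>\<^sub>*(c f\<^sup>*(t1))\<close>, so \<open>w\<close> is
  integrable there; to the right of \<open>t1\<close> it is bounded by \<open>w t1\<close>.\<close>

lemma Lambda_weight_integrable:
  assumes f: "f \<in> Lambda_space (complementary \<phi>) w a" and t1: "t1 \<in> I" "rearrangement a f t1 \<noteq> 0"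
    and t: "t \<in> I"
  shows "(\<integral>\<^sup>+x. ennreal (w x) * indicator {x \<in> I. x < t} x \<partial>L) < \<infinity>"
proof -
  define F where "F t = enn2real (rearrangement a f t)" for t
  have fin: "\<And>t. t \<in> I \<Longrightarrow> rearrangement a f t < \<infinity>" by (rule Lambda_spaceD(2)[OF f])
  obtain c where c: "0 < c" "(\<integral>\<^sup>+t. ennreal (complementary \<phi> (c * F t) * w t) \<partial>L) < \<infinity>"
    using Lambda_spaceD(3)[OF f] by (auto simp: F_def)
  have F1: "0 < F t1" using t1 fin[OF t1(1)] by (auto simp: F_def enn2real_positive_iff zero_less_iff_neq_zero)
  define p where "p = complementary \<phi> (c * F t1)"
  have p: "0 < p" unfolding p_def using c(1) F1 by (intro complementary_pos[OF N]) simp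
  have "ennreal p * (\<integral>\<^sup>+x. ennreal (w x) * indicator {x \<in> I. x < t1} x \<partial>L) =
      (\<integral>\<^sup>+x. ennreal p * (ennreal (w x) * indicator {x \<in> I. x < t1} x) \<partial>L)"
    by (rule nn_integral_cmult[symmetric]) measurable
  also have "\<dots> \<le> (\<integral>\<^sup>+t. ennreal (complementary \<phi> (c * F t) * w t) \<partial>L)"
  proof (rule nn_integral_mono)
    fix x assume "x \<in> space L"
    then have x: "x \<in> I" by simp
    have "p * w x \<le> complementary \<phi> (c * F x) * w x" if "x < t1"
    proof -
      have "F t1 \<le> F x"
        unfolding F_def using fin[OF x] that by (intro enn2real_mono rearrangement_antimono) auto
      then show ?thesis
        unfolding p_def using c(1) F1 w_nonneg[OF x] by (intro mult_right_mono complementary_mono[OF N]) auto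
    qed
    then show "ennreal p * (ennreal (w x) * indicator {x \<in> I. x < t1} x) \<le> ennreal (complementary \<phi> (c * F x) * w x)"
      using p w_nonneg[OF x] by (auto simp: ennreal_mult[symmetric] split: split_indicator intro!: ennreal_leI)
  qed
  also have "\<dots> < \<infinity>" by (rule c(2))
  finally have W1: "(\<integral>\<^sup>+x. ennreal (w x) * indicator {x \<in> I. x < t1} x \<partial>L) < \<infinity>"
    using p by (auto simp: ennreal_mult_less_top)
  have "(\<integral>\<^sup>+x. ennreal (w x) * indicator {x \<in> I. x < t} x \<partial>L) \<le>
    (\<integral>\<^sup>+x. ennreal (w x) * indicator {x \<in> I. x < t1} x + ennreal (w t1) * indicator {x \<in> I. x < t} x \<partial>L)"
    using w_antimono[OF t1(1)]
    by (intro nn_integral_mono) (auto split: split_indicator intro!: ennreal_leI)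
  also have "\<dots> = (\<integral>\<^sup>+x. ennreal (w x) * indicator {x \<in> I. x < t1} x \<partial>L) + ennreal (w t1) * ennreal t"
    by (subst nn_integral_add) (auto simp: nn_integral_cmult_indicator emeasure_leb_I_less[OF t])
  also have "\<dots> < \<infinity>" using W1 by (simp add: ennreal_mult_less_top)
  finally show ?thesis .
qed

lemma zero_M_norm: "(\<lambda>t. 0) \<in> M_class \<phi> w a" "M_norm \<phi> w a (\<lambda>t. 0) \<le> 1"
proof -
  have "rearrangement a (\<lambda>t. 0) t \<le> ennreal 0" for t
    by (subst rearrangement_le_iff) (auto simp: distr_fun_def)
  then have "rearrangement a (\<lambda>t. 0) t = 0" for t by simp
  then have "M_integrand \<phi> w a (\<lambda>t. 0) t = 0" for t
    unfolding M_integrand_def by (simp add: phi_0[OF N])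
  then have M: "M_modular \<phi> w a (\<lambda>t. 0) = 0"
    by (simp add: M_modular_def)
  show "(\<lambda>t. 0) \<in> M_class \<phi> w a"
    using M by (auto simp: M_class_def L0_def intro!: exI[of _ "1::real"])
  show "M_norm \<phi> w a (\<lambda>t. 0) \<le> 1"
    unfolding M_norm_def using M by (intro Inf_lower) (auto intro!: exI[of _ "1::real"])
qed

lemma orlicz_norm_le:
  assumes f: "f \<in> Lambda_space (complementary \<phi>) w a"
    and h: "h \<in> Lw_class \<phi> w a" "Lw_norm \<phi> w a h \<le> 1"
  shows "ereal (\<integral>t. enn2real (rearrangement a f t) * h t * w t \<partial>L) \<le>
    (SUP g\<in>{g \<in> M_class \<phi> w a. M_norm \<phi> w a g \<le> 1}. ereal (\<integral>t. f t * g t \<partial>L))"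
    (is "ereal ?X \<le> ?R")
proof (cases "\<exists>t\<in>I. rearrangement a f t \<noteq> 0")
  \<comment> \<open>For \<open>f\<^sup>* = 0\<close> the weight may fail to be integrable at 0, so
    the rearrangement is out of reach; the zero function settles this case.\<close>
  case False
  then have "?X = (\<integral>t. 0 \<partial>L)" by (intro Bochner_Integration.integral_cong) auto
  moreover have "ereal (\<integral>t. f t * 0 \<partial>L) \<le> ?R"
    using zero_M_norm by (intro SUP_upper2[of "\<lambda>t. 0"]) auto
  ultimately show ?thesis by simp
next
  case True
  then obtain t1 where t1: "t1 \<in> I" "rearrangement a f t1 \<noteq> 0" by auto
  have fm[measurable]: "f \<in> borel_measurable L" by (rule Lambda_spaceD(1)[OF f])
  have fK: "f \<in> kothe_dual a (M_class \<phi> w a)" using f by (simp add: kothe_dual_M_class)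
  have hm[measurable]: "h \<in> borel_measurable L" using h(1) by (simp add: Lw_class_def L0_def)
  note Fm[measurable] = rearrangement_measurable_leb_I[OF fm]
  obtain s0 where s0: "0 \<le> s0" "distr_fun a f s0 < \<infinity>" using kothe_dual_distr_finite[OF fK] .
  \<comment> \<open>One factor \<open>b\<close> is spent because norm at most 1, an infimum, gives
    modular at most 1 only after enlarging the scale beyond 1; the other is lost in the realization
    of \<open>h' w\<close>.\<close>
  have b: "ereal (?X / (b * b)) \<le> ?R" if b: "1 < b" for b
  proof -
    obtain e where e: "0 < e" "e < b" "(\<integral>\<^sup>+t. ennreal (\<phi> (\<bar>h t\<bar> / e) * w t) \<partial>L) \<le> 1"
    proof -
      have "Lw_norm \<phi> w a h < ennreal b" using h(2) b by (simp add: le_less_trans)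
      then show thesis
        unfolding Lw_norm_def Inf_less_iff using that b by (auto simp: ennreal_less_iff)
    qed
    have "(\<integral>\<^sup>+t. ennreal (\<phi> \<bar>h t / b\<bar> * w t) \<partial>L) \<le> (\<integral>\<^sup>+t. ennreal (\<phi> (\<bar>h t\<bar> / e) * w t) \<partial>L)"
      using e b w_nonneg
      by (intro nn_integral_mono ennreal_leI mult_right_mono phi_mono[OF N]) (auto intro!: divide_left_mono)
    also have "\<dots> \<le> 1" by (rule e(3))
    finally have hb: "(\<integral>\<^sup>+t. ennreal (\<phi> \<bar>h t / b\<bar> * w t) \<partial>L) \<le> 1" .
    have hbm: "(\<lambda>t. h t / b) \<in> borel_measurable L" by measurable
    obtain h' where h': "antimono_on I h'" "\<And>t. t \<in> I \<Longrightarrow> 0 \<le> h' t"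
      "(\<integral>\<^sup>+t. ennreal (\<phi> (h' t) * w t) \<partial>L) \<le> 1"
      "(\<integral>\<^sup>+t. rearrangement a f t * ennreal (\<bar>h t / b\<bar> * w t) \<partial>L) \<le>
        (\<integral>\<^sup>+t. rearrangement a f t * ennreal (h' t * w t) \<partial>L)"
    proof (rule weighted_rearrangement[OF hbm hb _ Fm])
      show "(\<integral>\<^sup>+x. ennreal (w x) * indicator {x \<in> I. x < t} x \<partial>L) < \<infinity>" if "t \<in> I" for t
        by (rule Lambda_weight_integrable[OF f t1 that])
      show "antimono_on I (rearrangement a f)" by (intro monotone_onI rearrangement_antimono)
    qed (rule that)
    have k: "(\<lambda>t. h' t * w t) \<in> K"
      unfolding K_def
    proof (intro CollectI conjI ballI)
      show "antimono_on I (\<lambda>t. h' t * w t)"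
        using h'(1,2) w_antimono w_nonneg by (auto simp: monotone_on_def intro!: mult_mono)
      show "0 \<le> h' t * w t" if "t \<in> I" for t using h'(2) w_nonneg that by simp
      have "(\<integral>\<^sup>+t. k_integrand (\<lambda>t. h' t * w t) t \<partial>L) = (\<integral>\<^sup>+t. ennreal (\<phi> (h' t) * w t) \<partial>L)"
        by (intro nn_integral_cong) (auto simp: k_integrand_def)
      then show "(\<integral>\<^sup>+t. k_integrand (\<lambda>t. h' t * w t) t \<partial>L) \<le> 1" using h'(3) by simp
    qed
    have fL: "f \<in> L0 a" by (simp add: L0_def)
    obtain g where g: "g \<in> M_class \<phi> w a" "M_norm \<phi> w a g \<le> 1" "\<And>t. 0 \<le> f t * g t"
      "(\<integral>\<^sup>+t. rearrangement a f t * ennreal (h' t * w t) \<partial>L) \<le> ennreal b * (\<integral>\<^sup>+x. ennreal (f x * g x) \<partial>L)"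
      by (rule realize_K[OF fL s0 k b]) (rule that)
    define Y where "Y = (\<integral>t. f t * g t \<partial>L)"
    have Y0: "0 \<le> Y" unfolding Y_def using g(3) by (intro Bochner_Integration.integral_nonneg)
    \<comment> \<open>If the integrand were not integrable, the Bochner integral would be 0 by
      default and the estimate would still hold.\<close>
    have "ennreal ?X \<le> (\<integral>\<^sup>+t. ennreal \<bar>enn2real (rearrangement a f t) * h t * w t\<bar> \<partial>L)"
    proof (cases "integrable L (\<lambda>t. enn2real (rearrangement a f t) * h t * w t)")
      case True
      have "ennreal ?X \<le> ennreal (norm ?X)" by (rule ennreal_leI) simp
      also have "\<dots> \<le> (\<integral>\<^sup>+t. ennreal \<bar>enn2real (rearrangement a f t) * h t * w t\<bar> \<partial>L)"
        using integral_norm_bound_ennreal[OF True] by simp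
      finally show ?thesis .
    qed (simp add: not_integrable_integral_eq)
    also have "\<dots> = (\<integral>\<^sup>+t. ennreal b * (rearrangement a f t * ennreal (\<bar>h t / b\<bar> * w t)) \<partial>L)"
    proof (rule nn_integral_cong)
      fix t assume "t \<in> space L"
      then have t: "t \<in> I" by simp
      obtain r where r: "rearrangement a f t = ennreal r" "0 \<le> r"
        using Lambda_spaceD(2)[OF f t] by (cases "rearrangement a f t") auto
      define y where "y = \<bar>h t / b\<bar> * w t"
      have y: "0 \<le> y" using w_nonneg[OF t] by (simp add: y_def)
      have "\<bar>r * h t * w t\<bar> = b * (r * y)"
        using b r w_nonneg[OF t] by (simp add: abs_mult y_def)
      then have "ennreal \<bar>r * h t * w t\<bar> = ennreal b * (ennreal r * ennreal y)"
        using b r y by (simp add: ennreal_mult)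
      then show "ennreal \<bar>enn2real (rearrangement a f t) * h t * w t\<bar> =
          ennreal b * (rearrangement a f t * ennreal (\<bar>h t / b\<bar> * w t))"
        using r by (simp add: y_def)
    qed
    also have "\<dots> = ennreal b * (\<integral>\<^sup>+t. rearrangement a f t * ennreal (\<bar>h t / b\<bar> * w t) \<partial>L)"
      by (rule nn_integral_cmult) measurable
    also have "\<dots> \<le> ennreal b * (ennreal b * (\<integral>\<^sup>+x. ennreal (f x * g x) \<partial>L))"
      using order_trans[OF h'(4) g(4)] by (rule mult_left_mono) simp
    also have "\<dots> = ennreal (b * b * Y)"
      using kothe_dual_integral_finite[OF fK g(1,3)] b Y0
      by (simp add: Y_def[symmetric] ennreal_mult[symmetric] mult.assoc)
    finally have "ennreal ?X \<le> ennreal (b * b * Y)" .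
    moreover have "0 \<le> b * b * Y" using b Y0 by simp
    ultimately have "?X \<le> b * b * Y" by (simp only: ennreal_le_iff)
    then have "?X / (b * b) \<le> Y" using b by (simp add: pos_divide_le_eq mult.commute)
    then have "ereal (?X / (b * b)) \<le> ereal Y" by simp
    also have "\<dots> \<le> ?R" unfolding Y_def using g(1,2) by (intro SUP_upper) auto
    finally show ?thesis .
  qed
  have "(\<lambda>n. 1 + 1 / real (Suc n)) \<longlonglongrightarrow> 1 + 0"
    by (intro tendsto_add tendsto_const LIMSEQ_Suc[OF lim_const_over_n])
  then have "(\<lambda>n. ?X / ((1 + 1 / real (Suc n)) * (1 + 1 / real (Suc n)))) \<longlonglongrightarrow> ?X / ((1 + 0) * (1 + 0))"
    by (intro tendsto_divide tendsto_mult tendsto_const) auto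
  then have "(\<lambda>n. ereal (?X / ((1 + 1 / real (Suc n)) * (1 + 1 / real (Suc n))))) \<longlonglongrightarrow> ereal ?X"
    by simp
  then show ?thesis by (rule LIMSEQ_le_const2) (auto intro!: b)
qed

lemma orlicz_norm_eq:
  assumes f: "f \<in> Lambda_space (complementary \<phi>) w a"
  shows "Lambda_orlicz_norm \<phi> w a f =
    (SUP g\<in>{g \<in> M_class \<phi> w a. M_norm \<phi> w a g \<le> 1}. ereal (\<integral>t. f t * g t \<partial>L))"
proof (rule antisym)
  show "Lambda_orlicz_norm \<phi> w a f \<le>
    (SUP g\<in>{g \<in> M_class \<phi> w a. M_norm \<phi> w a g \<le> 1}. ereal (\<integral>t. f t * g t \<partial>L))"
    unfolding Lambda_orlicz_norm_def using orlicz_norm_le[OF f] by (intro SUP_least) auto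
qed (use integral_le_orlicz_norm[OF f] in \<open>auto intro!: SUP_least\<close>)

end

theorem theorem3p10:
  fixes \<phi> w :: "real \<Rightarrow> real" and a :: ereal
  assumes "N_function \<phi>"
    and "0 < a"
    and "weight_function a w"
    and "\<exists>t\<in>einterval 0 a. w t \<noteq> 0"
  shows "kothe_dual a (M_class \<phi> w a) = Lambda_space (complementary \<phi>) w a \<and>
    (\<forall>f\<in>Lambda_space (complementary \<phi>) w a.
       Lambda_orlicz_norm \<phi> w a f =
       (SUP g\<in>{g \<in> M_class \<phi> w a. M_norm \<phi> w a g \<le> 1}.
          ereal (\<integral> t. f t * g t \<partial>leb_I a)))"
proof -
  interpret orlicz_weight \<phi> w a using assms by unfold_locales
  show ?thesis using kothe_dual_M_class orlicz_norm_eq by blast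
qed

end
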